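(* Let $n\ge 1$, $m\ge 1$, $T>0$, let $\Omega\subset\mathbb{R}^n$ be a bounded domain with piecewise smooth boundary, let $\Gamma\subset\partial\Omega$ be a nonempty connected relatively open subset of $\partial\Omega$, and let $\{B_j\}_{j=0}^{2m-1}$ be a Dirichlet system of order $2m-1$ near $\partial\Omega$. Assume that $\Gamma$ has at least one interior point in the relative topology of $\partial\Omega$. Then for all given functions $f\in C(\overline{\Omega_T})$ and $u_j\in C^{2m-j+1,0}(\overline{\Gamma_T})$, $1\le j\le 2m$, there is at most one function $$u\in C^{2m,1}(\Omega_T)\cap C^{2m-1,0}((\Omega\cup\overline\Gamma)_T)$$ satisfying $$\partial_t u+(-\Delta)^m u=f \ \text{ in } \Omega_T,$$ $$B_j u(x,t)=u_{j+1}(x,t)\ \text{ for all } (x,t)\in \overline\Gamma\times(0,T) \text{ and all } 0\le j\le 2m-1.$$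
   Context: $\Delta=\sum_{j=1}^n\partial_{x_j}^2$ is the Laplace operator in $\mathbb{R}^n$. For a set $A\subset\mathbb{R}^n$ put $A_T=A\times(0,T)$; thus $\Omega_T=\Omega\times(0,T)$, $\Gamma_T=\Gamma\times(0,T)$, $\overline{\Gamma_T}=\overline\Gamma\times[0,T]$. Function spaces: $C^{2m,1}(\Omega_T)$ is the set of continuous functions on $\Omega_T$ whose partial derivatives $\partial_t^j\partial_x^\alpha u$ with $|\alpha|+2mj\le 2m$ exist and are continuous in $\Omega_T$. For $k\in\mathbb{Z}_+$, $C^{k,0}(\Omega_T)$ is the set of continuous functions on $\Omega_T$ with continuous derivatives $\partial_x^\beta u$, $|\beta|\le k$. For $S\subset\partial\Omega$, $C^{k,0}((\Omega\cup S)_T)$ is the set of $u\in C^{k,0}(\Omega_T)$ whose derivatives $\partial_x^\beta u$, $|\beta|\le k$, extend continuously to $(\Omega\cup S)_T$. $C^{k,0}(\overline{\Gamma_T})$ is the analogous space of functions on $\overline{\Gamma}\times[0,T]$ (continuous, with tangential derivatives in the space variables up to order $k$ that are continuous on $\overline{\Gamma}\times[0,T]$). A Dirichlet system $\{B_j\}_{j=0}^{2m-1}$ of order $2m-1$ is a family of differential operators (in $x$) with smooth coefficients near $\partial\Omega$ such that $\mathrm{ord}\,B_j=j$ and, for each $x\in\partial\Omega$, the characteristic polynomial (principal symbol) $\sigma(B_j)(x,\zeta)$ does not vanish at $\zeta=\nu(x)$, where $\nu(x)$ is the exterior unit normal vector to $\partial\Omega$ at $x$. *)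

theory Defs
  imports "HOL-Analysis.Analysis"
begin

definition dirderiv ::
  "'a::real_normed_vector \<Rightarrow> ('a \<Rightarrow> 'b::real_normed_vector) \<Rightarrow> 'a \<Rightarrow> 'b" where
  "dirderiv v f p = vector_derivative (\<lambda>s. f (p + s *\<^sub>R v)) (at 0)"

text \<open>The iterated derivative \<open>\<partial>\<^sub>v\<^sub>1 (\<partial>\<^sub>v\<^sub>2 (\<dots> f))\<close> along a list of directions is
  \<open>foldr dirderiv vs f\<close>.  Since \<^const>\<open>vector_derivative\<close> is total, existence on the open set
  \<open>W\<close> of all the derivatives met on the way is recorded separately.\<close>

primrec derivs_exist ::
  "'a::real_normed_vector set \<Rightarrow> 'a list \<Rightarrow> ('a \<Rightarrow> 'b::real_normed_vector) \<Rightarrow> bool" where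
  "derivs_exist W [] f \<longleftrightarrow> True"
| "derivs_exist W (v # vs) f \<longleftrightarrow> derivs_exist W vs f \<and>
     (\<forall>p\<in>W. (\<lambda>s. foldr dirderiv vs f (p + s *\<^sub>R v)) differentiable (at 0))"

definition cont_deriv ::
  "'a::real_normed_vector set \<Rightarrow> 'a list \<Rightarrow> ('a \<Rightarrow> 'b::real_normed_vector) \<Rightarrow> bool" where
  "cont_deriv W vs f \<longleftrightarrow> derivs_exist W vs f \<and> continuous_on W (foldr dirderiv vs f)"

definition smooth_fun_on ::
  "'a::euclidean_space set \<Rightarrow> ('a \<Rightarrow> 'b::real_normed_vector) \<Rightarrow> bool" where
  "smooth_fun_on W f \<longleftrightarrow> (\<forall>vs. set vs \<subseteq> Basis \<longrightarrow> cont_deriv W vs f)"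

definition gradient :: "(real^'n \<Rightarrow> real) \<Rightarrow> real^'n \<Rightarrow> real^'n" where
  "gradient \<phi> x = (\<chi> i. dirderiv (axis i 1) \<phi> x)"

text \<open>Near a smooth boundary point the domain lies on one side of a smooth hypersurface.\<close>

definition local_defining ::
  "(real^'n) set \<Rightarrow> real^'n \<Rightarrow> (real^'n) set \<Rightarrow> (real^'n \<Rightarrow> real) \<Rightarrow> bool" where
  "local_defining \<Omega> x U \<phi> \<longleftrightarrow>
     open U \<and> x \<in> U \<and> smooth_fun_on U \<phi> \<and> (\<forall>y\<in>U. gradient \<phi> y \<noteq> 0) \<and>
     \<Omega> \<inter> U = {y \<in> U. \<phi> y < 0} \<and> frontier \<Omega> \<inter> U = {y \<in> U. \<phi> y = 0}"

definition smooth_boundary_part :: "(real^'n) set \<Rightarrow> (real^'n) set" where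
  "smooth_boundary_part \<Omega> = {x \<in> frontier \<Omega>. \<exists>U \<phi>. local_defining \<Omega> x U \<phi>}"

text \<open>The direction of the gradient does not depend on the choice of the defining function;
  the value is meaningful only on \<^const>\<open>smooth_boundary_part\<close>.\<close>

definition exterior_normal :: "(real^'n) set \<Rightarrow> real^'n \<Rightarrow> real^'n" where
  "exterior_normal \<Omega> x =
     (THE \<nu>. \<exists>U \<phi>. local_defining \<Omega> x U \<phi> \<and> \<nu> = gradient \<phi> x /\<^sub>R norm (gradient \<phi> x))"

text \<open>The boundary is the union of the closures of finitely many connected smooth open pieces.
  Nothing is required at the edges where the pieces meet, so edges, corners, conical points
  and cusps are all allowed.\<close>

definition piecewise_smooth_boundary :: "(real^'n) set \<Rightarrow> bool" where
  "piecewise_smooth_boundary \<Omega> \<longleftrightarrow>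
     (\<exists>\<S>. finite \<S> \<and>
        (\<forall>S\<in>\<S>. openin (top_of_set (frontier \<Omega>)) S \<and> connected S \<and> S \<subseteq> smooth_boundary_part \<Omega>) \<and>
        frontier \<Omega> = (\<Union>S\<in>\<S>. closure S))"

definition bounded_domain :: "(real^'n) set \<Rightarrow> bool" where
  "bounded_domain \<Omega> \<longleftrightarrow> open \<Omega> \<and> connected \<Omega> \<and> \<Omega> \<noteq> {} \<and> bounded \<Omega>"

definition cyl :: "(real^'n) set \<Rightarrow> real \<Rightarrow> ((real^'n) \<times> real) set" where
  "cyl A T = A \<times> {0<..<T}"

definition dir_x :: "'n::finite \<Rightarrow> (real^'n) \<times> real" where
  "dir_x i = (axis i 1, 0)"

definition dir_t :: "(real^'n) \<times> real" where
  "dir_t = (0, 1)"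

text \<open>In the next definitions a spatial derivative of order \<open>k\<close> is indexed by a list of \<open>k\<close>
  coordinates, i.e. the mixed partial derivatives are required to exist and be continuous
  for every order of differentiation.\<close>

definition C_2m_1 :: "nat \<Rightarrow> (real^'n) set \<Rightarrow> real \<Rightarrow> ((real^'n) \<times> real \<Rightarrow> complex) set" where
  "C_2m_1 m \<Omega> T = {u. \<forall>j w. length w + 2 * m * j \<le> 2 * m \<longrightarrow>
     cont_deriv (cyl \<Omega> T) (replicate j dir_t @ map dir_x w) u}"

definition C_k_0 :: "nat \<Rightarrow> (real^'n) set \<Rightarrow> real \<Rightarrow> ((real^'n) \<times> real \<Rightarrow> complex) set" where
  "C_k_0 k \<Omega> T = {u. \<forall>w. length w \<le> k \<longrightarrow> cont_deriv (cyl \<Omega> T) (map dir_x w) u}"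

definition C_k_0_upto ::
  "nat \<Rightarrow> (real^'n) set \<Rightarrow> (real^'n) set \<Rightarrow> real \<Rightarrow> ((real^'n) \<times> real \<Rightarrow> complex) set" where
  "C_k_0_upto k \<Omega> S T = {u \<in> C_k_0 k \<Omega> T. \<forall>w. length w \<le> k \<longrightarrow>
     (\<exists>h. continuous_on (cyl (\<Omega> \<union> S) T) h \<and>
        (\<forall>p\<in>cyl \<Omega> T. h p = foldr dirderiv (map dir_x w) u p))}"

text \<open>Tangential derivatives on a relatively open part \<open>M\<close> of the smooth part of the boundary:
  the derivative along the tangential projection \<open>e\<^sub>i - \<nu>\<^sub>i \<nu>\<close> of the \<open>i\<close>-th unit vector.
  A Frechet derivative within \<open>M\<close> is unique on the tangent space only, so that is the only
  place where it is evaluated.  These derivatives, over all \<open>i\<close>, span all tangential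
  derivatives.\<close>

definition tangent_dir :: "(real^'n) set \<Rightarrow> 'n \<Rightarrow> real^'n \<Rightarrow> real^'n" where
  "tangent_dir \<Omega> i x = axis i 1 - (exterior_normal \<Omega> x $ i) *\<^sub>R exterior_normal \<Omega> x"

definition tangent_deriv :: "(real^'n) set \<Rightarrow> (real^'n) set \<Rightarrow> 'n \<Rightarrow>
    ((real^'n) \<times> real \<Rightarrow> complex) \<Rightarrow> (real^'n) \<times> real \<Rightarrow> complex" where
  "tangent_deriv \<Omega> M i g =
     (\<lambda>(x, t). frechet_derivative (\<lambda>y. g (y, t)) (at x within M) (tangent_dir \<Omega> i x))"

primrec tangent_derivs_exist :: "(real^'n) set \<Rightarrow> (real^'n) set \<Rightarrow> real \<Rightarrow> 'n list \<Rightarrow>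
    ((real^'n) \<times> real \<Rightarrow> complex) \<Rightarrow> bool" where
  "tangent_derivs_exist \<Omega> M T [] g \<longleftrightarrow> True"
| "tangent_derivs_exist \<Omega> M T (i # w) g \<longleftrightarrow> tangent_derivs_exist \<Omega> M T w g \<and>
     (\<forall>x\<in>M. \<forall>t\<in>{0..T}.
        (\<lambda>y. foldr (tangent_deriv \<Omega> M) w g (y, t)) differentiable (at x within M))"

text \<open>The space \<open>C\<close> of order \<open>(k, 0)\<close> on \<open>closure \<Gamma> \<times> {0..T}\<close>.  Tangential derivatives only make
  sense where the boundary has a tangent space: they are taken at the smooth boundary points of
  \<open>\<Gamma>\<close> and have to extend continuously to all smooth boundary points of \<open>closure \<Gamma>\<close>.  At edge
  points only the function itself is required to be continuous.\<close>

definition C_k_0_bdry ::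
  "nat \<Rightarrow> (real^'n) set \<Rightarrow> (real^'n) set \<Rightarrow> real \<Rightarrow> ((real^'n) \<times> real \<Rightarrow> complex) set" where
  "C_k_0_bdry k \<Omega> \<Gamma> T = {g. continuous_on (closure \<Gamma> \<times> {0..T}) g \<and>
     (\<forall>w. length w \<le> k \<longrightarrow>
        tangent_derivs_exist \<Omega> (\<Gamma> \<inter> smooth_boundary_part \<Omega>) T w g \<and>
        (\<exists>h. continuous_on ((closure \<Gamma> \<inter> smooth_boundary_part \<Omega>) \<times> {0..T}) h \<and>
           (\<forall>q\<in>(\<Gamma> \<inter> smooth_boundary_part \<Omega>) \<times> {0..T}.
              h q = foldr (tangent_deriv \<Omega> (\<Gamma> \<inter> smooth_boundary_part \<Omega>)) w g q)))}"

definition mi_order :: "('n::finite \<Rightarrow> nat) \<Rightarrow> nat" where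
  "mi_order \<alpha> = (\<Sum>i\<in>UNIV. \<alpha> i)"

definition mi_power :: "real^'n \<Rightarrow> ('n \<Rightarrow> nat) \<Rightarrow> real" where
  "mi_power \<zeta> \<alpha> = (\<Prod>i\<in>UNIV. (\<zeta> $ i) ^ \<alpha> i)"

text \<open>The index type carries no linear order, so the order of differentiation in \<open>\<partial>\<^sub>x\<^sup>\<alpha>\<close> is an
  arbitrary fixed one; it does not matter for functions with continuous mixed derivatives.\<close>

definition mi_word :: "('n::finite \<Rightarrow> nat) \<Rightarrow> 'n list" where
  "mi_word \<alpha> = (SOME w. \<forall>i. count_list w i = \<alpha> i)"

definition partial_x ::
  "('n \<Rightarrow> nat) \<Rightarrow> ((real^'n) \<times> real \<Rightarrow> complex) \<Rightarrow> (real^'n) \<times> real \<Rightarrow> complex" where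
  "partial_x \<alpha> u = foldr dirderiv (map dir_x (mi_word \<alpha>)) u"

text \<open>A differential operator \<open>\<Sum>\<^sub>\<alpha> b\<^sub>\<alpha>(x) \<partial>\<^sub>x\<^sup>\<alpha>\<close> is given by its coefficients.\<close>

type_synonym 'n diff_op = "('n \<Rightarrow> nat) \<Rightarrow> real^'n \<Rightarrow> complex"

definition op_order_on :: "(real^'n) set \<Rightarrow> 'n::finite diff_op \<Rightarrow> nat \<Rightarrow> bool" where
  "op_order_on V b k \<longleftrightarrow>
     (\<forall>\<alpha>. mi_order \<alpha> > k \<longrightarrow> (\<forall>x\<in>V. b \<alpha> x = 0)) \<and>
     (\<exists>\<alpha>. mi_order \<alpha> = k \<and> (\<exists>x\<in>V. b \<alpha> x \<noteq> 0))"

definition principal_symbol ::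
  "nat \<Rightarrow> 'n::finite diff_op \<Rightarrow> real^'n \<Rightarrow> real^'n \<Rightarrow> complex" where
  "principal_symbol k b x \<zeta> =
     (\<Sum>\<alpha> | mi_order \<alpha> = k. b \<alpha> x * complex_of_real (mi_power \<zeta> \<alpha>))"

text \<open>A Dirichlet system of order \<open>r - 1\<close>.  The symbol condition is imposed at the boundary points
  at which the normal exists.\<close>

definition dirichlet_system :: "(real^'n) set \<Rightarrow> nat \<Rightarrow> (nat \<Rightarrow> 'n::finite diff_op) \<Rightarrow> bool" where
  "dirichlet_system \<Omega> r B \<longleftrightarrow>
     (\<exists>V. open V \<and> frontier \<Omega> \<subseteq> V \<and>
        (\<forall>j<r. (\<forall>\<alpha>. smooth_fun_on V (B j \<alpha>)) \<and> op_order_on V (B j) j)) \<and>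
     (\<forall>j<r. \<forall>x\<in>smooth_boundary_part \<Omega>. principal_symbol j (B j) x (exterior_normal \<Omega> x) \<noteq> 0)"

text \<open>The value at a point \<open>q\<close> of the lateral boundary of an operator of order \<open>k\<close>: the derivatives
  of \<open>u\<close> are replaced by their continuous extensions from the open cylinder.\<close>

definition boundary_op :: "(real^'n) set \<Rightarrow> real \<Rightarrow> nat \<Rightarrow> 'n::finite diff_op \<Rightarrow>
    ((real^'n) \<times> real \<Rightarrow> complex) \<Rightarrow> (real^'n) \<times> real \<Rightarrow> complex" where
  "boundary_op \<Omega> T k b u q =
     (\<Sum>\<alpha> | mi_order \<alpha> \<le> k. b \<alpha> (fst q) * Lim (at q within cyl \<Omega> T) (partial_x \<alpha> u))"

definition laplace ::
  "((real^'n) \<times> real \<Rightarrow> complex) \<Rightarrow> (real^'n) \<times> real \<Rightarrow> complex" where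
  "laplace u p = (\<Sum>i\<in>UNIV. dirderiv (dir_x i) (dirderiv (dir_x i) u) p)"

definition neg_laplace_pow ::
  "nat \<Rightarrow> ((real^'n) \<times> real \<Rightarrow> complex) \<Rightarrow> (real^'n) \<times> real \<Rightarrow> complex" where
  "neg_laplace_pow m = (\<lambda>v p. - laplace v p) ^^ m"

definition cauchy_solution :: "nat \<Rightarrow> (real^'n) set \<Rightarrow> (real^'n) set \<Rightarrow> real \<Rightarrow>
    (nat \<Rightarrow> 'n::finite diff_op) \<Rightarrow> ((real^'n) \<times> real \<Rightarrow> complex) \<Rightarrow>
    (nat \<Rightarrow> (real^'n) \<times> real \<Rightarrow> complex) \<Rightarrow> ((real^'n) \<times> real \<Rightarrow> complex) \<Rightarrow> bool" where
  "cauchy_solution m \<Omega> \<Gamma> T B f g u \<longleftrightarrow>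
     u \<in> C_2m_1 m \<Omega> T \<inter> C_k_0_upto (2 * m - 1) \<Omega> (closure \<Gamma>) T \<and>
     (\<forall>p\<in>cyl \<Omega> T. dirderiv dir_t u p + neg_laplace_pow m u p = f p) \<and>
     (\<forall>j\<le>2 * m - 1. \<forall>q\<in>cyl (closure \<Gamma>) T. boundary_op \<Omega> T j (B j) u q = g (j + 1) q)"

end

theory Submission
  imports Defs
begin

text \<open>Put \<open>w = u - v\<close>; it solves \<open>\<partial>\<^sub>t w + (- \<Delta>)\<^sup>m w = 0\<close> and has vanishing boundary data on \<open>\<Gamma>\<close>.  The proof
rests on the fact that \<open>\<partial>\<^sub>t\<close> has order \<open>1\<close> while the space part has order \<open>2m \<ge> 2\<close>, so that time
averages of \<open>w\<close> are as good as real analytic functions of \<open>x\<close>.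

Boundary data.  At a smooth point of \<open>\<Gamma>\<close> all space derivatives of \<open>w\<close> of order at most \<open>2m - 1\<close>
vanish (\<open>cauchy_data_vanish\<close>).  If the derivatives of order \<open>j - 1\<close> vanish along \<open>\<Gamma>\<close>, then their
gradients are normal to \<open>\<Gamma>\<close> (\<open>boundary_gradient_normal\<close>); together with the symmetry of mixed
derivatives this leaves a single unknown number at each point, the normal derivative of order \<open>j\<close>,
and \<open>B\<^sub>j\<close> multiplies it by its principal symbol at the normal, which is not zero.  Hence \<open>w\<close>,
extended by zero across \<open>\<Gamma>\<close>, keeps continuous space derivatives up to order \<open>2m - 1\<close>.

Time averages.  Let \<open>\<theta>\<close> be a smooth bump on \<open>[a, b] \<subseteq> (0, T)\<close> with \<open>\<bar>\<theta>\<^sup>(\<^sup>k\<^sup>)\<bar> \<le> 4\<^sup>k (2k)!\<close>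
(\<open>gevrey_bump\<close>).  The functions \<open>G\<^sub>m\<^sub>k\<^sub>+\<^sub>i(x) = \<integral> (- \<Delta>)\<^sup>i w(x, t) \<theta>\<^sup>(\<^sup>k\<^sup>)(t) dt\<close>, \<open>i < m\<close>, satisfy
\<open>- \<Delta> G\<^sub>j = G\<^sub>j\<^sub>+\<^sub>1\<close>: inside a block this is the definition, and from one block to the next the equation
for \<open>w\<close> and an integration by parts in \<open>t\<close> turn \<open>(- \<Delta>)\<^sup>m w\<close> into a derivative of \<open>\<theta>\<close>.  The equations
hold weakly across \<open>\<Gamma>\<close> as well, because each \<open>G\<^sub>j\<close> vanishes there together with its gradient
(\<open>weak_poissonI\<close>).  Moreover \<open>\<bar>G\<^sub>j\<bar> \<le> B A\<^sup>j (2j)!\<close> locally (\<open>avg_chain\<close>).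

Unique continuation.  Such a chain cannot vanish on a small ball without vanishing on a larger one
(\<open>zero_ball_grow\<close>).  Let all \<open>G\<^sub>j\<close> vanish near \<open>c\<close>.  A radial function about \<open>c\<close> can be written, away
from \<open>c\<close>, as the \<open>N\<close>-th iterated Laplacian of a radial function that vanishes to high order on an
outer sphere of radius \<open>\<surd>S\<close> and is of size \<open>(K S\<^sup>2)\<^sup>N / (2N)!\<close>.  Integrating by parts \<open>N\<close> times and letting \<open>N\<close>
grow, every radial moment of \<open>G\<^sub>j\<close> about \<open>c\<close> vanishes.  The centre may be moved; differentiating in
the centre gives all polynomial moments, and the Weierstrass theorem gives \<open>G\<^sub>j = 0\<close>.

Outside \<open>\<Omega>\<close> the chain is zero, so it is zero near a smooth point of \<open>\<Gamma>\<close>, and connectedness of \<open>\<Omega>\<close>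
carries this through \<open>\<Omega>\<close> (\<open>avg_zero\<close>).  As the bump may be concentrated at any time, \<open>w = 0\<close>.\<close>

section \<open>Derivatives along a direction and integrals of functions with bounded support\<close>

definition partial_on :: "'a::real_normed_vector set \<Rightarrow> 'a \<Rightarrow> ('a \<Rightarrow> 'b::real_normed_vector) \<Rightarrow> ('a \<Rightarrow> 'b) \<Rightarrow> bool" where
  "partial_on W v f f' \<longleftrightarrow> (\<forall>p\<in>W. ((\<lambda>s. f (p + s *\<^sub>R v)) has_vector_derivative f' p) (at 0))"

lemma partial_on_line:
  assumes "partial_on W v f f'" and "p + s *\<^sub>R v \<in> W"
  shows "((\<lambda>s. f (p + s *\<^sub>R v)) has_vector_derivative f' (p + s *\<^sub>R v)) (at s within X)"
proof -
  have "((\<lambda>r. f ((p + s *\<^sub>R v) + r *\<^sub>R v)) has_vector_derivative f' (p + s *\<^sub>R v)) (at (s - s))"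
    using assms by (simp add: partial_on_def)
  moreover have "((\<lambda>r. r - s) has_vector_derivative 1) (at s)"
    by (auto intro!: derivative_eq_intros)
  ultimately have "((\<lambda>r. f ((p + s *\<^sub>R v) + r *\<^sub>R v)) \<circ> (\<lambda>r. r - s) has_vector_derivative 1 *\<^sub>R f' (p + s *\<^sub>R v)) (at s)"
    by (intro vector_diff_chain_at) auto
  moreover have "(\<lambda>r. f ((p + s *\<^sub>R v) + r *\<^sub>R v)) \<circ> (\<lambda>r. r - s) = (\<lambda>s. f (p + s *\<^sub>R v))"
    by (auto simp: o_def algebra_simps)
  ultimately show ?thesis by (auto intro: has_vector_derivative_at_within)
qed

lemma integral_bounded_support:
  fixes f :: "'a::euclidean_space \<Rightarrow> 'b::banach"
  assumes "continuous_on UNIV f" and "\<And>y. y \<notin> cbox a b \<Longrightarrow> f y = 0"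
  shows "f integrable_on UNIV" and "integral UNIV f = integral (cbox a b) f"
proof -
  have "f integrable_on cbox a b"
    by (intro integrable_continuous continuous_on_subset[OF assms(1)]) auto
  then have "(f has_integral integral (cbox a b) f) (cbox a b)" by auto
  then have *: "(f has_integral integral (cbox a b) f) UNIV"
    by (rule has_integral_on_superset) (use assms(2) in auto)
  from * show "f integrable_on UNIV" by auto
  from * show "integral UNIV f = integral (cbox a b) f" by (rule integral_unique)
qed

lemma integral_translate:
  fixes f :: "'a::euclidean_space \<Rightarrow> 'b::banach"
  assumes "continuous_on UNIV f" and "\<And>y. y \<notin> cbox a b \<Longrightarrow> f y = 0"
  shows "integral UNIV (\<lambda>y. f (y + z)) = integral UNIV f"
proof -
  have c: "continuous_on UNIV (\<lambda>y. f (y + z))"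
    by (intro continuous_on_compose2[OF assms(1)] continuous_intros) auto
  have s: "f (y + z) = 0" if "y \<notin> cbox (a - z) (b - z)" for y
    using that assms(2)[of "y + z"] by (auto simp: mem_box inner_diff_left inner_add_left algebra_simps)
  have "integral UNIV (\<lambda>y. f (y + z)) = integral (cbox (a - z) (b - z)) (\<lambda>y. f (y + z))"
    by (rule integral_bounded_support(2)[OF c s])
  also have "\<dots> = integral (cbox a b) f"
    using integral_shift_cbox_plus[of "a - z" "b - z" f z] by (simp add: o_def add.commute)
  also have "\<dots> = integral UNIV f" using integral_bounded_support(2)[OF assms] by simp
  finally show ?thesis .
qed

text \<open>The integral is invariant under translation along \<open>v\<close>; differentiating this invariance under the
integral sign gives the claim.  This is the only form of integration by parts in the space variables
that is used below.\<close>

lemma integral_partial_zero: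
  fixes f :: "'a::euclidean_space \<Rightarrow> real"
  assumes f: "continuous_on UNIV f" and f': "continuous_on UNIV f'"
    and d: "partial_on UNIV v f f'" and supp: "\<And>y. y \<notin> cbox a b \<Longrightarrow> f y = 0"
  shows "integral UNIV f' = 0"
proof -
  obtain R where R: "\<And>y. y \<in> cbox a b \<Longrightarrow> norm y \<le> R"
    using bounded_cbox[of a b] by (auto simp: bounded_iff)
  define M where "M = R + norm v + 1"
  have supp': "f y = 0" if "norm y > R" for y using R[of y] supp[of y] that by fastforce
  obtain A B where AB: "cball (0::'a) M \<subseteq> cbox A B"
    using bounded_subset_cbox_symmetric[OF bounded_cball[of "0::'a" M]] by blast
  have z: "f (y + s *\<^sub>R v) = 0" if "y \<notin> cbox A B" "s \<in> {-1..1}" for y s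
  proof -
    have "norm y > M" using that AB by (auto simp: subset_iff not_le[symmetric])
    moreover have "norm (s *\<^sub>R v) \<le> norm v" using that mult_right_mono[of "\<bar>s\<bar>" 1 "norm v"] by auto
    moreover have "norm (y + s *\<^sub>R v) \<ge> norm y - norm (s *\<^sub>R v)" using norm_diff_ineq by blast
    ultimately show ?thesis by (intro supp') (auto simp: M_def)
  qed
  have const: "integral (cbox A B) (\<lambda>y. f (y + s *\<^sub>R v)) = integral UNIV f" if "s \<in> {-1..1}" for s
  proof -
    have "integral UNIV (\<lambda>y. f (y + s *\<^sub>R v)) = integral (cbox A B) (\<lambda>y. f (y + s *\<^sub>R v))"
      using z that by (intro integral_bounded_support(2) continuous_on_compose2[OF f] continuous_intros) auto
    then show ?thesis using integral_translate[OF f supp] by simp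
  qed
  have "((\<lambda>s. integral (cbox A B) (\<lambda>y. f (y + s *\<^sub>R v))) has_vector_derivative
      integral (cbox A B) (\<lambda>y. f' (y + 0 *\<^sub>R v))) (at 0 within {-1..1})"
  proof (rule leibniz_rule_vector_derivative)
    show "((\<lambda>s. f (y + s *\<^sub>R v)) has_vector_derivative f' (y + s *\<^sub>R v)) (at s within {-1..1})" for s y
      by (rule partial_on_line[OF d]) auto
    show "(\<lambda>y. f (y + s *\<^sub>R v)) integrable_on cbox A B" for s
      by (intro integrable_continuous continuous_on_compose2[OF f] continuous_intros) auto
    show "continuous_on ({-1..1} \<times> cbox A B) (\<lambda>(s, y). f' (y + s *\<^sub>R v))"
      unfolding split_beta by (intro continuous_on_compose2[OF f'] continuous_intros) auto
  qed auto
  then have "((\<lambda>s. integral (cbox A B) (\<lambda>y. f (y + s *\<^sub>R v))) has_vector_derivative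
      integral (cbox A B) f') (at 0 within {-1..1})" by simp
  from has_vector_derivative_transform[OF _ _ this, of "\<lambda>s. integral UNIV f"]
  have "((\<lambda>s. integral UNIV f) has_vector_derivative
      integral (cbox A B) f') (at 0 within {-1..1})" using const by simp
  moreover have "((\<lambda>s. integral UNIV f) has_vector_derivative 0) (at 0 within {-1..1::real})" by simp
  ultimately have e: "integral (cbox A B) f' = 0"
    using vector_derivative_unique_within_closed_interval[of "-1" "1::real" 0] by (metis atLeastAtMost_iff cbox_interval box_real(2) less_numeral_extra(1) neg_le_0_iff_le neg_less_0_iff_less not_less order.strict_trans zero_le_one)
  have "f' y = 0" if "y \<notin> cbox A B" for y
  proof -
    have "eventually (\<lambda>s. s \<in> {-1<..<1}) (nhds (0::real))" by (intro eventually_nhds_in_open) auto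
    then have "((\<lambda>s. f (y + s *\<^sub>R v)) has_vector_derivative f' y) (at 0) \<longleftrightarrow> ((\<lambda>s. 0) has_vector_derivative f' y) (at 0)"
      by (intro has_vector_derivative_cong_ev) (auto elim!: eventually_mono intro!: z that z[OF that, of 0, simplified])
    then have "((\<lambda>s::real. 0) has_vector_derivative f' y) (at 0)" using d by (simp add: partial_on_def)
    then show ?thesis using vector_derivative_at[of "\<lambda>s. 0" "f' y" 0] by (simp add: vector_derivative_const_at)
  qed
  then show ?thesis using integral_bounded_support(2)[OF f', of A B] e by simp
qed

section \<open>Radial solutions of the Poisson equation\<close>

lemma antiderivative_from_end:
  fixes f :: "real \<Rightarrow> real"
  assumes "continuous_on UNIV f" and z: "\<And>s. s \<ge> S \<Longrightarrow> f s = 0"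
  obtains F where "\<And>s. (F has_real_derivative f s) (at s)" "\<And>s. s \<ge> S \<Longrightarrow> F s = 0"
proof -
  obtain F0 where F0: "\<And>s. (F0 has_real_derivative f s) (at s)"
    using einterval_antiderivative[of "-\<infinity>" "\<infinity>" f] assms(1)
    by (auto simp: continuous_on_eq_continuous_at has_real_derivative_iff_has_vector_derivative)
  define F where "F s = F0 s - F0 S" for s
  have F: "(F has_real_derivative f s) (at s)" for s
    unfolding F_def by (auto intro!: derivative_eq_intros F0)
  moreover have "F s = 0" if "s \<ge> S" for s
  proof (cases "s = S")
    case False
    have "\<exists>z>S. z < s \<and> F s - F S = (s - S) * f z"
      using that False by (intro MVT2) (auto intro: F)
    then show ?thesis using z by (force simp: F_def)
  qed (simp add: F_def)
  ultimately show ?thesis using that by blast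
qed

lemma antiderivative_bound:
  fixes f F :: "real \<Rightarrow> real"
  assumes F: "\<And>s. (F has_real_derivative f s) (at s)" and z: "F S = 0"
    and b: "\<And>s. 0 \<le> s \<Longrightarrow> s \<le> S \<Longrightarrow> \<bar>f s\<bar> \<le> C * (S - s) ^ i / fact i"
    and s: "0 \<le> s" "s \<le> S"
  shows "\<bar>F s\<bar> \<le> C * (S - s) ^ Suc i / fact (Suc i)"
proof -
  have p: "((\<lambda>s. C * (S - s) ^ Suc i / fact (Suc i)) has_real_derivative - (C * (S - r) ^ i / fact i)) (at r)" for r
  proof -
    have "((\<lambda>s. C / fact (Suc i) * (S - s) ^ Suc i) has_real_derivative C / fact (Suc i) * (real (Suc i) * (S - r) ^ i * (0 - 1))) (at r)"
      by (rule DERIV_cmult, rule DERIV_cong[OF DERIV_power[OF DERIV_diff[OF DERIV_const DERIV_ident]]]) simp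
    moreover have "C / fact (Suc i) * (real (Suc i) * (S - r) ^ i * (0 - 1)) = - (C * (S - r) ^ i / fact i)"
      by (simp add: field_simps del: of_nat_Suc)
    ultimately show ?thesis by (simp only: times_divide_eq_left)
  qed
  have "F S + C * (S - S) ^ Suc i / fact (Suc i) \<ge> F s + - (C * (S - s) ^ Suc i / fact (Suc i))"
  proof -
    have "F s - C * (S - s) ^ Suc i / fact (Suc i) \<le> F S - C * (S - S) ^ Suc i / fact (Suc i)"
    proof (rule DERIV_nonneg_imp_nondecreasing[OF s(2)])
      fix x assume x: "s \<le> x" "x \<le> S"
      have "f x + C * (S - x) ^ i / fact i \<ge> 0" using b[of x] x s by linarith
      then show "\<exists>y. ((\<lambda>s. F s - C * (S - s) ^ Suc i / fact (Suc i)) has_real_derivative y) (at x) \<and> 0 \<le> y"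
        by (intro exI[of _ "f x + C * (S - x) ^ i / fact i"] conjI DERIV_cong[OF DERIV_diff[OF F p]]) auto
    qed
    then show ?thesis by simp
  qed
  moreover have "F s + C * (S - s) ^ Suc i / fact (Suc i) \<ge> F S + C * (S - S) ^ Suc i / fact (Suc i)"
  proof (rule DERIV_nonpos_imp_nonincreasing[OF s(2)])
    fix x assume x: "s \<le> x" "x \<le> S"
    have "f x - C * (S - x) ^ i / fact i \<le> 0" using b[of x] x s by linarith
    then show "\<exists>y. ((\<lambda>s. F s + C * (S - s) ^ Suc i / fact (Suc i)) has_real_derivative y) (at x) \<and> y \<le> 0"
      by (intro exI[of _ "f x - C * (S - x) ^ i / fact i"] conjI DERIV_cong[OF DERIV_add[OF F p]]) auto
  qed
  ultimately show ?thesis using z by (simp add: abs_le_iff)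
qed

text \<open>For \<open>\<psi>(y) = H(\<bar>y - c\<bar>\<^sup>2)\<close> in dimension \<open>n\<close> one has \<open>\<Delta>\<psi> = 4 s H'' + 2 n H'\<close> at \<open>s = \<bar>y - c\<bar>\<^sup>2\<close>.  The
equation with right-hand side \<open>H\<close> is solved here with the coefficient \<open>4 s\<close> replaced by \<open>4 max s a\<close>.
This changes nothing for \<open>s \<ge> a\<close>, and keeps the solution regular at the centre, where the true
solution with zero data at \<open>S\<close> is singular.  Integrating twice from \<open>S\<close> gains two powers of \<open>S - s\<close>
and the matching factorial; it is this gain that beats the growth \<open>(2j)!\<close> of a chain of iterated
Laplacians.\<close>

lemma radial_poisson_step:
  fixes H :: "real \<Rightarrow> real" and n :: nat
  assumes H: "continuous_on UNIV H" and z: "\<And>s. s \<ge> S \<Longrightarrow> H s = 0" and a: "a > 0" and S: "S \<ge> 0"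
    and b: "\<And>s. 0 \<le> s \<Longrightarrow> s \<le> S \<Longrightarrow> \<bar>H s\<bar> \<le> C * (S - s) ^ i / fact i"
  obtains H1 D1 D2 where "\<And>s. (H1 has_real_derivative D1 s) (at s)" "\<And>s. (D1 has_real_derivative D2 s) (at s)"
    "continuous_on UNIV D2" "\<And>s. 4 * max s a * D2 s + 2 * real n * D1 s = H s"
    "\<And>s. s \<ge> S \<Longrightarrow> H1 s = 0" "\<And>s. s \<ge> S \<Longrightarrow> D1 s = 0" "\<And>s. s \<ge> S \<Longrightarrow> D2 s = 0"
    "\<And>s. 0 \<le> s \<Longrightarrow> s \<le> S \<Longrightarrow> \<bar>H1 s\<bar> \<le> (exp (real n * S / (2 * a)) / (4 * a) * C) * (S - s) ^ (i + 2) / fact (i + 2)"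
proof -
  define q where "q s = max s a" for s
  have q: "q s > 0" "q s \<ge> a" for s using a by (auto simp: q_def)
  have qc: "continuous_on UNIV q" unfolding q_def by (intro continuous_intros)
  have q0: "q s \<noteq> 0" for s using q(1)[of s] by simp
  obtain l where l: "\<And>s. (l has_real_derivative 1 / q s) (at s)"
    using einterval_antiderivative[of "-\<infinity>" "\<infinity>" "\<lambda>s. 1 / q s"] continuous_on_divide[OF continuous_on_const qc, of 1] q0
    by (auto simp: continuous_on_eq_continuous_at has_real_derivative_iff_has_vector_derivative)
  \<comment> \<open>the integrating factor: \<open>P' / P = n / (2 q)\<close>, so that \<open>(P D1)' = P H / (4 q)\<close>\<close>
  define P where "P s = exp (real n / 2 * l s)" for s
  have P0: "P s > 0" for s by (simp add: P_def)
  have P: "(P has_real_derivative (P s * (real n / 2) / q s)) (at s)" for s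
    unfolding P_def by (auto intro!: derivative_eq_intros l)
  have Pc: "continuous_on UNIV P"
    using P DERIV_isCont by (auto simp: continuous_on_eq_continuous_at)
  have lm: "l s \<le> l r" if "s \<le> r" for s r
    by (rule DERIV_nonneg_imp_nondecreasing[OF that]) (use l q(1) in \<open>metis less_eq_real_def zero_less_divide_1_iff\<close>)
  have Pm: "P s \<le> P r" if "s \<le> r" for s r
    using lm[OF that] by (auto simp: P_def intro!: mult_left_mono)
  have lS: "l S - l 0 \<le> S / a"
  proof -
    have "(\<lambda>s. l s - s / a) S \<le> (\<lambda>s. l s - s / a) 0"
    proof (rule DERIV_nonpos_imp_nonincreasing[OF S])
      fix x
      have "((\<lambda>s. l s - s / a) has_real_derivative 1 / q x - 1 / a) (at x)"
        by (intro DERIV_diff l) (use a in \<open>auto intro!: derivative_eq_intros\<close>)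
      moreover have "1 / q x - 1 / a \<le> 0" using frac_le[of 1 1 a "q x"] q[of x] a by simp
      ultimately show "\<exists>y. ((\<lambda>s. l s - s / a) has_real_derivative y) (at x) \<and> y \<le> 0" by blast
    qed
    then show ?thesis by simp
  qed
  have Pr: "P S \<le> exp (real n * S / (2 * a)) * P 0"
  proof -
    have "real n / 2 * l S \<le> real n * S / (2 * a) + real n / 2 * l 0"
      using mult_left_mono[OF lS, of "real n / 2"] a by (simp add: field_simps)
    then show ?thesis by (simp add: P_def flip: exp_add)
  qed
  define j where "j s = P s * H s / (4 * q s)" for s
  have jc: "continuous_on UNIV j" unfolding j_def using q0 by (intro continuous_intros H Pc qc) auto
  obtain J where J: "\<And>s. (J has_real_derivative j s) (at s)" "\<And>s. s \<ge> S \<Longrightarrow> J s = 0"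
    using antiderivative_from_end[OF jc, of S] z by (auto simp: j_def)
  define D1 where "D1 s = J s / P s" for s
  define D2 where "D2 s = H s / (4 * q s) - D1 s * (real n / 2) / q s" for s
  have D1: "(D1 has_real_derivative D2 s) (at s)" for s
    unfolding D1_def D2_def using P0[of s] q(1)[of s]
    by (auto intro!: derivative_eq_intros J(1) P simp: j_def field_simps)
  have D1c: "continuous_on UNIV D1"
    using D1 DERIV_isCont by (auto simp: continuous_on_eq_continuous_at)
  have D2c: "continuous_on UNIV D2"
    unfolding D2_def using q0 by (intro continuous_intros H D1c qc) auto
  obtain H1 where H1: "\<And>s. (H1 has_real_derivative D1 s) (at s)" "\<And>s. s \<ge> S \<Longrightarrow> H1 s = 0"
    using antiderivative_from_end[OF D1c, of S] J(2) by (auto simp: D1_def)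
  have jb: "\<bar>j s\<bar> \<le> (P S / (4 * a) * C) * (S - s) ^ i / fact i" if "0 \<le> s" "s \<le> S" for s
  proof -
    have "\<bar>j s\<bar> = P s / (4 * q s) * \<bar>H s\<bar>" using P0[of s] q(1)[of s] by (simp add: j_def abs_mult)
    also have "\<dots> \<le> P S / (4 * a) * (C * (S - s) ^ i / fact i)"
      using q[of s] P0 Pm[OF that(2)] a that by (intro mult_mono frac_le b) (auto simp: less_imp_le)
    finally show ?thesis by simp
  qed
  have Jb: "\<bar>J s\<bar> \<le> (P S / (4 * a) * C) * (S - s) ^ Suc i / fact (Suc i)" if "0 \<le> s" "s \<le> S" for s
    by (rule antiderivative_bound[OF J(1) _ jb]) (use that J(2) in auto)
  have D1b: "\<bar>D1 s\<bar> \<le> (exp (real n * S / (2 * a)) / (4 * a) * C) * (S - s) ^ Suc i / fact (Suc i)" if s: "0 \<le> s" "s \<le> S" for s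
  proof -
    have C: "0 \<le> C * (S - s) ^ Suc i / fact (Suc i)"
    proof -
      have "0 \<le> (C * (S - s) ^ i / fact i) * ((S - s) / Suc i)"
        using b[OF s] s by (intro mult_nonneg_nonneg) (auto intro: order_trans[OF abs_ge_zero])
      then show ?thesis by (simp add: field_simps)
    qed
    have "\<bar>D1 s\<bar> = \<bar>J s\<bar> / P s" using P0[of s] by (simp add: D1_def)
    also have "\<dots> \<le> \<bar>J s\<bar> / P 0" using P0 Pm[OF s(1)] by (intro divide_left_mono) auto
    also have "\<dots> \<le> ((P S / (4 * a) * C) * (S - s) ^ Suc i / fact (Suc i)) / P 0"
      using P0[of 0] Jb[OF s] by (intro divide_right_mono) auto
    also have "\<dots> = (P S / P 0) * (C * (S - s) ^ Suc i / fact (Suc i)) / (4 * a)" by (simp add: mult_ac)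
    also have "\<dots> \<le> exp (real n * S / (2 * a)) * (C * (S - s) ^ Suc i / fact (Suc i)) / (4 * a)"
      using Pr P0[of 0] C a by (intro divide_right_mono mult_right_mono) (auto simp: field_simps)
    finally show ?thesis by (simp add: mult_ac)
  qed
  have H1b: "\<bar>H1 s\<bar> \<le> (exp (real n * S / (2 * a)) / (4 * a) * C) * (S - s) ^ Suc (Suc i) / fact (Suc (Suc i))" if "0 \<le> s" "s \<le> S" for s
    by (rule antiderivative_bound[OF H1(1) _ D1b]) (use that H1(2) in auto)
  show ?thesis
  proof (rule that[OF H1(1) D1 D2c])
    show "4 * max s a * D2 s + 2 * real n * D1 s = H s" for s
      using q(1)[of s] by (simp add: D2_def field_simps flip: q_def)
    show "D2 s = 0" if "s \<ge> S" for s using that by (simp add: D2_def D1_def z J(2))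
  qed (use H1 J H1b in \<open>auto simp: D1_def\<close>)
qed

section \<open>Unique continuation for chains of iterated Laplacians\<close>

text \<open>A test function supported in a closed ball, given together with its first and its pure second
derivatives along each basis vector; mixed second derivatives do not enter a Laplacian.\<close>

definition test_fun :: "'a::euclidean_space \<Rightarrow> real \<Rightarrow> ('a \<Rightarrow> real) \<Rightarrow> ('a \<Rightarrow> 'a \<Rightarrow> real) \<Rightarrow> ('a \<Rightarrow> 'a \<Rightarrow> real) \<Rightarrow> bool" where
  "test_fun c r \<phi> \<phi>' \<phi>'' \<longleftrightarrow> continuous_on UNIV \<phi> \<and> (\<forall>y. y \<notin> cball c r \<longrightarrow> \<phi> y = 0) \<and>
     (\<forall>b\<in>Basis. partial_on UNIV b \<phi> (\<phi>' b) \<and> partial_on UNIV b (\<phi>' b) (\<phi>'' b) \<and>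
        continuous_on UNIV (\<phi>' b) \<and> continuous_on UNIV (\<phi>'' b) \<and>
        (\<forall>y. y \<notin> cball c r \<longrightarrow> \<phi>' b y = 0 \<and> \<phi>'' b y = 0))"

text \<open>The weak form of \<open>- \<Delta> F = G\<close>; only test functions supported in a single ball are admitted.\<close>

definition weak_poisson :: "'a::euclidean_space set \<Rightarrow> ('a \<Rightarrow> real) \<Rightarrow> ('a \<Rightarrow> real) \<Rightarrow> bool" where
  "weak_poisson D F G \<longleftrightarrow> (\<forall>c r \<phi> \<phi>' \<phi>''. cball c r \<subseteq> D \<and> test_fun c r \<phi> \<phi>' \<phi>'' \<longrightarrow>
     integral UNIV (\<lambda>y. F y * (\<Sum>b\<in>Basis. \<phi>'' b y)) = - integral UNIV (\<lambda>y. G y * \<phi> y))"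

lemma continuous_times_supported:
  fixes F :: "'a::euclidean_space \<Rightarrow> real"
  assumes "open D" "continuous_on D F" "continuous_on UNIV \<phi>" "closed K" "K \<subseteq> D" "\<And>y. y \<notin> K \<Longrightarrow> \<phi> y = 0"
  shows "continuous_on UNIV (\<lambda>y. F y * \<phi> y)"
proof -
  have "continuous_on (D \<union> - K) (\<lambda>y. F y * \<phi> y)"
  proof (rule continuous_on_open_Un)
    show "continuous_on D (\<lambda>y. F y * \<phi> y)"
      by (intro continuous_on_mult assms(2) continuous_on_subset[OF assms(3)]) auto
    show "continuous_on (- K) (\<lambda>y. F y * \<phi> y)"
      using assms(6) by (subst continuous_on_cong[OF refl, of _ _ "\<lambda>y. 0"]) auto
  qed (use assms in auto)
  moreover have "D \<union> - K = UNIV" using assms by auto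
  ultimately show ?thesis by simp
qed

lemma inner_ge_outside_cball:
  fixes c y :: "'a::real_inner"
  assumes "y \<notin> cball c (sqrt S)"
  shows "S \<le> (y - c) \<bullet> (y - c)"
proof -
  have "sqrt S < norm (y - c)" using assms by (simp add: dist_norm norm_minus_commute)
  then show ?thesis by (simp add: norm_eq_sqrt_inner)
qed

lemma radial_test_fun:
  fixes c :: "'a::euclidean_space"
  assumes H: "\<And>s. (H has_real_derivative D1 s) (at s)" and D1: "\<And>s. (D1 has_real_derivative D2 s) (at s)"
    and D2: "continuous_on UNIV D2" and S: "S \<ge> 0"
    and z: "\<And>s. s \<ge> S \<Longrightarrow> H s = 0" "\<And>s. s \<ge> S \<Longrightarrow> D1 s = 0" "\<And>s. s \<ge> S \<Longrightarrow> D2 s = 0"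
  shows "test_fun c (sqrt S) (\<lambda>y. H ((y - c) \<bullet> (y - c))) (\<lambda>b y. 2 * ((y - c) \<bullet> b) * D1 ((y - c) \<bullet> (y - c)))
     (\<lambda>b y. 2 * D1 ((y - c) \<bullet> (y - c)) + 4 * ((y - c) \<bullet> b)\<^sup>2 * D2 ((y - c) \<bullet> (y - c)))"
proof -
  have Hc: "continuous_on UNIV H" and D1c: "continuous_on UNIV D1"
    using H D1 DERIV_isCont by (metis continuous_at_imp_continuous_on)+
  have far: "(y - c) \<bullet> (y - c) \<ge> S" if "y \<notin> cball c (sqrt S)" for y
    using inner_ge_outside_cball[OF that] .
  have dr: "((\<lambda>s. (y + s *\<^sub>R b - c) \<bullet> (y + s *\<^sub>R b - c)) has_real_derivative 2 * ((y - c) \<bullet> b)) (at 0)" for y b :: 'a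
    unfolding has_field_derivative_def
    by (auto intro!: derivative_eq_intros simp: inner_commute algebra_simps)
  have dl: "((\<lambda>s. (y + s *\<^sub>R b - c) \<bullet> b) has_real_derivative 1) (at 0)" if "b \<in> Basis" for y b :: 'a
    unfolding has_field_derivative_def
    by (auto intro!: derivative_eq_intros simp: that algebra_simps)
  have chain: "((\<lambda>s. K ((y + s *\<^sub>R b - c) \<bullet> (y + s *\<^sub>R b - c))) has_real_derivative
      K' ((y - c) \<bullet> (y - c)) * (2 * ((y - c) \<bullet> b))) (at 0)"
    if "\<And>s. (K has_real_derivative K' s) (at s)" for K K' y and b :: 'a
    using DERIV_chain2[OF that dr[of y b]] by simp
  have p1: "partial_on UNIV b (\<lambda>y. H ((y - c) \<bullet> (y - c))) (\<lambda>y. 2 * ((y - c) \<bullet> b) * D1 ((y - c) \<bullet> (y - c)))" for b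
    unfolding partial_on_def has_real_derivative_iff_has_vector_derivative[symmetric]
    using chain[OF H, of _ b] by (simp add: mult_ac)
  have p2: "partial_on UNIV b (\<lambda>y. 2 * ((y - c) \<bullet> b) * D1 ((y - c) \<bullet> (y - c)))
      (\<lambda>y. 2 * D1 ((y - c) \<bullet> (y - c)) + 4 * ((y - c) \<bullet> b)\<^sup>2 * D2 ((y - c) \<bullet> (y - c)))" if "b \<in> Basis" for b
    unfolding partial_on_def has_real_derivative_iff_has_vector_derivative[symmetric]
  proof
    fix y
    have "((\<lambda>s. 2 * (((y + s *\<^sub>R b - c) \<bullet> b) * D1 ((y + s *\<^sub>R b - c) \<bullet> (y + s *\<^sub>R b - c)))) has_real_derivative
       2 * (1 * D1 ((y + 0 *\<^sub>R b - c) \<bullet> (y + 0 *\<^sub>R b - c)) + D2 ((y - c) \<bullet> (y - c)) * (2 * ((y - c) \<bullet> b)) * ((y + 0 *\<^sub>R b - c) \<bullet> b))) (at 0)"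
      by (intro DERIV_cmult DERIV_mult dl chain that D1)
    then show "((\<lambda>s. 2 * ((y + s *\<^sub>R b - c) \<bullet> b) * D1 ((y + s *\<^sub>R b - c) \<bullet> (y + s *\<^sub>R b - c))) has_real_derivative
       2 * D1 ((y - c) \<bullet> (y - c)) + 4 * ((y - c) \<bullet> b)\<^sup>2 * D2 ((y - c) \<bullet> (y - c))) (at 0)"
      by (simp add: algebra_simps power2_eq_square)
  qed
  have cc: "continuous_on UNIV (\<lambda>y. K ((y - c) \<bullet> (y - c)))" if "continuous_on UNIV K" for K :: "real \<Rightarrow> real"
    by (intro continuous_on_compose2[OF that] continuous_intros) auto
  show ?thesis
    unfolding test_fun_def using far
    by (auto intro!: p1 p2 cc Hc D1c D2 continuous_intros simp: z)
qed

lemma sum_Basis_inner_power2: "(\<Sum>b\<in>Basis. (x \<bullet> b)\<^sup>2) = x \<bullet> (x::'a::euclidean_space)"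
  unfolding euclidean_inner[of x x] by (simp add: power2_eq_square)

lemma norm_integral_supported:
  fixes f :: "'a::euclidean_space \<Rightarrow> real"
  assumes "continuous_on UNIV f" "\<And>y. y \<notin> cbox a b \<Longrightarrow> f y = 0" "\<And>y. \<bar>f y\<bar> \<le> M" "M \<ge> 0"
  shows "\<bar>integral UNIV f\<bar> \<le> M * measure lborel (cbox a b)"
proof -
  have "(f has_integral integral (cbox a b) f) (cbox a b)"
    by (intro integrable_integral integrable_continuous continuous_on_subset[OF assms(1)]) auto
  from has_integral_bound[OF assms(4) this] show ?thesis
    using assms integral_bounded_support(2)[OF assms(1,2)] by auto
qed

text \<open>A function whose iterated Laplacians grow at most like \<open>A\<^sup>j (2j)!\<close> is real analytic.  The sequence
replaces the iterated Laplacians of \<open>G 0\<close> when these exist in the weak sense only.  The bound is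
stated for every tail of the sequence, with the same \<open>A\<close>, so that every member of the chain can
take the place of the first.\<close>

locale laplace_chain =
  fixes D :: "'a::euclidean_space set" and G :: "nat \<Rightarrow> 'a \<Rightarrow> real" and A :: real
  assumes open_D: "open D" and cont: "\<And>j. continuous_on D (G j)"
    and weak: "\<And>j. weak_poisson D (G j) (G (Suc j))" and A_pos: "A > 0"
    and bound: "\<And>i. \<exists>B. \<forall>j. \<forall>y\<in>D. \<bar>G (i + j) y\<bar> \<le> B * A ^ j * fact (2 * j)"
begin

text \<open>Each step replaces the radial weight by its solution from \<open>radial_poisson_step\<close> and moves the
Laplacian onto the chain.  That solution is wrong on the ball \<open>\<bar>y - c\<bar>\<^sup>2 < a\<close>, which does no harm
because the chain vanishes there.\<close>

lemma radial_integral_bound: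
  assumes a: "a > 0" and cb: "cball c (sqrt S) \<subseteq> D" and S: "S \<ge> 0"
    and zero: "\<And>j y. (y - c) \<bullet> (y - c) < a \<Longrightarrow> y \<in> D \<Longrightarrow> G j y = 0"
    and box: "cball c (sqrt S) \<subseteq> cbox u v"
    and B: "\<And>j y. y \<in> D \<Longrightarrow> \<bar>G (i + j) y\<bar> \<le> B * A ^ j * fact (2 * j)"
    and H: "continuous_on UNIV H" "\<And>s. s \<ge> S \<Longrightarrow> H s = 0"
      "\<And>s. 0 \<le> s \<Longrightarrow> s \<le> S \<Longrightarrow> \<bar>H s\<bar> \<le> C * (S - s) ^ m / fact m"
  defines "\<kappa> \<equiv> exp (real DIM('a) * S / (2 * a)) / (4 * a)"
  shows "\<bar>integral UNIV (\<lambda>y. G (i + j) y * H ((y - c) \<bullet> (y - c)))\<bar> \<le>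
    (B * A ^ (j + N) * fact (2 * (j + N))) * (\<kappa> ^ N * C * S ^ (m + 2 * N) / fact (m + 2 * N)) * measure lborel (cbox u v)"
  using H
proof (induction N arbitrary: j m C H)
  case 0
  have far: "(y - c) \<bullet> (y - c) \<ge> S" if "y \<notin> cball c (sqrt S)" for y
    using inner_ge_outside_cball[OF that] .
  have Hc: "continuous_on UNIV (\<lambda>y. H ((y - c) \<bullet> (y - c)))"
    by (intro continuous_on_compose2[OF 0(1)] continuous_intros) auto
  have C: "0 \<le> C * S ^ m / fact m" using 0(3)[of 0] S by simp
  have C0: "C * (S - s) ^ m / fact m \<le> C * S ^ m / fact m" if "0 \<le> s" "s \<le> S" for s
  proof (cases "S = 0")
    case False
    then have p: "0 < S ^ m / fact m" using S by simp
    have "C \<ge> 0" using C mult_neg_pos[OF _ p, of C] by force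
    then show ?thesis using that by (intro divide_right_mono mult_left_mono power_mono) auto
  qed (use that in auto)
  have Bn: "0 \<le> B * A ^ j * fact (2 * j)"
    using B[of c j] cb S by (auto simp: subset_iff intro: order_trans[OF abs_ge_zero])
  have "\<bar>integral UNIV (\<lambda>y. G (i + j) y * H ((y - c) \<bullet> (y - c)))\<bar> \<le>
    (B * A ^ j * fact (2 * j) * (C * S ^ m / fact m)) * measure lborel (cbox u v)"
  proof (rule norm_integral_supported)
    show "continuous_on UNIV (\<lambda>y. G (i + j) y * H ((y - c) \<bullet> (y - c)))"
      by (rule continuous_times_supported[OF open_D cont Hc _ cb]) (use far 0(2) in auto)
    show "G (i + j) y * H ((y - c) \<bullet> (y - c)) = 0" if "y \<notin> cbox u v" for y
    proof -
      have "H ((y - c) \<bullet> (y - c)) = 0" using that box by (intro 0(2) far) auto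
      then show ?thesis by simp
    qed
    show "\<bar>G (i + j) y * H ((y - c) \<bullet> (y - c))\<bar> \<le> B * A ^ j * fact (2 * j) * (C * S ^ m / fact m)" for y
    proof (cases "(y - c) \<bullet> (y - c) \<le> S")
      case True
      then have "y \<in> D" using cb real_sqrt_le_iff[of "(y - c) \<bullet> (y - c)" S]
        unfolding norm_eq_sqrt_inner[symmetric] by (auto simp: dist_norm norm_minus_commute)
      then show ?thesis unfolding abs_mult using True
        by (intro mult_mono B order_trans[OF 0(3) C0] Bn) auto
    next
      case False
      then have "H ((y - c) \<bullet> (y - c)) = 0" by (intro 0(2)) auto
      then show ?thesis using mult_nonneg_nonneg[OF Bn C] by simp
    qed
  qed (rule mult_nonneg_nonneg[OF Bn C])
  then show ?case by simp
next
  case (Suc N)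
  obtain H1 D1 D2 where H1: "\<And>s. (H1 has_real_derivative D1 s) (at s)" "\<And>s. (D1 has_real_derivative D2 s) (at s)"
    "continuous_on UNIV D2" and ode: "\<And>s. 4 * max s a * D2 s + 2 * real DIM('a) * D1 s = H s"
    and z: "\<And>s. s \<ge> S \<Longrightarrow> H1 s = 0" "\<And>s. s \<ge> S \<Longrightarrow> D1 s = 0" "\<And>s. s \<ge> S \<Longrightarrow> D2 s = 0"
    and H1b: "\<And>s. 0 \<le> s \<Longrightarrow> s \<le> S \<Longrightarrow> \<bar>H1 s\<bar> \<le> (\<kappa> * C) * (S - s) ^ (m + 2) / fact (m + 2)"
    using radial_poisson_step[OF Suc.prems(1,2) a S Suc.prems(3), of "DIM('a)"] unfolding \<kappa>_def by blast
  note tf = radial_test_fun[OF H1 S z, of c]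
  have "integral UNIV (\<lambda>y. G (i + j) y * H ((y - c) \<bullet> (y - c))) =
    integral UNIV (\<lambda>y. G (i + j) y * (\<Sum>b\<in>Basis. 2 * D1 ((y - c) \<bullet> (y - c)) + 4 * ((y - c) \<bullet> b)\<^sup>2 * D2 ((y - c) \<bullet> (y - c))))"
  proof (rule integral_cong)
    fix y
    have *: "(\<Sum>b\<in>Basis. 2 * D1 ((y - c) \<bullet> (y - c)) + 4 * ((y - c) \<bullet> b)\<^sup>2 * D2 ((y - c) \<bullet> (y - c)))
       = 2 * real DIM('a) * D1 ((y - c) \<bullet> (y - c)) + 4 * ((y - c) \<bullet> (y - c)) * D2 ((y - c) \<bullet> (y - c))"
      by (simp add: sum.distrib sum_Basis_inner_power2[symmetric] sum_distrib_left sum_distrib_right)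
    consider "y \<in> D" "(y - c) \<bullet> (y - c) < a" | "(y - c) \<bullet> (y - c) \<ge> a" | "y \<notin> D" by linarith
    then show "G (i + j) y * H ((y - c) \<bullet> (y - c)) =
     G (i + j) y * (\<Sum>b\<in>Basis. 2 * D1 ((y - c) \<bullet> (y - c)) + 4 * ((y - c) \<bullet> b)\<^sup>2 * D2 ((y - c) \<bullet> (y - c)))"
    proof cases
      case 2
      then show ?thesis using ode[of "(y - c) \<bullet> (y - c)"] unfolding * by (simp add: max_def split: if_splits)
    next
      case 3
      then have "y \<notin> cball c (sqrt S)" using cb by auto
      then have "(y - c) \<bullet> (y - c) \<ge> S"
        by (rule inner_ge_outside_cball)
      then show ?thesis using z Suc.prems(2) by simp
    qed (simp add: zero)
  qed
  also have "\<dots> = - integral UNIV (\<lambda>y. G (i + Suc j) y * H1 ((y - c) \<bullet> (y - c)))"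
    using weak[of "i + j"] cb tf unfolding weak_poisson_def by simp
  finally have "\<bar>integral UNIV (\<lambda>y. G (i + j) y * H ((y - c) \<bullet> (y - c)))\<bar> =
    \<bar>integral UNIV (\<lambda>y. G (i + Suc j) y * H1 ((y - c) \<bullet> (y - c)))\<bar>" by simp
  also have "\<dots> \<le> (B * A ^ (Suc j + N) * fact (2 * (Suc j + N))) *
      (\<kappa> ^ N * (\<kappa> * C) * S ^ (m + 2 + 2 * N) / fact (m + 2 + 2 * N)) * measure lborel (cbox u v)"
    using H1(1) DERIV_isCont by (intro Suc.IH z H1b) (auto simp: continuous_on_eq_continuous_at)
  finally show ?case by (simp add: mult_ac)
qed

text \<open>With \<open>S = 2a\<close> the bound of \<open>radial_integral_bound\<close> is a constant times
\<open>(A \<kappa> S\<^sup>2)\<^sup>N = (A e\<^sup>n a)\<^sup>N\<close>, where \<open>n\<close> is the dimension: the factorials cancel, and \<open>N\<close> is arbitrary.\<close>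

lemma radial_integral_zero:
  assumes a: "a > 0" and cb: "cball c (sqrt (2 * a)) \<subseteq> D" and small: "A * exp (real DIM('a)) * a < 1"
    and zero: "\<And>j y. (y - c) \<bullet> (y - c) < a \<Longrightarrow> y \<in> D \<Longrightarrow> G j y = 0"
    and H: "continuous_on UNIV H" "\<And>s. s \<ge> 2 * a \<Longrightarrow> H s = 0"
  shows "integral UNIV (\<lambda>y. G i y * H ((y - c) \<bullet> (y - c))) = 0"
proof -
  obtain u v where uv: "cball c (sqrt (2 * a)) \<subseteq> cbox u v"
    using bounded_subset_cbox_symmetric[OF bounded_cball[of c "sqrt (2 * a)"]] by blast
  obtain B where B: "\<And>j y. y \<in> D \<Longrightarrow> \<bar>G (i + j) y\<bar> \<le> B * A ^ j * fact (2 * j)" using bound by blast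
  have "compact (H ` {0..2 * a})"
    by (intro compact_continuous_image continuous_on_subset[OF H(1)]) auto
  then obtain C where C: "\<And>s. 0 \<le> s \<Longrightarrow> s \<le> 2 * a \<Longrightarrow> \<bar>H s\<bar> \<le> C"
    by (force dest!: compact_imp_bounded simp: bounded_iff)
  define q where "q = A * exp (real DIM('a)) * a"
  have q: "0 \<le> q" "q < 1" using small A_pos a by (auto simp: q_def)
  have "\<bar>integral UNIV (\<lambda>y. G i y * H ((y - c) \<bullet> (y - c)))\<bar> \<le> q ^ N * (B * C * measure lborel (cbox u v))" for N
  proof -
    have "\<bar>integral UNIV (\<lambda>y. G (i + 0) y * H ((y - c) \<bullet> (y - c)))\<bar> \<le>
       (B * A ^ (0 + N) * fact (2 * (0 + N))) * ((exp (real DIM('a) * (2 * a) / (2 * a)) / (4 * a)) ^ N * C * (2 * a) ^ (0 + 2 * N) / fact (0 + 2 * N)) * measure lborel (cbox u v)"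
      by (rule radial_integral_bound[OF a cb _ zero uv B H]) (use a C in auto)
    also have "\<dots> = (A * (exp (real DIM('a)) / (4 * a)) * (2 * a)\<^sup>2) ^ N * (B * C * measure lborel (cbox u v))"
    proof -
      have "(A * k * (2 * a)\<^sup>2) ^ N = A ^ N * k ^ N * (2 * a) ^ (2 * N)" for k :: real
        by (simp only: power_mult_distrib power_mult)
      from this[of "exp (real DIM('a)) / (4 * a)"] show ?thesis using a by (simp add: mult_ac)
    qed
    also have "A * (exp (real DIM('a)) / (4 * a)) * (2 * a)\<^sup>2 = q"
      using a by (simp add: q_def power2_eq_square)
    finally show ?thesis by simp
  qed
  moreover have "(\<lambda>N. q ^ N * (B * C * measure lborel (cbox u v))) \<longlonglongrightarrow> 0 * (B * C * measure lborel (cbox u v))"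
    using q by (intro tendsto_mult LIMSEQ_realpow_zero tendsto_const)
  ultimately have "\<bar>integral UNIV (\<lambda>y. G i y * H ((y - c) \<bullet> (y - c)))\<bar> \<le> 0"
    by (intro LIMSEQ_le_const[of _ 0]) (auto simp del: mult_zero_left simp: mult_zero_left[of "B * C * measure lborel (cbox u v)"])
  then show ?thesis by simp
qed

end

lemma vector_derivative_of_zero:
  assumes "e > 0" "((\<lambda>s. 0) has_vector_derivative d) (at 0 within {-e..e::real})"
  shows "d = 0"
proof -
  have "((\<lambda>s. 0) has_vector_derivative d) (at 0 within cbox (-e) e)"
    "((\<lambda>s. 0) has_vector_derivative 0) (at (0::real) within cbox (-e) e)" using assms(2) by simp_all
  from vector_derivative_unique_within_closed_interval[OF _ _ this] show ?thesis using assms(1) by simp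
qed

text \<open>Moving the centre \<open>c\<close> in the direction \<open>v\<close> differentiates a radial weight \<open>X\<close> into
\<open>- 2 ((y - c) \<bullet> v) X'\<close>.  As \<open>X'\<close> is an arbitrary radial weight, the vanishing of all radial moments
of \<open>F\<close> about all nearby centres passes to \<open>(y \<bullet> v) F\<close>, and so to \<open>p F\<close> for every polynomial \<open>p\<close>.\<close>

lemma polynomial_moments_zero:
  fixes F :: "'a::euclidean_space \<Rightarrow> real"
  assumes p: "real_polynomial_function p" and d: "\<delta> > 0" and S: "S \<ge> 0"
    and F: "continuous_on UNIV F"
    and M: "\<And>c H. c \<in> ball c0 \<delta> \<Longrightarrow> continuous_on UNIV H \<Longrightarrow> (\<And>s. s \<ge> S \<Longrightarrow> H s = 0) \<Longrightarrow>
       integral UNIV (\<lambda>y. F y * H ((y - c) \<bullet> (y - c))) = 0"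
    and c: "c \<in> ball c0 \<delta>" and H: "continuous_on UNIV H" "\<And>s. s \<ge> S \<Longrightarrow> H s = 0"
  shows "integral UNIV (\<lambda>y. p y * F y * H ((y - c) \<bullet> (y - c))) = 0"
  using p F M c H
proof (induction p arbitrary: F c H rule: real_polynomial_function.induct)
  case (linear f)
  obtain v where f: "f = (\<lambda>y. y \<bullet> v)"
  proof
    show "f = (\<lambda>y. y \<bullet> (\<Sum>b\<in>Basis. f b *\<^sub>R b))"
    proof
      fix y
      have "f y = f (\<Sum>b\<in>Basis. (y \<bullet> b) *\<^sub>R b)" by (simp add: euclidean_representation)
      also have "\<dots> = y \<bullet> (\<Sum>b\<in>Basis. f b *\<^sub>R b)"
        using linear(1) by (simp add: bounded_linear.linear linear_sum linear_cmul inner_sum_right mult.commute)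
      finally show "f y = y \<bullet> (\<Sum>b\<in>Basis. f b *\<^sub>R b)" .
    qed
  qed
  \<comment> \<open>the weight whose derivative in the centre is to be taken\<close>
  obtain X where X: "\<And>s. (X has_real_derivative H s) (at s)" "\<And>s. s \<ge> S \<Longrightarrow> X s = 0"
    using antiderivative_from_end[OF linear(5,6)] by blast
  have Xc: "continuous_on UNIV X" using X(1) DERIV_isCont by (metis continuous_at_imp_continuous_on)
  obtain e0 where e0: "e0 > 0" "ball c e0 \<subseteq> ball c0 \<delta>" using linear(4) open_ball open_contains_ball by blast
  define e where "e = e0 / (norm v + 1) / 2"
  have nv: "norm v + 1 > 0" by (smt (verit) norm_ge_zero)
  have e: "e > 0" unfolding e_def using e0 nv by auto
  have mv: "c + s *\<^sub>R v \<in> ball c0 \<delta>" and ms: "norm (s *\<^sub>R v) \<le> e0" if "s \<in> {-e..e}" for s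
  proof -
    have "\<bar>s\<bar> * norm v \<le> e * (norm v + 1)" using that e by (intro mult_mono) auto
    also have "\<dots> < e0"
    proof -
      have "e0 / k / 2 * k = e0 / 2" if "k > 0" for k :: real using that by simp
      from this[OF nv] have "e * (norm v + 1) = e0 / 2" by (simp only: e_def)
      then show ?thesis using e0(1) by simp
    qed
    finally show "c + s *\<^sub>R v \<in> ball c0 \<delta>" "norm (s *\<^sub>R v) \<le> e0" using e0(2) by (auto simp: subset_iff dist_norm)
  qed
  obtain A B where AB: "cball c (sqrt S + e0) \<subseteq> cbox A B"
    using bounded_subset_cbox_symmetric[OF bounded_cball[of c "sqrt S + e0"]] by blast
  have far: "(y - (c + s *\<^sub>R v)) \<bullet> (y - (c + s *\<^sub>R v)) \<ge> S" if "y \<notin> cbox A B" "s \<in> {-e..e}" for y s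
  proof -
    have "norm (y - c) > sqrt S + e0" using AB that(1) by (auto simp: subset_iff dist_norm norm_minus_commute not_le[symmetric])
    moreover have "norm (y - (c + s *\<^sub>R v)) \<ge> norm (y - c) - norm (s *\<^sub>R v)"
      using norm_triangle_ineq2[of "y - c" "s *\<^sub>R v"] by (simp add: algebra_simps)
    ultimately have "norm (y - (c + s *\<^sub>R v)) > sqrt S" using ms[OF that(2)] by linarith
    then show ?thesis unfolding norm_eq_sqrt_inner by simp
  qed
  have dr: "((\<lambda>s. (y - (c + s *\<^sub>R v)) \<bullet> (y - (c + s *\<^sub>R v))) has_real_derivative - 2 * ((y - (c + s *\<^sub>R v)) \<bullet> v)) (at s within T)" for y s T
    unfolding has_field_derivative_def
    by (auto intro!: derivative_eq_intros simp: inner_commute algebra_simps)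
  have cr: "continuous_on T (\<lambda>x. K ((g x - (c + h x *\<^sub>R v)) \<bullet> (g x - (c + h x *\<^sub>R v))))"
    if "continuous_on UNIV K" "continuous_on T g" "continuous_on T h" for K :: "real \<Rightarrow> real" and g h and T :: "'b::topological_space set"
    by (intro continuous_on_compose2[OF that(1)] continuous_intros that) auto
  have d0: "((\<lambda>s. integral (cbox A B) (\<lambda>y. F y * X ((y - (c + s *\<^sub>R v)) \<bullet> (y - (c + s *\<^sub>R v))))) has_vector_derivative
     integral (cbox A B) (\<lambda>y. F y * (H ((y - (c + 0 *\<^sub>R v)) \<bullet> (y - (c + 0 *\<^sub>R v))) * (- 2 * ((y - (c + 0 *\<^sub>R v)) \<bullet> v))))) (at 0 within {-e..e})"
  proof (rule leibniz_rule_vector_derivative)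
    show "((\<lambda>s. F y * X ((y - (c + s *\<^sub>R v)) \<bullet> (y - (c + s *\<^sub>R v)))) has_vector_derivative
      F y * (H ((y - (c + s *\<^sub>R v)) \<bullet> (y - (c + s *\<^sub>R v))) * (- 2 * ((y - (c + s *\<^sub>R v)) \<bullet> v)))) (at s within {-e..e})" for s y
      unfolding has_real_derivative_iff_has_vector_derivative[symmetric]
      by (intro DERIV_cmult DERIV_chain2[OF X(1)] dr)
    show "(\<lambda>y. F y * X ((y - (c + s *\<^sub>R v)) \<bullet> (y - (c + s *\<^sub>R v)))) integrable_on cbox A B" for s
      by (intro integrable_continuous continuous_on_mult cr[OF Xc] continuous_on_id continuous_on_const continuous_on_subset[OF linear(2)]) auto
    show "continuous_on ({- e..e} \<times> cbox A B) (\<lambda>(s, y). F y * (H ((y - (c + s *\<^sub>R v)) \<bullet> (y - (c + s *\<^sub>R v))) * (- 2 * ((y - (c + s *\<^sub>R v)) \<bullet> v))))"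
      unfolding split_beta by (intro continuous_on_mult cr[OF linear(5)] continuous_intros continuous_on_compose2[OF linear(2)]) auto
  qed (use e in auto)
  have z0: "integral (cbox A B) (\<lambda>y. F y * X ((y - (c + s *\<^sub>R v)) \<bullet> (y - (c + s *\<^sub>R v)))) = 0" if "s \<in> {-e..e}" for s
  proof -
    have "integral UNIV (\<lambda>y. F y * X ((y - (c + s *\<^sub>R v)) \<bullet> (y - (c + s *\<^sub>R v)))) = 0"
      by (rule linear(3)[OF mv[OF that] Xc X(2)])
    then show ?thesis using far X(2) that
      by (subst integral_bounded_support(2)[symmetric]) (auto intro!: continuous_on_mult linear(2) cr[OF Xc] continuous_on_id continuous_on_const)
  qed
  have "((\<lambda>s. 0) has_vector_derivative
     integral (cbox A B) (\<lambda>y. F y * (H ((y - c) \<bullet> (y - c)) * (- 2 * ((y - c) \<bullet> v))))) (at 0 within {-e..e})"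
    using has_vector_derivative_transform[OF _ _ d0, of "\<lambda>s. 0"] e z0 by simp
  then have 0: "integral (cbox A B) (\<lambda>y. F y * (H ((y - c) \<bullet> (y - c)) * (- 2 * ((y - c) \<bullet> v)))) = 0"
    by (rule vector_derivative_of_zero[OF e])
  have Hc: "continuous_on UNIV (\<lambda>y. H ((y - c) \<bullet> (y - c)))"
    by (intro continuous_on_compose2[OF linear(5)] continuous_intros) auto
  have Hz: "H ((y - c) \<bullet> (y - c)) = 0" if "y \<notin> cbox A B" for y
    using far[OF that, of 0] e by (intro linear(6)) auto
  have supp: "k y * H ((y - c) \<bullet> (y - c)) = 0" if "y \<notin> cbox A B" for y k using Hz[OF that] by simp
  have int: "(\<lambda>y. k y * H ((y - c) \<bullet> (y - c))) integrable_on UNIV" if "continuous_on UNIV k" for k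
    by (rule integral_bounded_support(1)[of _ A B]) (intro continuous_on_mult that Hc, rule supp)
  have kc: "continuous_on UNIV (\<lambda>y. F y * (- 2 * ((y - c) \<bullet> v)))"
    by (intro continuous_on_mult linear(2) continuous_intros)
  have "integral UNIV (\<lambda>y. F y * (- 2 * ((y - c) \<bullet> v)) * H ((y - c) \<bullet> (y - c))) =
     integral (cbox A B) (\<lambda>y. F y * (- 2 * ((y - c) \<bullet> v)) * H ((y - c) \<bullet> (y - c)))"
    by (rule integral_bounded_support(2)) (intro continuous_on_mult[OF kc Hc], rule supp)
  also have "\<dots> = 0" unfolding 0[symmetric] by (intro integral_cong) (simp add: mult_ac)
  finally have 1: "integral UNIV (\<lambda>y. F y * (- 2 * ((y - c) \<bullet> v)) * H ((y - c) \<bullet> (y - c))) = 0" .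
  have 2: "integral UNIV (\<lambda>y. F y * H ((y - c) \<bullet> (y - c))) = 0" by (rule linear(3)[OF linear(4-6)])
  have "integral UNIV (\<lambda>y. f y * F y * H ((y - c) \<bullet> (y - c))) =
     integral UNIV (\<lambda>y. (- 1 / 2) * (F y * (- 2 * ((y - c) \<bullet> v)) * H ((y - c) \<bullet> (y - c))) + (c \<bullet> v) * (F y * H ((y - c) \<bullet> (y - c))))"
    by (intro integral_cong) (simp add: f inner_diff_left algebra_simps)
  also have "\<dots> = integral UNIV (\<lambda>y. (- 1 / 2) * (F y * (- 2 * ((y - c) \<bullet> v)) * H ((y - c) \<bullet> (y - c)))) + integral UNIV (\<lambda>y. (c \<bullet> v) * (F y * H ((y - c) \<bullet> (y - c))))"
    using int[OF kc] int[OF linear(2)] by (intro integral_add integrable_on_mult_right)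
  also have "\<dots> = 0" by (simp only: integral_mult_right 1 2 mult_zero_right add_0)
  finally show ?case .
next
  case (const k)
  have "integral UNIV (\<lambda>y. k * (F y * H ((y - c) \<bullet> (y - c)))) = 0" using const(2)[OF const(3-5)] by simp
  then show ?case by (simp add: mult.assoc)
next
  case (add f g)
  obtain A B where AB: "cball c (sqrt S) \<subseteq> cbox A B"
    using bounded_subset_cbox_symmetric[OF bounded_cball[of c "sqrt S"]] by blast
  have far: "(y - c) \<bullet> (y - c) \<ge> S" if "y \<notin> cbox A B" for y
    using AB that by (intro inner_ge_outside_cball) auto
  have int: "(\<lambda>y. p y * F y * H ((y - c) \<bullet> (y - c))) integrable_on UNIV" if "real_polynomial_function p" for p
  proof -
    have pc: "continuous_on UNIV p"
      using that unfolding real_polynomial_function_eq by (rule continuous_on_polymonial_function)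
    have Hc: "continuous_on UNIV (\<lambda>y. H ((y - c) \<bullet> (y - c)))"
      by (intro continuous_on_compose2[OF add.prems(4)] continuous_intros) auto
    show ?thesis
      by (rule integral_bounded_support(1)[of _ A B])
        (intro continuous_on_mult pc add.prems(1) Hc, simp add: far add.prems(5))
  qed
  have 1: "integral UNIV (\<lambda>y. f y * F y * H ((y - c) \<bullet> (y - c))) = 0"
    by (rule add.IH(1)) (fact add.prems)+
  have 2: "integral UNIV (\<lambda>y. g y * F y * H ((y - c) \<bullet> (y - c))) = 0"
    by (rule add.IH(2)) (fact add.prems)+
  have "integral UNIV (\<lambda>y. (f y + g y) * F y * H ((y - c) \<bullet> (y - c))) =
     integral UNIV (\<lambda>y. f y * F y * H ((y - c) \<bullet> (y - c)) + g y * F y * H ((y - c) \<bullet> (y - c)))"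
    by (simp add: distrib_right)
  also have "\<dots> = integral UNIV (\<lambda>y. f y * F y * H ((y - c) \<bullet> (y - c))) + integral UNIV (\<lambda>y. g y * F y * H ((y - c) \<bullet> (y - c)))"
    using int[OF add.hyps(1)] int[OF add.hyps(2)] by (rule integral_add)
  finally show ?case by (simp only: 1 2 add_0)
next
  case (mult f g)
  have gF: "continuous_on UNIV (\<lambda>y. g y * F y)"
    using mult.hyps(2) unfolding real_polynomial_function_eq by (intro continuous_on_mult continuous_on_polymonial_function mult.prems)
  have "integral UNIV (\<lambda>y. f y * (g y * F y) * H ((y - c) \<bullet> (y - c))) = 0"
  proof (rule mult.IH(1))
    show "integral UNIV (\<lambda>y. g y * F y * H ((y - c) \<bullet> (y - c))) = 0"
      if "c \<in> ball c0 \<delta>" "continuous_on UNIV H" "\<And>s. s \<ge> S \<Longrightarrow> H s = 0" for c H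
      by (rule mult.IH(2)) (fact mult.prems that)+
  qed (fact gF mult.prems)+
  then show ?case by (simp add: mult.assoc)
qed

text \<open>By the Weierstrass theorem \<open>F\<close> itself can play the role of the polynomial, so the integral of \<open>F\<^sup>2\<close>
against a positive weight on the ball vanishes.\<close>

lemma zero_of_radial_moments:
  fixes F :: "'a::euclidean_space \<Rightarrow> real"
  assumes d: "\<delta> > 0" and S: "S \<ge> 0" and F: "continuous_on UNIV F"
    and M: "\<And>c H. c \<in> ball c0 \<delta> \<Longrightarrow> continuous_on UNIV H \<Longrightarrow> (\<And>s. s \<ge> S \<Longrightarrow> H s = 0) \<Longrightarrow>
       integral UNIV (\<lambda>y. F y * H ((y - c) \<bullet> (y - c))) = 0"
    and y: "norm (y - c0) < sqrt S"
  shows "F y = 0"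
proof -
  define H where "H s = max 0 (S - s)" for s
  have H: "continuous_on UNIV H" "\<And>s. s \<ge> S \<Longrightarrow> H s = 0" "\<And>s. H s \<ge> 0"
    by (auto simp: H_def intro!: continuous_intros)
  define h where "h y = H ((y - c0) \<bullet> (y - c0))" for y
  have h: "continuous_on UNIV h" unfolding h_def
    by (intro continuous_on_compose2[OF H(1)] continuous_intros) auto
  obtain A B where AB: "cball c0 (sqrt S + 1) \<subseteq> cbox A B"
    using bounded_subset_cbox_symmetric[OF bounded_cball[of c0 "sqrt S + 1"]] by blast
  have far: "h y = 0" if "y \<notin> cball c0 (sqrt S)" for y
    unfolding h_def by (intro H(2) inner_ge_outside_cball that)
  have far': "h y = 0" if "y \<notin> cbox A B" for y
    using that AB S by (intro far) (auto simp: subset_iff)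
  have Fh: "continuous_on UNIV (\<lambda>y. \<bar>F y\<bar> * h y)" by (intro continuous_intros F h)
  have Fh2: "continuous_on UNIV (\<lambda>y. F y * F y * h y)" by (intro continuous_intros F h)
  have nn: "integral UNIV (\<lambda>y. F y * F y * h y) \<ge> 0"
    by (rule integral_nonneg[OF integral_bounded_support(1)[OF Fh2, of A B]]) (use far' in \<open>auto simp: h_def H(3)\<close>)
  have le: "integral UNIV (\<lambda>y. F y * F y * h y) \<le> e * integral UNIV (\<lambda>y. \<bar>F y\<bar> * h y)" if "e > 0" for e
  proof -
    obtain p where p: "real_polynomial_function p" "\<And>x. x \<in> cball c0 (sqrt S) \<Longrightarrow> \<bar>F x - p x\<bar> < e"
      by (rule Stone_Weierstrass_real_polynomial_function[OF compact_cball continuous_on_subset[OF F] \<open>e > 0\<close>]) auto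
    have pc: "continuous_on UNIV p"
      using p(1) unfolding real_polynomial_function_eq by (rule continuous_on_polymonial_function)
    have "integral UNIV (\<lambda>y. F y * F y * h y) = integral UNIV (\<lambda>y. (F y - p y) * F y * h y + p y * F y * h y)"
      by (intro integral_cong) (simp add: algebra_simps)
    also have "\<dots> = integral UNIV (\<lambda>y. (F y - p y) * F y * h y) + integral UNIV (\<lambda>y. p y * F y * h y)"
      by (intro integral_add integral_bounded_support(1)[of _ A B] continuous_intros F h pc) (use far' in auto)
    also have "integral UNIV (\<lambda>y. p y * F y * h y) = 0"
      unfolding h_def using d H by (intro polynomial_moments_zero[OF p(1) d S F M]) auto
    also have "integral UNIV (\<lambda>y. (F y - p y) * F y * h y) \<le> integral UNIV (\<lambda>y. e * (\<bar>F y\<bar> * h y))"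
    proof (rule integral_le)
      show "(F y - p y) * F y * h y \<le> e * (\<bar>F y\<bar> * h y)" for y
      proof (cases "y \<in> cball c0 (sqrt S)")
        case True
        have "(F y - p y) * F y \<le> \<bar>F y - p y\<bar> * \<bar>F y\<bar>" by (simp flip: abs_mult)
        also have "\<dots> \<le> e * \<bar>F y\<bar>" using p(2)[OF True] by (intro mult_right_mono) auto
        finally show ?thesis using H(3) by (simp add: h_def mult_right_mono flip: mult.assoc)
      qed (simp add: far)
    qed (intro integral_bounded_support(1)[of _ A B] continuous_intros F h pc; use far' in auto)+
    finally show ?thesis by simp
  qed
  have "integral UNIV (\<lambda>y. F y * F y * h y) = 0"
  proof (rule ccontr)
    define I where "I = integral UNIV (\<lambda>y. \<bar>F y\<bar> * h y)"
    assume "\<not> ?thesis"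
    then have pos: "integral UNIV (\<lambda>y. F y * F y * h y) > 0" using nn by simp
    define e where "e = integral UNIV (\<lambda>y. F y * F y * h y) / (2 * (\<bar>I\<bar> + 1))"
    have "e > 0" using pos by (simp add: e_def)
    have "e * I \<le> e * (\<bar>I\<bar> + 1)" using \<open>e > 0\<close> by (intro mult_left_mono) auto
    also have "\<dots> < integral UNIV (\<lambda>y. F y * F y * h y)" proof -
      have "x / (2 * k) * k < x" if "x > 0" "k > 0" for x k :: real using that by simp
      from this[OF pos, of "\<bar>I\<bar> + 1"] show ?thesis by (simp add: e_def)
    qed
    finally show False using le[OF \<open>e > 0\<close>] by (simp add: I_def)
  qed
  then have "integral (cbox A B) (\<lambda>y. F y * F y * h y) = 0"
    using integral_bounded_support(2)[OF Fh2, of A B] far' by simp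
  then have hi: "((\<lambda>y. F y * F y * h y) has_integral 0) (cbox A B)"
    using integrable_integral[OF integrable_continuous[OF continuous_on_subset[OF Fh2], of A B]] by simp
  have yb: "y \<in> ball c0 (sqrt S + 1)" using y by (auto simp: dist_norm norm_minus_commute)
  have "ball c0 (sqrt S + 1) \<subseteq> interior (cbox A B)"
    using AB by (intro interior_maximal) (auto simp: subset_iff)
  then have "y \<in> box A B" using yb by auto
  then have "F y * F y * h y = 0"
    using has_integral_0_cbox_imp_0[OF continuous_on_subset[OF Fh2] _ hi, of y] H(3) box_subset_cbox[of A B]
    by (auto simp: h_def)
  moreover have "h y > 0" using y S by (simp add: h_def H_def norm_eq_sqrt_inner)
  ultimately show ?thesis by simp
qed

context laplace_chain
begin

text \<open>The centre needs room to move, so the inner radius is taken to be \<open>9/10\<close> of \<open>\<rho>\<close>.  With \<open>S = 2a\<close> the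
outer radius is \<open>\<surd>2 \<cdot> 9/10 \<cdot> \<rho>\<close>, which lies between \<open>6/5 \<rho>\<close> and \<open>13/10 \<rho>\<close>.\<close>

lemma zero_ball_grow:
  assumes cb: "cball c (2 * \<rho>) \<subseteq> D" and \<rho>: "\<rho> > 0" and small: "A * exp (real DIM('a)) * \<rho>\<^sup>2 < 1"
    and zero: "\<And>j y. y \<in> ball c \<rho> \<Longrightarrow> G j y = 0" and y: "y \<in> ball c (6 / 5 * \<rho>)"
  shows "G i y = 0"
proof -
  define a where "a = (9 / 10 * \<rho>)\<^sup>2"
  \<comment> \<open>a continuous function on the whole space that agrees with \<open>G i\<close> on the ball in question\<close>
  define F where "F x = G i (closest_point (cball c (2 * \<rho>)) x)" for x
  have F_eq: "F x = G i x" if "x \<in> cball c (2 * \<rho>)" for x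
    using that by (simp add: F_def closest_point_self)
  have F: "continuous_on UNIV F" unfolding F_def
    using cb \<rho> by (intro continuous_on_compose2[OF continuous_on_subset[OF cont cb]] continuous_on_closest_point)
      (auto intro!: closest_point_in_set)
  have a: "a > 0" using \<rho> by (simp add: a_def)
  have aS: "A * exp (real DIM('a)) * a < 1"
  proof -
    have "a \<le> \<rho>\<^sup>2" using \<rho> by (simp add: a_def power_mult_distrib)
    then have "A * exp (real DIM('a)) * a \<le> A * exp (real DIM('a)) * \<rho>\<^sup>2"
      using A_pos by (intro mult_left_mono) auto
    then show ?thesis using small by simp
  qed
  have S1: "sqrt (2 * a) \<le> 13 / 10 * \<rho>" using \<rho>
    by (intro real_le_lsqrt) (auto simp: a_def power2_eq_square field_simps)
  have S2: "6 / 5 * \<rho> < sqrt (2 * a)" using \<rho>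
    by (intro real_less_rsqrt) (auto simp: a_def power2_eq_square field_simps)
  have "F y = 0"
  proof (rule zero_of_radial_moments[of "\<rho> / 10" "2 * a" F c, OF _ _ F])
    fix c' H assume c': "c' \<in> ball c (\<rho> / 10)" and H: "continuous_on UNIV H" "\<And>s. s \<ge> 2 * a \<Longrightarrow> H s = (0::real)"
    have near: "x \<in> cball c (2 * \<rho>)" if "norm (x - c') \<le> sqrt (2 * a)" for x
      using norm_triangle_ineq[of "x - c'" "c' - c"] that c' S1 \<rho> by (auto simp: dist_norm norm_minus_commute)
    have "integral UNIV (\<lambda>x. F x * H ((x - c') \<bullet> (x - c'))) = integral UNIV (\<lambda>x. G i x * H ((x - c') \<bullet> (x - c')))"
    proof (rule integral_cong)
      fix x
      show "F x * H ((x - c') \<bullet> (x - c')) = G i x * H ((x - c') \<bullet> (x - c'))"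
        using near[of x] F_eq[of x] H(2)[of "(x - c') \<bullet> (x - c')"]
        by (cases "(x - c') \<bullet> (x - c') \<le> 2 * a") (auto simp: norm_eq_sqrt_inner)
    qed
    also have "\<dots> = 0"
    proof (rule radial_integral_zero[OF a _ aS _ H])
      show "cball c' (sqrt (2 * a)) \<subseteq> D" using near cb by (auto simp: dist_norm norm_minus_commute subset_iff)
      show "G j x = 0" if "(x - c') \<bullet> (x - c') < a" for j x
      proof (rule zero)
        have "norm (x - c') < 9 / 10 * \<rho>" using that \<rho> real_sqrt_less_iff[of "(x - c') \<bullet> (x - c')" a]
          by (simp add: norm_eq_sqrt_inner a_def)
        then show "x \<in> ball c \<rho>" using norm_triangle_ineq[of "x - c'" "c' - c"] c'
          by (auto simp: dist_norm norm_minus_commute)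
      qed
    qed
    finally show "integral UNIV (\<lambda>x. F x * H ((x - c') \<bullet> (x - c'))) = 0" .
  qed (use \<rho> a S2 y in \<open>auto simp: dist_norm norm_minus_commute\<close>)
  then show ?thesis using F_eq[of y] y \<rho> by auto
qed

text \<open>The smallness condition depends on the radius only, so the growth step can be repeated until
radius \<open>r\<close> is reached, however small the first ball is.\<close>

lemma zero_ball_full:
  assumes cb: "cball c (2 * r) \<subseteq> D" and small: "A * exp (real DIM('a)) * r\<^sup>2 < 1"
    and e: "\<epsilon> > 0" and r: "r > 0" and zero: "\<And>j y. y \<in> ball c \<epsilon> \<Longrightarrow> G j y = 0" and y: "y \<in> ball c r"
  shows "G i y = 0"
proof -
  define \<rho> where "\<rho> k = min r (\<epsilon> * (6 / 5) ^ k)" for k :: nat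
  have "\<forall>j. \<forall>y\<in>ball c (\<rho> k). G j y = 0" for k
  proof (induction k)
    case 0
    then show ?case using zero by (auto simp: \<rho>_def)
  next
    case (Suc k)
    have p: "0 < \<rho> k" "\<rho> k \<le> r" using e r by (auto simp: \<rho>_def)
    have "A * exp (real DIM('a)) * (\<rho> k)\<^sup>2 \<le> A * exp (real DIM('a)) * r\<^sup>2"
      using A_pos p by (intro mult_left_mono power_mono) auto
    then have s: "A * exp (real DIM('a)) * (\<rho> k)\<^sup>2 < 1" using small by simp
    have cb': "cball c (2 * \<rho> k) \<subseteq> D" using cb p by (auto simp: subset_iff)
    have "\<rho> (Suc k) \<le> 6 / 5 * \<rho> k" using e r by (auto simp: \<rho>_def min_def)
    then show ?case using zero_ball_grow[OF cb' p(1) s] Suc.IH by force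
  qed
  moreover obtain k where "r / \<epsilon> < (6 / 5) ^ k" using real_arch_pow[of "6 / 5" "r / \<epsilon>"] by auto
  then have "\<rho> k = r" using e by (simp add: \<rho>_def field_simps)
  ultimately show ?thesis using y by metis
qed

end

section \<open>The Poisson equation across a boundary with vanishing Cauchy data\<close>

lemma partial_on_mult_supported:
  fixes F \<phi> :: "'a::euclidean_space \<Rightarrow> real"
  assumes F: "partial_on D v F F'" and \<phi>: "partial_on UNIV v \<phi> \<phi>'"
    and K: "closed K" "K \<subseteq> D" "\<And>y. y \<notin> K \<Longrightarrow> \<phi> y = 0" "\<And>y. y \<notin> K \<Longrightarrow> \<phi>' y = 0"
  shows "partial_on UNIV v (\<lambda>y. F y * \<phi> y) (\<lambda>y. F' y * \<phi> y + F y * \<phi>' y)"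
  unfolding partial_on_def
proof
  fix p
  show "((\<lambda>s. F (p + s *\<^sub>R v) * \<phi> (p + s *\<^sub>R v)) has_vector_derivative F' p * \<phi> p + F p * \<phi>' p) (at 0)"
  proof (cases "p \<in> D")
    case True
    then have "((\<lambda>s. F (p + s *\<^sub>R v)) has_vector_derivative F' p) (at 0)"
      "((\<lambda>s. \<phi> (p + s *\<^sub>R v)) has_vector_derivative \<phi>' p) (at 0)"
      using F \<phi> by (auto simp: partial_on_def)
    from has_vector_derivative_mult[OF this] show ?thesis by (simp add: add.commute)
  next
    case False
    then have pK: "p \<notin> K" using K by auto
    have o: "open ((\<lambda>s. p + s *\<^sub>R v) -` (- K))"
      using K(1) by (intro continuous_open_vimage continuous_intros) auto
    have "((\<lambda>s. 0) has_vector_derivative 0) (at (0::real))" by simp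
    then have "((\<lambda>s. F (p + s *\<^sub>R v) * \<phi> (p + s *\<^sub>R v)) has_vector_derivative 0) (at 0)"
      by (rule has_vector_derivative_transform_within_open[OF _ o]) (use pK K in auto)
    then show ?thesis using K pK by simp
  qed
qed

lemma has_derivative_square_pos_part:
  "((\<lambda>s. (max 0 s)\<^sup>2) has_real_derivative 2 * max 0 s) (at (s::real))"
proof -
  consider "s > 0" | "s < 0" | "s = 0" by linarith
  then show ?thesis
  proof cases
    case 1
    have "((\<lambda>s. s\<^sup>2) has_real_derivative 2 * max 0 s) (at s)"
      using 1 by (auto intro!: derivative_eq_intros)
    then show ?thesis
      by (rule has_field_derivative_transform_within_open[of _ _ _ "{0<..}"]) (use 1 in auto)
  next
    case 2
    have "((\<lambda>s. 0) has_real_derivative 2 * max 0 s) (at s)" using 2 by simp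
    then show ?thesis
      by (rule has_field_derivative_transform_within_open[of _ _ _ "{..<0}"]) (use 2 in auto)
  next
    case 3
    have "((\<lambda>y. (max 0 y)\<^sup>2 / y) \<longlongrightarrow> 0) (at (0::real))"
    proof (rule Lim_null_comparison)
      show "\<forall>\<^sub>F y in at 0. norm ((max 0 y)\<^sup>2 / y) \<le> \<bar>y :: real\<bar>"
        by (intro always_eventually allI) (auto simp: max_def power2_eq_square)
      show "((\<lambda>y. \<bar>y :: real\<bar>) \<longlongrightarrow> 0) (at 0)" by (auto intro!: tendsto_eq_intros)
    qed
    then show ?thesis unfolding 3 has_field_derivative_iff by simp
  qed
qed

text \<open>A quadratic spline of class \<open>C\<^sup>1\<close> that rises from \<open>0\<close> at \<open>0\<close> to \<open>1\<close> at \<open>1\<close>.\<close>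

definition smooth_step :: "real \<Rightarrow> real" where
  "smooth_step x = 2 * (max 0 x)\<^sup>2 - 4 * (max 0 (x - 1 / 2))\<^sup>2 + 2 * (max 0 (x - 1))\<^sup>2"

definition smooth_step' :: "real \<Rightarrow> real" where
  "smooth_step' x = 4 * max 0 x - 8 * max 0 (x - 1 / 2) + 4 * max 0 (x - 1)"

lemma smooth_step_deriv: "(smooth_step has_real_derivative smooth_step' x) (at x)"
proof -
  have "((\<lambda>x. (max 0 (x - k))\<^sup>2) has_real_derivative 2 * max 0 (x - k)) (at x)" for k :: real
    using DERIV_chain2[OF has_derivative_square_pos_part DERIV_diff[OF DERIV_ident DERIV_const], of k x UNIV] by simp
  from DERIV_add[OF DERIV_diff[OF DERIV_cmult[OF this[of 0], of 2] DERIV_cmult[OF this[of "1 / 2"], of 4]] DERIV_cmult[OF this[of 1], of 2]]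
  show ?thesis unfolding smooth_step_def[abs_def] smooth_step'_def[abs_def] by simp
qed

lemma smooth_step:
  "x \<le> 0 \<Longrightarrow> smooth_step x = 0" "x \<ge> 1 \<Longrightarrow> smooth_step x = 1" "0 \<le> smooth_step x" "smooth_step x \<le> 1"
  "0 \<le> smooth_step' x" "x \<le> 0 \<Longrightarrow> smooth_step' x = 0" "x \<ge> 1 \<Longrightarrow> smooth_step' x = 0"
proof -
  show e0: "smooth_step x = 0" if "x \<le> 0" for x using that by (simp add: smooth_step_def max_def)
  show e1: "smooth_step x = 1" if "x \<ge> 1" for x
    using that by (simp add: smooth_step_def max_def power2_eq_square algebra_simps)
  show d: "0 \<le> smooth_step' x" for x by (auto simp: smooth_step'_def max_def)
  have mono: "smooth_step x \<le> smooth_step y" if "x \<le> y" for x y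
    by (rule DERIV_nonneg_imp_nondecreasing[OF that]) (use smooth_step_deriv d in blast)
  show "0 \<le> smooth_step x" using mono[of "min x 0" x] e0[of "min x 0"] by simp
  show "smooth_step x \<le> 1" using mono[of x "max x 1"] e1[of "max x 1"] by simp
  show "smooth_step' x = 0" if "x \<le> 0" using that by (simp add: smooth_step'_def max_def)
  show "smooth_step' x = 0" if "x \<ge> 1" using that by (simp add: smooth_step'_def max_def)
qed

lemma smooth_step_cont: "continuous_on UNIV smooth_step" "continuous_on UNIV smooth_step'"
  unfolding smooth_step_def[abs_def] smooth_step'_def[abs_def] by (intro continuous_intros)+

lemma enlarged_cball:
  fixes c :: "'a::euclidean_space"
  assumes "open D" "cball c r \<subseteq> D" "r \<ge> 0"
  obtains r' where "r' > r" "cball c r' \<subseteq> D"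
proof -
  obtain e where e: "e > 0" "(\<Union>x\<in>cball c r. ball x e) \<subseteq> D"
    using compact_subset_open_imp_ball_epsilon_subset[OF compact_cball assms(1,2)] by blast
  have "cball c (r + e / 2) \<subseteq> D"
  proof
    fix y assume y: "y \<in> cball c (r + e / 2)"
    show "y \<in> D"
    proof (cases "y \<in> cball c r")
      case False
      define x where "x = c + (r / dist c y) *\<^sub>R (y - c)"
      have d: "dist c y > r" using False by simp
      have n: "norm (y - c) = dist c y" by (simp add: dist_norm norm_minus_commute)
      have "dist c y > 0" using d assms(3) by linarith
      then have "dist c x = r" using assms(3) n unfolding x_def dist_norm by simp
      moreover have "y - x = (1 - r / dist c y) *\<^sub>R (y - c)" by (simp add: x_def algebra_simps)
      then have "dist x y = \<bar>1 - r / dist c y\<bar> * dist c y"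
        unfolding n[symmetric] by (metis dist_commute dist_norm norm_scaleR)
      then have "dist x y = dist c y - r" using d assms(3) by (simp add: abs_if field_simps split: if_splits)
      ultimately have "x \<in> cball c r" "y \<in> ball x e" using y e(1) by auto
      then show ?thesis using e(2) by blast
    qed (use assms(2) in auto)
  qed
  then show ?thesis using e(1) by (intro that[of "r + e / 2"]) auto
qed

text \<open>Inside \<open>D\<close> the set \<open>\<Omega>\<close> is a sublevel set of \<open>d\<close>, and one partial derivative of \<open>d\<close>, of constant sign,
dominates all of them.  This covers a neighbourhood of a smooth boundary point, and also the
interior case \<open>\<Omega> = D\<close>, by a constant \<open>d\<close>.\<close>

locale one_sided_domain =
  fixes D \<Omega> :: "'a::euclidean_space set" and d :: "'a \<Rightarrow> real" and d' :: "'a \<Rightarrow> 'a \<Rightarrow> real"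
    and b0 :: 'a and \<sigma> C :: real
  assumes open_D: "open D" and dc: "continuous_on D d" and dd: "\<And>b. b \<in> Basis \<Longrightarrow> partial_on D b d (d' b)"
    and d'c: "\<And>b. b \<in> Basis \<Longrightarrow> continuous_on D (d' b)"
    and O_def: "\<Omega> = {y \<in> D. d y < 0}" and b0: "b0 \<in> Basis" and \<sigma>: "\<bar>\<sigma>\<bar> = 1" and C0: "C \<ge> 0"
    and dom: "\<And>b y. b \<in> Basis \<Longrightarrow> y \<in> D \<Longrightarrow> \<bar>d' b y\<bar> \<le> C * (\<sigma> * d' b0 y)"
begin

text \<open>The cutoff vanishes where \<open>d \<ge> - h\<close> and equals \<open>1\<close> where \<open>d \<le> - 2h\<close>.\<close>

definition cutoff :: "real \<Rightarrow> 'a \<Rightarrow> real" where "cutoff h y = smooth_step (- d y / h - 1)"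
definition cutoff' :: "real \<Rightarrow> 'a \<Rightarrow> 'a \<Rightarrow> real" where "cutoff' h b y = smooth_step' (- d y / h - 1) * (- d' b y / h)"

lemma cutoff_partial: "b \<in> Basis \<Longrightarrow> partial_on D b (cutoff h) (cutoff' h b)"
  unfolding partial_on_def
proof
  fix p assume b: "b \<in> Basis" and p: "p \<in> D"
  have "((\<lambda>s. d (p + s *\<^sub>R b)) has_real_derivative d' b p) (at 0)"
    using dd[OF b] p by (simp add: partial_on_def has_real_derivative_iff_has_vector_derivative)
  then have "((\<lambda>s. - d (p + s *\<^sub>R b) / h - 1) has_real_derivative - d' b p / h - 0) (at 0)"
    by (intro DERIV_diff DERIV_cdivide DERIV_minus DERIV_const)
  then have "((\<lambda>s. - d (p + s *\<^sub>R b) / h - 1) has_real_derivative - d' b p / h) (at 0)" by simp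
  from DERIV_chain2[OF smooth_step_deriv this]
  show "((\<lambda>s. cutoff h (p + s *\<^sub>R b)) has_vector_derivative cutoff' h b p) (at 0)"
    by (simp add: cutoff_def cutoff'_def has_real_derivative_iff_has_vector_derivative)
qed

lemma cutoff_cont: "h > 0 \<Longrightarrow> continuous_on D (cutoff h)" "h > 0 \<Longrightarrow> b \<in> Basis \<Longrightarrow> continuous_on D (cutoff' h b)"
  unfolding cutoff_def[abs_def] cutoff'_def[abs_def]
  by (intro continuous_intros continuous_on_compose2[OF smooth_step_cont(1)] continuous_on_compose2[OF smooth_step_cont(2)] dc d'c; simp)+

lemma cutoff_bounds: "0 \<le> cutoff h y" "cutoff h y \<le> 1" "\<bar>cutoff h y\<bar> \<le> 1"
  using smooth_step(3,4) by (auto simp: cutoff_def)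

lemma cutoff_zero: "h > 0 \<Longrightarrow> d y \<ge> - h \<Longrightarrow> cutoff h y = 0 \<and> cutoff' h b y = 0"
  by (simp add: cutoff_def cutoff'_def smooth_step field_simps)

lemma cutoff'_layer: "h > 0 \<Longrightarrow> d y \<le> - (2 * h) \<Longrightarrow> cutoff' h b y = 0"
  by (simp add: cutoff'_def smooth_step field_simps)

lemma cutoff'_dom:
  assumes "h > 0" "b \<in> Basis" "y \<in> D"
  shows "\<bar>cutoff' h b y\<bar> \<le> C * (- \<sigma> * cutoff' h b0 y)"
proof -
  have "\<bar>cutoff' h b y\<bar> = smooth_step' (- d y / h - 1) / h * \<bar>d' b y\<bar>"
    using assms smooth_step(5) by (simp add: cutoff'_def abs_mult)
  also have "\<dots> \<le> smooth_step' (- d y / h - 1) / h * (C * (\<sigma> * d' b0 y))"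
    using assms smooth_step(5) by (intro mult_left_mono dom) auto
  finally show ?thesis by (simp add: cutoff'_def mult_ac)
qed

lemma cutoff_limit:
  assumes P: "continuous_on UNIV P" "\<And>y. y \<notin> cbox u v \<Longrightarrow> P y = 0" "\<And>y. y \<notin> \<Omega> \<Longrightarrow> P y = 0"
    and Pc: "\<And>k. continuous_on UNIV (\<lambda>y. cutoff (1 / Suc k) y * P y)"
  shows "(\<lambda>k. integral UNIV (\<lambda>y. cutoff (1 / Suc k) y * P y)) \<longlonglongrightarrow> integral UNIV P"
proof (rule dominated_convergence(2))
  show "(\<lambda>y. cutoff (1 / Suc k) y * P y) integrable_on UNIV" for k
    by (rule integral_bounded_support(1)[OF Pc, of u v]) (simp add: P(2))
  show "(\<lambda>y. \<bar>P y\<bar>) integrable_on UNIV"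
    by (rule integral_bounded_support(1)[of _ u v]) (intro continuous_intros P(1), simp add: P(2))
  show "norm (cutoff (1 / Suc k) y * P y) \<le> \<bar>P y\<bar>" for k y
    using mult_right_mono[OF cutoff_bounds(3), of "\<bar>P y\<bar>"] by (simp add: abs_mult)
  show "(\<lambda>k. cutoff (1 / Suc k) y * P y) \<longlonglongrightarrow> P y" for y
  proof (cases "y \<in> \<Omega>")
    case True
    then have dy: "d y < 0" using O_def by auto
    obtain k0 :: nat where k0: "real k0 > 2 / (- d y)" using reals_Archimedean2 by blast
    have "cutoff (1 / Suc k) y * P y = P y" if "k \<ge> k0" for k
    proof -
      have "real (Suc k) > 2 / (- d y)" using k0 that by linarith
      then have "- d y * real (Suc k) > 2" using dy by (simp add: field_simps)
      then have "- d y / (1 / Suc k) - 1 \<ge> 1" by simp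
      then show ?thesis unfolding cutoff_def by (subst smooth_step(2)) auto
    qed
    then show ?thesis by (intro tendsto_eventually eventually_sequentiallyI)
  qed (simp add: P(3))
qed

text \<open>The gradient of the cutoff is of size \<open>1 / h\<close> on a layer along the boundary.  Its integral stays
bounded as \<open>h\<close> tends to \<open>0\<close>: the derivative in the dominating direction \<open>b0\<close> has a constant sign, so its
absolute value can be integrated by parts against a fixed bump \<open>\<beta>\<close>, and the cutoff itself is at
most \<open>1\<close>.  No measure of the layer has to be computed.\<close>

lemma cutoff_layer_integral:
  assumes K: "cball c r \<subseteq> D" "r \<ge> 0"
  obtains \<beta> M where "continuous_on UNIV \<beta>" "\<And>y. \<beta> y \<ge> 0" "\<And>y. y \<in> cball c r \<Longrightarrow> \<beta> y \<ge> 1"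
    "\<And>h. h > 0 \<Longrightarrow> continuous_on UNIV (\<lambda>y. cutoff' h b0 y * \<beta> y)"
    "\<And>h. h > 0 \<Longrightarrow> (\<lambda>y. (- \<sigma> * cutoff' h b0 y) * \<beta> y) integrable_on UNIV"
    "\<And>h. h > 0 \<Longrightarrow> integral UNIV (\<lambda>y. (- \<sigma> * cutoff' h b0 y) * \<beta> y) \<le> M"
    "M \<ge> 0" "\<And>y. y \<notin> D \<Longrightarrow> \<beta> y = 0"
proof -
  obtain R where R: "R > r" "cball c R \<subseteq> D" using enlarged_cball[OF open_D K] .
  have q: "R\<^sup>2 - r\<^sup>2 > 0" using R K(2) by (simp add: power_strict_mono)
  define k where "k = 1 / (R\<^sup>2 - r\<^sup>2)\<^sup>2"
  define \<beta> where "\<beta> y = k * (max 0 (R\<^sup>2 - (y - c) \<bullet> (y - c)))\<^sup>2" for y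
  define \<beta>' where "\<beta>' y = k * (2 * max 0 (R\<^sup>2 - (y - c) \<bullet> (y - c)) * (- 2 * ((y - c) \<bullet> b0)))" for y
  have \<beta>c: "continuous_on UNIV \<beta>" and \<beta>'c: "continuous_on UNIV \<beta>'"
    unfolding \<beta>_def \<beta>'_def by (intro continuous_intros)+
  have k: "k > 0" using q by (simp add: k_def)
  have \<beta>0: "\<beta> y \<ge> 0" for y using k by (simp add: \<beta>_def)
  have \<beta>1: "\<beta> y \<ge> 1" if "y \<in> cball c r" for y
  proof -
    have "(y - c) \<bullet> (y - c) \<le> r\<^sup>2" unfolding power2_norm_eq_inner[symmetric]
      using that K by (intro power_mono) (auto simp: dist_norm norm_minus_commute)
    then have "(R\<^sup>2 - r\<^sup>2)\<^sup>2 \<le> (max 0 (R\<^sup>2 - (y - c) \<bullet> (y - c)))\<^sup>2"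
      using q by (intro power_mono) auto
    then show ?thesis using q by (simp add: \<beta>_def k_def)
  qed
  have z: "\<beta> y = 0" "\<beta>' y = 0" if "y \<notin> cball c R" for y
    using inner_ge_outside_cball[of y c "R\<^sup>2"] that R K by (auto simp: \<beta>_def \<beta>'_def)
  have p: "partial_on UNIV b0 \<beta> \<beta>'"
    unfolding partial_on_def has_real_derivative_iff_has_vector_derivative[symmetric]
  proof
    fix y
    have "((\<lambda>s. R\<^sup>2 - (y + s *\<^sub>R b0 - c) \<bullet> (y + s *\<^sub>R b0 - c)) has_real_derivative - 2 * ((y - c) \<bullet> b0)) (at 0)"
      unfolding has_field_derivative_def
      by (auto intro!: derivative_eq_intros simp: inner_commute algebra_simps)
    from DERIV_cmult[OF DERIV_chain2[OF has_derivative_square_pos_part this], of k]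
    show "((\<lambda>s. \<beta> (y + s *\<^sub>R b0)) has_real_derivative \<beta>' y) (at 0)" by (simp add: \<beta>_def \<beta>'_def)
  qed
  obtain u v where uv: "cball c R \<subseteq> cbox u v"
    using bounded_subset_cbox_symmetric[OF bounded_cball[of c R]] by blast
  have zb: "\<beta> y = 0" "\<beta>' y = 0" if "y \<notin> cbox u v" for y using z[of y] uv that by blast+
  define M where "M = integral UNIV (\<lambda>y. \<bar>\<beta>' y\<bar>)"
  have Mi: "(\<lambda>y. \<bar>\<beta>' y\<bar>) integrable_on UNIV"
    by (rule integral_bounded_support(1)[of _ u v]) (auto intro!: continuous_intros \<beta>'c zb)
  have c1: "continuous_on UNIV (\<lambda>y. cutoff' h b0 y * \<beta> y)" if "h > 0" for h
    by (rule continuous_times_supported[OF open_D cutoff_cont(2)[OF that b0] \<beta>c _ R(2)]) (auto simp: z)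
  have c2: "continuous_on UNIV (\<lambda>y. cutoff h y * \<beta>' y)" if "h > 0" for h
    by (rule continuous_times_supported[OF open_D cutoff_cont(1)[OF that] \<beta>'c _ R(2)]) (auto simp: z)
  have c3: "continuous_on UNIV (\<lambda>y. cutoff h y * \<beta> y)" if "h > 0" for h
    by (rule continuous_times_supported[OF open_D cutoff_cont(1)[OF that] \<beta>c _ R(2)]) (auto simp: z)
  have i1: "(\<lambda>y. cutoff' h b0 y * \<beta> y) integrable_on UNIV" and i2: "(\<lambda>y. cutoff h y * \<beta>' y) integrable_on UNIV" if "h > 0" for h
    by (rule integral_bounded_support(1)[of _ u v], rule c1[OF that] c2[OF that], simp add: zb)+
  have bd: "integral UNIV (\<lambda>y. (- \<sigma> * cutoff' h b0 y) * \<beta> y) \<le> M" if h: "h > 0" for h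
  proof -
    have "integral UNIV (\<lambda>y. cutoff' h b0 y * \<beta> y + cutoff h y * \<beta>' y) = 0"
      by (rule integral_partial_zero[where a = u and b = v, OF c3[OF h] continuous_on_add[OF c1[OF h] c2[OF h]]])
        (rule partial_on_mult_supported[OF cutoff_partial[OF b0] p _ R(2)], auto simp: z zb)
    then have "integral UNIV (\<lambda>y. cutoff' h b0 y * \<beta> y) = - integral UNIV (\<lambda>y. cutoff h y * \<beta>' y)"
      using integral_add[OF i1[OF h] i2[OF h]] by simp
    then have "integral UNIV (\<lambda>y. (- \<sigma> * cutoff' h b0 y) * \<beta> y) = \<sigma> * integral UNIV (\<lambda>y. cutoff h y * \<beta>' y)"
      by (simp add: mult.assoc)
    also have "\<dots> \<le> \<bar>integral UNIV (\<lambda>y. cutoff h y * \<beta>' y)\<bar>"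
      using \<sigma> by (metis abs_ge_self abs_mult mult_1)
    also have "\<dots> \<le> M" unfolding M_def real_norm_def[symmetric]
      by (rule integral_norm_bound_integral[OF i2[OF h] Mi[folded real_norm_def]])
        (use mult_right_mono[OF cutoff_bounds(3)] in \<open>simp add: abs_mult\<close>)
    finally show ?thesis .
  qed
  show ?thesis
  proof (rule that[of \<beta> M])
    show "(\<lambda>y. (- \<sigma> * cutoff' h b0 y) * \<beta> y) integrable_on UNIV" if "h > 0" for h
      using integrable_on_mult_right[OF i1[OF that], of "- \<sigma>"] by (simp add: mult.assoc)
    show "M \<ge> 0" unfolding M_def by (rule integral_nonneg[OF Mi]) simp
    show "\<beta> y = 0" if "y \<notin> D" for y using z(1)[of y] R(2) that by blast
  qed (use \<beta>c \<beta>0 \<beta>1 c1 bd in auto)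
qed

text \<open>If \<open>F\<close> is of class \<open>C\<^sup>1\<close> on \<open>D\<close> and its gradient vanishes off \<open>\<Omega>\<close>, then no boundary term appears
and the Poisson equation in \<open>\<Omega>\<close> holds weakly in \<open>D\<close>.  The pure second derivatives need not be bounded
near the boundary; only their sum, the Laplacian, is assumed to extend continuously.  So the second integration by
parts is done with the cutoff, for all directions at once.  The error contains the gradient of the
cutoff, with bounded integral, times the gradient of \<open>F\<close>, which is small in the layer.\<close>

lemma weak_poissonI:
  assumes Fc: "continuous_on D F" and Fp: "\<And>b. b \<in> Basis \<Longrightarrow> partial_on D b F (F' b)"
    and F'c: "\<And>b. b \<in> Basis \<Longrightarrow> continuous_on D (F' b)"
    and F'z: "\<And>b y. b \<in> Basis \<Longrightarrow> y \<in> D \<Longrightarrow> y \<notin> \<Omega> \<Longrightarrow> F' b y = 0"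
    and F'p: "\<And>b. b \<in> Basis \<Longrightarrow> partial_on \<Omega> b (F' b) (F'' b)"
    and F''c: "\<And>b. b \<in> Basis \<Longrightarrow> continuous_on \<Omega> (F'' b)"
    and Gc: "continuous_on D G" and Gz: "\<And>y. y \<in> D \<Longrightarrow> y \<notin> \<Omega> \<Longrightarrow> G y = 0"
    and eq: "\<And>y. y \<in> \<Omega> \<Longrightarrow> G y = - (\<Sum>b\<in>Basis. F'' b y)"
  shows "weak_poisson D F G"
  unfolding weak_poisson_def
proof (intro allI impI, elim conjE)
  fix c r \<phi> \<phi>' \<phi>'' assume K: "cball c r \<subseteq> D" and tf: "test_fun c r \<phi> \<phi>' \<phi>''"
  have \<phi>c: "continuous_on UNIV \<phi>" and \<phi>z: "\<And>y. y \<notin> cball c r \<Longrightarrow> \<phi> y = 0"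
    and \<phi>p: "\<And>b. b \<in> Basis \<Longrightarrow> partial_on UNIV b \<phi> (\<phi>' b)" "\<And>b. b \<in> Basis \<Longrightarrow> partial_on UNIV b (\<phi>' b) (\<phi>'' b)"
    and \<phi>'c: "\<And>b. b \<in> Basis \<Longrightarrow> continuous_on UNIV (\<phi>' b)" "\<And>b. b \<in> Basis \<Longrightarrow> continuous_on UNIV (\<phi>'' b)"
    and \<phi>'z: "\<And>b y. b \<in> Basis \<Longrightarrow> y \<notin> cball c r \<Longrightarrow> \<phi>' b y = 0" "\<And>b y. b \<in> Basis \<Longrightarrow> y \<notin> cball c r \<Longrightarrow> \<phi>'' b y = 0"
    using tf by (auto simp: test_fun_def)
  show "integral UNIV (\<lambda>y. F y * (\<Sum>b\<in>Basis. \<phi>'' b y)) = - integral UNIV (\<lambda>y. G y * \<phi> y)"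
  proof (cases "r \<ge> 0")
    case False
    then have "cball c r = {}" by simp
    then show ?thesis using \<phi>z \<phi>'z by simp
  next
    case r: True
    obtain u v where uv: "cball c r \<subseteq> cbox u v"
      using bounded_subset_cbox_symmetric[OF bounded_cball[of c r]] by blast
    have zb: "\<phi> y = 0" "b \<in> Basis \<Longrightarrow> \<phi>' b y = 0" "b \<in> Basis \<Longrightarrow> \<phi>'' b y = 0" if "y \<notin> cbox u v" for y b
      using \<phi>z[of y] \<phi>'z[of b y] that uv by blast+
    note cts = continuous_times_supported[OF open_D _ _ closed_cball K]
    have cF'\<phi>': "continuous_on UNIV (\<lambda>y. F' b y * \<phi>' b y)" if "b \<in> Basis" for b
      by (rule cts) (auto simp: F'c \<phi>'c \<phi>'z that)
    have cF\<phi>'': "continuous_on UNIV (\<lambda>y. F y * \<phi>'' b y)" if "b \<in> Basis" for b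
      by (rule cts) (auto simp: Fc \<phi>'c \<phi>'z that)
    have cF\<phi>': "continuous_on UNIV (\<lambda>y. F y * \<phi>' b y)" if "b \<in> Basis" for b
      by (rule cts) (auto simp: Fc \<phi>'c \<phi>'z that)
    have iF'\<phi>': "(\<lambda>y. F' b y * \<phi>' b y) integrable_on UNIV" and iF\<phi>'': "(\<lambda>y. F y * \<phi>'' b y) integrable_on UNIV" if "b \<in> Basis" for b
      by (rule integral_bounded_support(1)[of _ u v], rule cF'\<phi>'[OF that] cF\<phi>''[OF that], simp add: zb that)+
    have "integral UNIV (\<lambda>y. F y * (\<Sum>b\<in>Basis. \<phi>'' b y)) = (\<Sum>b\<in>Basis. integral UNIV (\<lambda>y. F y * \<phi>'' b y))"
      unfolding sum_distrib_left by (rule integral_sum) (auto intro: iF\<phi>'')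
    also have "\<dots> = (\<Sum>b\<in>Basis. - integral UNIV (\<lambda>y. F' b y * \<phi>' b y))"
    proof (rule sum.cong[OF refl])
      fix b :: 'a assume b: "b \<in> Basis"
      have "integral UNIV (\<lambda>y. F' b y * \<phi>' b y + F y * \<phi>'' b y) = 0"
        by (rule integral_partial_zero[where a = u and b = v, OF cF\<phi>'[OF b] continuous_on_add[OF cF'\<phi>'[OF b] cF\<phi>''[OF b]]])
          (rule partial_on_mult_supported[OF Fp[OF b] \<phi>p(2)[OF b] _ K], auto simp: \<phi>'z zb b)
      then show "integral UNIV (\<lambda>y. F y * \<phi>'' b y) = - integral UNIV (\<lambda>y. F' b y * \<phi>' b y)"
        using integral_add[OF iF'\<phi>'[OF b] iF\<phi>''[OF b]] by simp
    qed
    also have "\<dots> = - integral UNIV (\<lambda>y. \<Sum>b\<in>Basis. F' b y * \<phi>' b y)"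
      by (subst integral_sum) (auto simp: iF'\<phi>' sum_negf)
    finally have step1: "integral UNIV (\<lambda>y. F y * (\<Sum>b\<in>Basis. \<phi>'' b y)) = - integral UNIV (\<lambda>y. \<Sum>b\<in>Basis. F' b y * \<phi>' b y)" .
    have oO: "open \<Omega>" unfolding O_def using continuous_open_preimage[OF dc open_D, of "{..<0}"] by (simp add: vimage_def Int_def)
    define P where "P y = G y * \<phi> y" for y
    \<comment> \<open>\<open>P\<close> and \<open>Q\<close> are the integrands of both sides; \<open>R h\<close> is the error due to the cutoff\<close>
    define Q where "Q y = (\<Sum>b\<in>Basis. F' b y * \<phi>' b y)" for y
    define R where "R h y = (\<Sum>b\<in>Basis. F' b y * (cutoff' h b y * \<phi> y))" for h y
    have Pc: "continuous_on UNIV P" unfolding P_def by (rule cts) (auto simp: Gc \<phi>c \<phi>z)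
    have Qc: "continuous_on UNIV Q" unfolding Q_def by (intro continuous_on_sum cF'\<phi>')
    have c\<phi>: "continuous_on UNIV (\<lambda>y. cutoff' h b y * \<phi> y)" if "h > 0" "b \<in> Basis" for h b
      by (rule cts) (auto simp: cutoff_cont that \<phi>c \<phi>z)
    have c\<phi>0: "continuous_on UNIV (\<lambda>y. cutoff h y * \<phi> y)" if "h > 0" for h
      by (rule cts) (auto simp: cutoff_cont that \<phi>c \<phi>z)
    have c\<phi>1: "continuous_on UNIV (\<lambda>y. cutoff h y * \<phi>' b y)" if "h > 0" "b \<in> Basis" for h b
      by (rule cts) (auto simp: cutoff_cont that \<phi>'c \<phi>'z)
    have Rc1: "continuous_on UNIV (\<lambda>y. F' b y * (cutoff' h b y * \<phi> y))" if "h > 0" "b \<in> Basis" for h b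
      by (rule cts) (auto simp: c\<phi> F'c that \<phi>z)
    have Rc: "continuous_on UNIV (R h)" if "h > 0" for h
      unfolding R_def by (intro continuous_on_sum Rc1 that)
    have cPc: "continuous_on UNIV (\<lambda>y. cutoff h y * P y)" if "h > 0" for h
    proof -
      have "continuous_on UNIV (\<lambda>y. G y * (cutoff h y * \<phi> y))"
        by (rule cts) (auto simp: c\<phi>0 that Gc \<phi>z)
      then show ?thesis by (simp add: P_def mult_ac)
    qed
    have Qc1: "continuous_on UNIV (\<lambda>y. F' b y * (cutoff h y * \<phi>' b y))" if "h > 0" "b \<in> Basis" for h b
      by (rule cts) (auto simp: c\<phi>1 that F'c \<phi>'z)
    have cQe: "cutoff h y * Q y = (\<Sum>b\<in>Basis. F' b y * (cutoff h y * \<phi>' b y))" for h y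
      by (simp add: Q_def sum_distrib_left mult_ac)
    have cQc: "continuous_on UNIV (\<lambda>y. cutoff h y * Q y)" if "h > 0" for h
      unfolding cQe by (intro continuous_on_sum Qc1 that)
    have sP: "P y = 0" "Q y = 0" "R h y = 0" if "y \<notin> cbox u v" for y h
      using zb[OF that] by (auto simp: P_def Q_def R_def)
    have zP: "P y = 0" "Q y = 0" if "y \<notin> \<Omega>" for y
    proof (atomize (full), cases "y \<in> D")
      case True
      then show "P y = 0 \<and> Q y = 0" using that Gz F'z by (simp add: P_def Q_def)
    next
      case False
      then have "y \<notin> cball c r" using K by blast
      then show "P y = 0 \<and> Q y = 0" using \<phi>z \<phi>'z by (simp add: P_def Q_def)
    qed
    \<comment> \<open>Green's formula in \<open>\<Omega>\<close>, for the test function multiplied by the cutoff\<close>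
    have green: "integral UNIV (\<lambda>y. cutoff h y * P y) = integral UNIV (\<lambda>y. cutoff h y * Q y) + integral UNIV (R h)" if h: "h > 0" for h
    proof -
      define K' where "K' = {y \<in> cball c r. d y \<in> {..- h}}"
      have clK: "closed K'" unfolding K'_def
        using continuous_closed_preimage[OF continuous_on_subset[OF dc K] closed_cball, of "{..-h}"]
        by (simp add: vimage_def Int_def)
      have K'O: "K' \<subseteq> \<Omega>" using K h by (auto simp: K'_def O_def)
      have zK: "cutoff h y * \<phi> y = 0" "b \<in> Basis \<Longrightarrow> cutoff' h b y * \<phi> y + cutoff h y * \<phi>' b y = 0" if "y \<notin> K'" for y b
        using that cutoff_zero[OF h, of y b] \<phi>z[of y] \<phi>'z(1)[of b y] by (auto simp: K'_def not_le less_imp_le)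
      have p: "partial_on UNIV b (\<lambda>y. cutoff h y * \<phi> y) (\<lambda>y. cutoff' h b y * \<phi> y + cutoff h y * \<phi>' b y)" if "b \<in> Basis" for b
        by (rule partial_on_mult_supported[OF cutoff_partial[OF that] \<phi>p(1)[OF that] _ K]) (auto simp: \<phi>z \<phi>'z that)
      have fc: "continuous_on UNIV (\<lambda>y. F' b y * (cutoff h y * \<phi> y))" if "b \<in> Basis" for b
        by (rule cts) (auto simp: c\<phi>0 h F'c \<phi>z that)
      have f2c: "continuous_on UNIV (\<lambda>y. F'' b y * (cutoff h y * \<phi> y))" if "b \<in> Basis" for b
        by (rule continuous_times_supported[OF oO _ _ clK K'O]) (auto simp: c\<phi>0 h F''c zK that)
      have f1c: "continuous_on UNIV (\<lambda>y. F' b y * (cutoff' h b y * \<phi> y + cutoff h y * \<phi>' b y))" if "b \<in> Basis" for b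
        unfolding distrib_left by (intro continuous_on_add Rc1 Qc1 h that)
      have z2: "F'' b y * (cutoff h y * \<phi> y) = 0" "b \<in> Basis \<Longrightarrow> F' b y * (cutoff' h b y * \<phi> y + cutoff h y * \<phi>' b y) = 0" if "y \<notin> cbox u v" for y b
        using zb[OF that] by auto
      have I0: "integral UNIV (\<lambda>y. F'' b y * (cutoff h y * \<phi> y)) = - integral UNIV (\<lambda>y. F' b y * (cutoff' h b y * \<phi> y + cutoff h y * \<phi>' b y))" if b: "b \<in> Basis" for b
      proof -
        have "integral UNIV (\<lambda>y. F'' b y * (cutoff h y * \<phi> y) + F' b y * (cutoff' h b y * \<phi> y + cutoff h y * \<phi>' b y)) = 0"
          by (rule integral_partial_zero[where a = u and b = v, OF fc[OF b] continuous_on_add[OF f2c[OF b] f1c[OF b]]])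
            (rule partial_on_mult_supported[OF F'p[OF b] p[OF b] clK K'O], auto simp: zK zb b)
        moreover have "integral UNIV (\<lambda>y. F'' b y * (cutoff h y * \<phi> y) + F' b y * (cutoff' h b y * \<phi> y + cutoff h y * \<phi>' b y)) =
           integral UNIV (\<lambda>y. F'' b y * (cutoff h y * \<phi> y)) + integral UNIV (\<lambda>y. F' b y * (cutoff' h b y * \<phi> y + cutoff h y * \<phi>' b y))"
          by (intro integral_add integral_bounded_support(1)[OF f2c[OF b], of u v] integral_bounded_support(1)[OF f1c[OF b], of u v]) (auto simp: z2 b)
        ultimately show ?thesis by simp
      qed
      have "integral UNIV (\<lambda>y. cutoff h y * P y) = integral UNIV (\<lambda>y. \<Sum>b\<in>Basis. - (F'' b y * (cutoff h y * \<phi> y)))"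
      proof (rule integral_cong)
        fix y
        show "cutoff h y * P y = (\<Sum>b\<in>Basis. - (F'' b y * (cutoff h y * \<phi> y)))"
        proof (cases "y \<in> \<Omega>")
          case True
          then show ?thesis by (simp add: P_def eq sum_distrib_left sum_distrib_right sum_negf mult_ac)
        next
          case False
          then have "y \<notin> K'" using K'O by auto
          from zK(1)[OF this] show ?thesis by (auto simp: P_def)
        qed
      qed
      also have "\<dots> = (\<Sum>b\<in>Basis. integral UNIV (\<lambda>y. - (F'' b y * (cutoff h y * \<phi> y))))"
        by (rule integral_sum) (auto intro!: integrable_neg integral_bounded_support(1)[OF f2c, of _ u v] simp: zb)
      also have "\<dots> = (\<Sum>b\<in>Basis. integral UNIV (\<lambda>y. F' b y * (cutoff' h b y * \<phi> y + cutoff h y * \<phi>' b y)))"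
        by (intro sum.cong refl) (simp add: I0)
      also have "\<dots> = integral UNIV (\<lambda>y. \<Sum>b\<in>Basis. F' b y * (cutoff' h b y * \<phi> y + cutoff h y * \<phi>' b y))"
        by (rule integral_sum[symmetric]) (auto intro!: integral_bounded_support(1)[OF f1c, of _ u v] simp: zb)
      also have "\<dots> = integral UNIV (\<lambda>y. cutoff h y * Q y + R h y)"
        by (intro integral_cong) (simp add: cQe R_def distrib_left sum.distrib add.commute)
      also have "\<dots> = integral UNIV (\<lambda>y. cutoff h y * Q y) + integral UNIV (R h)"
        by (intro integral_add integral_bounded_support(1)[OF cQc[OF h], of u v] integral_bounded_support(1)[OF Rc[OF h], of u v]) (auto simp: sP)
      finally show ?thesis .
    qed
    obtain \<beta> M where \<beta>: "continuous_on UNIV \<beta>" "\<And>y. \<beta> y \<ge> 0" "\<And>y. y \<in> cball c r \<Longrightarrow> \<beta> y \<ge> 1"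
      "\<And>h. h > 0 \<Longrightarrow> (\<lambda>y. (- \<sigma> * cutoff' h b0 y) * \<beta> y) integrable_on UNIV"
      "\<And>h. h > 0 \<Longrightarrow> integral UNIV (\<lambda>y. (- \<sigma> * cutoff' h b0 y) * \<beta> y) \<le> M" "M \<ge> 0" "\<And>y. y \<notin> D \<Longrightarrow> \<beta> y = 0"
      by (rule cutoff_layer_integral[OF K r]) (rule that; assumption)
    have Rlim: "(\<lambda>k. integral UNIV (R (1 / Suc k))) \<longlonglongrightarrow> 0"
    proof (rule LIMSEQ_I)
      fix \<epsilon> :: real assume \<epsilon>: "\<epsilon> > 0"
      define m where "m y = (\<Sum>b\<in>Basis. \<bar>F' b y\<bar>) * \<bar>\<phi> y\<bar>" for y
      have mc: "continuous_on (cball c r) m" unfolding m_def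
        by (intro continuous_intros continuous_on_subset[OF F'c K] continuous_on_subset[OF \<phi>c]) auto
      define e where "e = \<epsilon> / (C * M + 1)"
      have CM: "C * M \<ge> 0" using C0 \<beta>(6) by simp
      have e: "e > 0" using \<epsilon> CM by (simp add: e_def)
      \<comment> \<open>\<open>L\<close> is the set where the gradient of \<open>F\<close> is not small; it is compact, so it stays away from the layer\<close>
      define L where "L = {y \<in> cball c r. m y \<in> {e..}}"
      have cL: "compact L"
      proof -
        have "closed L" unfolding L_def using continuous_closed_preimage[OF mc closed_cball, of "{e..}"]
          by (simp add: vimage_def Int_def)
        then have "compact (cball c r \<inter> L)" by (intro compact_Int_closed compact_cball)
        moreover have "cball c r \<inter> L = L" by (auto simp: L_def)
        ultimately show ?thesis by simp
      qed
      have LO: "d y < 0" if "y \<in> L" for y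
      proof (rule ccontr)
        assume "\<not> d y < 0"
        then have "y \<notin> \<Omega>" by (simp add: O_def)
        then have "m y = 0" using that K F'z[of _ y] by (auto simp: m_def L_def subset_iff)
        then show False using that e by (simp add: L_def)
      qed
      obtain \<mu> where \<mu>: "\<mu> > 0" "\<And>y. y \<in> L \<Longrightarrow> d y \<le> - \<mu>"
      proof (cases "L = {}")
        case False
        have "continuous_on L d" by (rule continuous_on_subset[OF dc]) (use K in \<open>auto simp: L_def\<close>)
        then obtain y0 where "y0 \<in> L" "\<And>y. y \<in> L \<Longrightarrow> d y \<le> d y0"
          using continuous_attains_sup[OF cL False] by blast
        then show ?thesis using LO by (intro that[of "- d y0"]) auto
      qed (use that[of 1] in auto)
      obtain k0 :: nat where k0: "real k0 > 2 / \<mu>" using reals_Archimedean2 by blast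
      have "norm (integral UNIV (R (1 / Suc k)) - 0) < \<epsilon>" if k: "k \<ge> k0" for k
      proof -
        define h where "h = 1 / real (Suc k)"
        have h: "h > 0" by (simp add: h_def)
        have "real (Suc k) > 2 / \<mu>" using k0 k by linarith
        then have h2: "2 * h < \<mu>" using \<mu>(1) by (simp add: h_def field_simps)
        have pw: "\<bar>R h y\<bar> \<le> e * C * ((- \<sigma> * cutoff' h b0 y) * \<beta> y)" for y
        proof (cases "y \<in> cball c r")
          case True
          then have yD: "y \<in> D" using K by auto
          define g where "g = - \<sigma> * cutoff' h b0 y"
          have Cg: "C * g \<ge> 0" using cutoff'_dom[OF h b0 yD] unfolding g_def by (rule order_trans[OF abs_ge_zero])
          have "\<bar>R h y\<bar> \<le> (\<Sum>b\<in>Basis. \<bar>F' b y * (cutoff' h b y * \<phi> y)\<bar>)" unfolding R_def by (rule sum_abs)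
          also have "\<dots> \<le> (\<Sum>b\<in>Basis. (\<bar>F' b y\<bar> * \<bar>\<phi> y\<bar>) * (C * g))"
          proof (rule sum_mono)
            fix b :: 'a assume "b \<in> Basis"
            have "\<bar>F' b y * (cutoff' h b y * \<phi> y)\<bar> = (\<bar>F' b y\<bar> * \<bar>\<phi> y\<bar>) * \<bar>cutoff' h b y\<bar>" by (simp add: abs_mult)
            also have "\<dots> \<le> (\<bar>F' b y\<bar> * \<bar>\<phi> y\<bar>) * (C * g)"
              using cutoff'_dom[OF h \<open>b \<in> Basis\<close> yD] by (intro mult_left_mono) (auto simp: g_def)
            finally show "\<bar>F' b y * (cutoff' h b y * \<phi> y)\<bar> \<le> (\<bar>F' b y\<bar> * \<bar>\<phi> y\<bar>) * (C * g)" .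
          qed
          also have "\<dots> = m y * (C * g)" by (simp add: m_def sum_distrib_right)
          also have "\<dots> \<le> e * (C * g)"
          proof (cases "y \<in> L")
            case True
            then have "cutoff' h b0 y = 0" using \<mu>(2) h2 by (intro cutoff'_layer[OF h]) force
            then show ?thesis by (simp add: g_def)
          next
            case False
            then have "m y \<le> e" using \<open>y \<in> cball c r\<close> by (simp add: L_def)
            then show ?thesis using Cg by (rule mult_right_mono)
          qed
          also have "\<dots> \<le> e * (C * g) * \<beta> y"
            using mult_left_mono[OF \<beta>(3)[OF True], of "e * (C * g)"] e Cg by simp
          finally show ?thesis by (simp add: g_def mult_ac)
        next
          case False
          have "R h y = 0" using \<phi>z[OF False] by (simp add: R_def)
          moreover have "0 \<le> e * (C * (- \<sigma> * cutoff' h b0 y)) * \<beta> y"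
          proof (cases "y \<in> D")
            case True
            have "0 \<le> C * (- \<sigma> * cutoff' h b0 y)" by (rule order_trans[OF abs_ge_zero cutoff'_dom[OF h b0 True]])
            from mult_nonneg_nonneg[OF mult_nonneg_nonneg[OF less_imp_le[OF e] this] \<beta>(2)] show ?thesis .
          qed (simp add: \<beta>(7))
          ultimately show ?thesis by (simp add: mult_ac)
        qed
        have "norm (integral UNIV (R h)) \<le> integral UNIV (\<lambda>y. e * C * ((- \<sigma> * cutoff' h b0 y) * \<beta> y))"
          by (rule integral_norm_bound_integral)
            (use pw integral_bounded_support(1)[OF Rc[OF h], of u v] sP(3) integrable_on_mult_right[OF \<beta>(4)[OF h]] in auto)
        also have "\<dots> = e * C * integral UNIV (\<lambda>y. (- \<sigma> * cutoff' h b0 y) * \<beta> y)"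
          by (rule integral_mult_right)
        also have "\<dots> \<le> e * C * M" using \<beta>(5)[OF h] e C0 by (intro mult_left_mono) auto
        also have "\<dots> < \<epsilon>"
        proof -
          have "e * (C * M + 1) = \<epsilon>" using CM by (simp add: e_def)
          then show ?thesis using e by (simp add: algebra_simps)
        qed
        finally show ?thesis by (simp add: h_def)
      qed
      then show "\<exists>k0. \<forall>k\<ge>k0. norm (integral UNIV (R (1 / Suc k)) - 0) < \<epsilon>" by blast
    qed
    have "(\<lambda>k. integral UNIV (\<lambda>y. cutoff (1 / Suc k) y * Q y) + integral UNIV (R (1 / Suc k))) \<longlonglongrightarrow> integral UNIV Q + 0"
      by (intro tendsto_add Rlim cutoff_limit[OF Qc sP(2) zP(2) cQc]) auto
    then have "(\<lambda>k. integral UNIV (\<lambda>y. cutoff (1 / Suc k) y * P y)) \<longlonglongrightarrow> integral UNIV Q"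
      by (simp add: green)
    moreover have "(\<lambda>k. integral UNIV (\<lambda>y. cutoff (1 / Suc k) y * P y)) \<longlonglongrightarrow> integral UNIV P"
      by (intro cutoff_limit[OF Pc sP(1) zP(1) cPc]) auto
    ultimately have "integral UNIV P = integral UNIV Q" by (rule LIMSEQ_unique[rotated])
    then show ?thesis using step1 by (simp add: P_def[abs_def] Q_def[abs_def])
  qed
qed

end

section \<open>A bump function with derivatives of factorial growth\<close>

fun exp_inv_poly :: "nat \<Rightarrow> real poly" where
  "exp_inv_poly 0 = 1"
| "exp_inv_poly (Suc k) = monom 1 2 * (exp_inv_poly k - pderiv (exp_inv_poly k))"

text \<open>The \<open>k\<close>-th derivative of \<open>exp (- 1 / t)\<close>, continued by zero to \<open>t \<le> 0\<close>.\<close>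

definition exp_inv :: "nat \<Rightarrow> real \<Rightarrow> real" where
  "exp_inv k t = (if t \<le> 0 then 0 else poly (exp_inv_poly k) (1 / t) * exp (- 1 / t))"

lemma exp_inv_deriv:
  assumes "t > 0"
  shows "(exp_inv k has_real_derivative exp_inv (Suc k) t) (at t)"
proof -
  have "((\<lambda>t. poly (exp_inv_poly k) (1 / t) * exp (- 1 / t)) has_real_derivative exp_inv (Suc k) t) (at t)"
    using assms by (auto intro!: derivative_eq_intros DERIV_chain2[OF poly_DERIV]
        simp: exp_inv_def poly_monom field_simps power2_eq_square)
  then show ?thesis
    by (rule has_field_derivative_transform_within_open[of _ _ _ "{0<..}"]) (use assms in \<open>auto simp: exp_inv_def\<close>)
qed

lemma degree_exp_inv_poly: "degree (exp_inv_poly k) \<le> 2 * k"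
proof (induction k)
  case (Suc k)
  have "degree (exp_inv_poly k - pderiv (exp_inv_poly k)) \<le> 2 * k"
    using Suc by (intro degree_diff_le) (auto simp: degree_pderiv)
  moreover have "degree (exp_inv_poly (Suc k)) \<le> 2 + degree (exp_inv_poly k - pderiv (exp_inv_poly k))"
    using degree_mult_le[of "monom (1::real) 2" "exp_inv_poly k - pderiv (exp_inv_poly k)"] by (simp add: degree_monom_eq)
  ultimately show ?case by simp
qed auto

lemma power_exp_le_fact: "x \<ge> 0 \<Longrightarrow> x ^ l * exp (- x) \<le> (fact l :: real)"
proof -
  assume x: "x \<ge> 0"
  have "(\<Sum>i\<in>{l}. x ^ i /\<^sub>R fact i) \<le> exp x"
    unfolding exp_def using x summable_exp_generic[of x] by (intro sum_le_suminf) auto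
  then have "x ^ l \<le> fact l * exp x" by (simp add: field_simps)
  then show ?thesis by (simp add: exp_minus field_simps)
qed

text \<open>The weight \<open>l!\<close> bounds the monomial \<open>x\<^sup>l e\<^sup>-\<^sup>x\<close> for \<open>x \<ge> 0\<close>, so the weighted sum of the coefficients bounds
\<open>exp_inv k\<close>.  In passing from \<open>k\<close> to \<open>k + 1\<close> a monomial of degree \<open>l \<le> 2k\<close> becomes \<open>x\<^sup>l\<^sup>+\<^sup>2 - l x\<^sup>l\<^sup>+\<^sup>1\<close>, and
its weight grows by a factor of at most \<open>2 (2k + 2) (2k + 1)\<close>.\<close>

lemma exp_inv_coeff_bound:
  "(\<Sum>l\<le>2 * k. \<bar>coeff (exp_inv_poly k) l\<bar> * fact l) \<le> 2 ^ k * (fact (2 * k) :: real)"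
proof (induction k)
  case (Suc k)
  define c where "c = coeff (exp_inv_poly k)"
  have c0: "c l = 0" if "l > 2 * k" for l
    using degree_exp_inv_poly[of k] that by (auto simp: c_def intro: coeff_eq_0)
  have c1: "coeff (exp_inv_poly (Suc k)) l = (if l < 2 then 0 else c (l - 2) - real (l - 1) * c (l - 1))" for l
    by (auto simp: coeff_monom_mult coeff_pderiv c_def Suc_diff_Suc numeral_2_eq_2)
  have e: "(\<Sum>l\<le>2 * Suc k. g l) = g 0 + (g 1 + (\<Sum>l\<le>2 * k. g (Suc (Suc l))))" for g :: "nat \<Rightarrow> real"
    by (simp add: sum.atMost_Suc_shift del: sum.atMost_Suc)
  have "(\<Sum>l\<le>2 * Suc k. \<bar>coeff (exp_inv_poly (Suc k)) l\<bar> * fact l)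
      = (\<Sum>l\<le>2 * k. \<bar>c l - real (Suc l) * c (Suc l)\<bar> * fact (Suc (Suc l)))"
    unfolding e c1 by simp
  also have "\<dots> \<le> (\<Sum>l\<le>2 * k. \<bar>c l\<bar> * fact (Suc (Suc l)) + real (Suc l) * \<bar>c (Suc l)\<bar> * fact (Suc (Suc l)))"
  proof (rule sum_mono)
    fix l
    have "\<bar>c l - real (Suc l) * c (Suc l)\<bar> \<le> \<bar>c l\<bar> + real (Suc l) * \<bar>c (Suc l)\<bar>"
      using abs_triangle_ineq4[of "c l" "real (Suc l) * c (Suc l)"] by (simp add: abs_mult)
    from mult_right_mono[OF this, of "fact (Suc (Suc l))"]
    show "\<bar>c l - real (Suc l) * c (Suc l)\<bar> * fact (Suc (Suc l)) \<le> \<bar>c l\<bar> * fact (Suc (Suc l)) + real (Suc l) * \<bar>c (Suc l)\<bar> * fact (Suc (Suc l))"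
      by (simp only: distrib_right fact_ge_zero)
  qed
  also have "\<dots> = (\<Sum>l\<le>2 * k. \<bar>c l\<bar> * fact (Suc (Suc l))) + (\<Sum>l\<le>2 * k. real (Suc l) * \<bar>c (Suc l)\<bar> * fact (Suc (Suc l)))"
    by (rule sum.distrib)
  also have "(\<Sum>l\<le>2 * k. real (Suc l) * \<bar>c (Suc l)\<bar> * fact (Suc (Suc l))) = (\<Sum>l\<le>2 * k. real l * \<bar>c l\<bar> * fact (Suc l))"
  proof -
    have "(\<Sum>l\<le>Suc (2 * k). real l * \<bar>c l\<bar> * fact (Suc l)) = (\<Sum>l\<le>2 * k. real (Suc l) * \<bar>c (Suc l)\<bar> * fact (Suc (Suc l)))"
      by (simp only: sum.atMost_Suc_shift of_nat_0 mult_zero_left add_0)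
    then show ?thesis using c0[of "Suc (2 * k)"] by simp
  qed
  also have "(\<Sum>l\<le>2 * k. \<bar>c l\<bar> * fact (Suc (Suc l))) + (\<Sum>l\<le>2 * k. real l * \<bar>c l\<bar> * fact (Suc l))
      \<le> (\<Sum>l\<le>2 * k. \<bar>c l\<bar> * fact (Suc (Suc l))) + (\<Sum>l\<le>2 * k. \<bar>c l\<bar> * fact (Suc (Suc l)))"
  proof (rule add_left_mono, rule sum_mono)
    fix l
    have "real l * fact (Suc l) \<le> real (Suc (Suc l)) * fact (Suc l)" by (intro mult_right_mono) auto
    then have "real l * fact (Suc l) \<le> fact (Suc (Suc l))" by (simp add: fact_Suc[of "Suc l"] del: fact_Suc)
    from mult_left_mono[OF this, of "\<bar>c l\<bar>"] show "real l * \<bar>c l\<bar> * fact (Suc l) \<le> \<bar>c l\<bar> * fact (Suc (Suc l))"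
      by (simp add: mult_ac del: fact_Suc)
  qed
  also have "(\<Sum>l\<le>2 * k. \<bar>c l\<bar> * fact (Suc (Suc l))) + (\<Sum>l\<le>2 * k. \<bar>c l\<bar> * fact (Suc (Suc l)))
     \<le> 2 * (real ((2 * k + 2) * (2 * k + 1)) * (\<Sum>l\<le>2 * k. \<bar>c l\<bar> * fact l))"
  proof -
    have "(\<Sum>l\<le>2 * k. \<bar>c l\<bar> * fact (Suc (Suc l))) \<le> (\<Sum>l\<le>2 * k. real ((2 * k + 2) * (2 * k + 1)) * (\<bar>c l\<bar> * fact l))"
    proof (rule sum_mono)
      fix l assume l: "l \<in> {..2 * k}"
      have "real (Suc (Suc l)) * real (Suc l) \<le> real (2 * k + 2) * real (2 * k + 1)"
        using l by (intro mult_mono) auto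
      from mult_right_mono[OF this, of "\<bar>c l\<bar> * fact l"]
      show "\<bar>c l\<bar> * fact (Suc (Suc l)) \<le> real ((2 * k + 2) * (2 * k + 1)) * (\<bar>c l\<bar> * fact l)"
        by (simp only: fact_Suc of_nat_mult of_nat_Suc mult_ac abs_ge_zero fact_ge_zero mult_nonneg_nonneg)
    qed
    then show ?thesis by (simp only: sum_distrib_left[symmetric])
  qed
  also have "\<dots> \<le> 2 * (real ((2 * k + 2) * (2 * k + 1)) * (2 ^ k * fact (2 * k)))"
    using Suc unfolding c_def by (intro mult_left_mono) auto
  also have "\<dots> = 2 ^ Suc k * fact (2 * Suc k)"
    by (simp add: algebra_simps)
  finally show ?case .
qed simp

lemma exp_inv_bounds:
  shows "\<bar>exp_inv k t\<bar> \<le> 2 ^ k * fact (2 * k)" and "\<exists>C. \<forall>t. \<bar>exp_inv k t\<bar> \<le> C * \<bar>t\<bar>"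
proof -
  define c where "c = coeff (exp_inv_poly k)"
  have p: "poly (exp_inv_poly k) x = (\<Sum>l\<le>2 * k. c l * x ^ l)" for x
    unfolding c_def poly_altdef using degree_exp_inv_poly[of k]
    by (intro sum.mono_neutral_left) (auto simp: coeff_eq_0)
  have b: "\<bar>poly (exp_inv_poly k) x * exp (- x)\<bar> * x ^ j \<le> (\<Sum>l\<le>2 * k. \<bar>c l\<bar> * fact (l + j))" if "x \<ge> 0" for x j
  proof -
    have "\<bar>poly (exp_inv_poly k) x * exp (- x)\<bar> * x ^ j = \<bar>\<Sum>l\<le>2 * k. c l * (x ^ (l + j) * exp (- x))\<bar>"
    proof -
      have "\<bar>poly (exp_inv_poly k) x * exp (- x)\<bar> * x ^ j = \<bar>poly (exp_inv_poly k) x * exp (- x) * x ^ j\<bar>"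
        using that by (simp add: abs_mult)
      also have "poly (exp_inv_poly k) x * exp (- x) * x ^ j = (\<Sum>l\<le>2 * k. c l * (x ^ (l + j) * exp (- x)))"
        by (simp add: p sum_distrib_left sum_distrib_right power_add mult_ac)
      finally show ?thesis .
    qed
    also have "\<dots> \<le> (\<Sum>l\<le>2 * k. \<bar>c l * (x ^ (l + j) * exp (- x))\<bar>)" by (rule sum_abs)
    also have "\<dots> \<le> (\<Sum>l\<le>2 * k. \<bar>c l\<bar> * fact (l + j))"
      unfolding abs_mult using that power_exp_le_fact[OF that] by (intro sum_mono mult_left_mono) auto
    finally show ?thesis .
  qed
  show "\<bar>exp_inv k t\<bar> \<le> 2 ^ k * fact (2 * k)"
    using b[of "1 / t" 0] exp_inv_coeff_bound[of k] by (auto simp: exp_inv_def c_def)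
  define C where "C = (\<Sum>l\<le>2 * k. \<bar>c l\<bar> * fact (l + 1))"
  have "\<bar>exp_inv k t\<bar> \<le> C * \<bar>t\<bar>" for t
  proof (cases "t \<le> 0")
    case False
    then show ?thesis using b[of "1 / t" 1] by (simp add: exp_inv_def C_def field_simps)
  next
    case True
    have "C \<ge> 0" unfolding C_def by (intro sum_nonneg) auto
    then show ?thesis using True by (simp add: exp_inv_def mult_nonneg_nonpos)
  qed
  then show "\<exists>C. \<forall>t. \<bar>exp_inv k t\<bar> \<le> C * \<bar>t\<bar>" by blast
qed

lemma exp_inv_cont: "continuous_on UNIV (exp_inv k)"
  unfolding continuous_on_eq_continuous_at[OF open_UNIV]
proof
  fix t :: real
  consider "t > 0" | "t < 0" | "t = 0" by linarith
  then show "isCont (exp_inv k) t"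
  proof cases
    case 1
    then show ?thesis using exp_inv_deriv DERIV_isCont by blast
  next
    case 2
    have "continuous_on {..<0} (exp_inv k)"
      by (subst continuous_on_cong[OF refl, of _ _ "\<lambda>_. 0"]) (auto simp: exp_inv_def)
    then show ?thesis using 2 by (simp add: continuous_on_eq_continuous_at)
  next
    case 3
    obtain C where C: "\<And>t. \<bar>exp_inv k t\<bar> \<le> C * \<bar>t\<bar>" using exp_inv_bounds(2) by blast
    have "(exp_inv k \<longlongrightarrow> 0) (at 0)"
    proof (rule Lim_null_comparison)
      show "\<forall>\<^sub>F t in at 0. norm (exp_inv k t) \<le> C * \<bar>t\<bar>" using C by simp
      show "((\<lambda>t. C * \<bar>t\<bar>) \<longlongrightarrow> 0) (at (0::real))" by (auto intro!: tendsto_eq_intros)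
    qed
    then show ?thesis using 3 by (simp add: isCont_def exp_inv_def)
  qed
qed

text \<open>The \<open>k\<close>-th derivative of \<open>F i * H j\<close> when \<open>F (Suc i)\<close> and \<open>H (Suc j)\<close> are the derivatives of \<open>F i\<close> and
\<open>H j\<close>, written as a sum of \<open>2\<^sup>k\<close> products; binomial coefficients are avoided.\<close>

fun leibniz_terms :: "(nat \<Rightarrow> real \<Rightarrow> real) \<Rightarrow> (nat \<Rightarrow> real \<Rightarrow> real) \<Rightarrow> nat \<Rightarrow> nat \<Rightarrow> nat \<Rightarrow> real \<Rightarrow> real" where
  "leibniz_terms F H 0 i j t = F i t * H j t"
| "leibniz_terms F H (Suc k) i j t = leibniz_terms F H k (Suc i) j t + leibniz_terms F H k i (Suc j) t"

lemma leibniz_terms_deriv: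
  assumes "\<And>i. (F i has_real_derivative F (Suc i) t) (at t)" "\<And>i. (H i has_real_derivative H (Suc i) t) (at t)"
  shows "(leibniz_terms F H k i j has_real_derivative leibniz_terms F H (Suc k) i j t) (at t)"
proof (induction k arbitrary: i j)
  case 0
  show ?case using DERIV_mult[OF assms(1)[of i] assms(2)[of j]] by (simp add: mult.commute add.commute)
next
  case (Suc k)
  show ?case using DERIV_add[OF Suc[of "Suc i" j] Suc[of i "Suc j"]] by simp
qed

lemma leibniz_terms_cont:
  assumes "\<And>i. continuous_on A (F i)" "\<And>i. continuous_on A (H i)"
  shows "continuous_on A (leibniz_terms F H k i j)"
  by (induction k arbitrary: i j) (auto intro!: continuous_intros assms)

lemma leibniz_terms_zero:
  assumes "(\<forall>i. F i t = 0) \<or> (\<forall>i. H i t = 0)"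
  shows "leibniz_terms F H k i j t = 0"
  using assms by (induction k arbitrary: i j) auto

lemma leibniz_terms_bound:
  assumes "\<And>i. \<bar>F i t\<bar> \<le> 2 ^ i * fact (2 * i)" "\<And>i. \<bar>H i t\<bar> \<le> 2 ^ i * fact (2 * i)"
  shows "\<bar>leibniz_terms F H k i j t\<bar> \<le> 2 ^ k * (2 ^ (i + j + k) * fact (2 * (i + j + k)))"
proof (induction k arbitrary: i j)
  case 0
  have "\<bar>F i t\<bar> * \<bar>H j t\<bar> \<le> (2 ^ i * fact (2 * i)) * (2 ^ j * fact (2 * j))"
    by (intro mult_mono assms) auto
  also have "\<dots> = 2 ^ (i + j) * (fact (2 * i) * fact (2 * j))" by (simp add: power_add)
  also have "\<dots> \<le> 2 ^ (i + j) * fact (2 * i + 2 * j)"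
  proof -
    have "fact (2 * i) * fact (2 * j) \<le> (fact (2 * i + 2 * j) :: nat)"
      using fact_fact_dvd_fact[of "2 * i" "2 * j", where 'a = nat] by (intro dvd_imp_le) (auto simp: fact_gt_zero)
    then have "real (fact (2 * i) * fact (2 * j)) \<le> real (fact (2 * i + 2 * j))" by (rule of_nat_mono)
    then show ?thesis by (intro mult_left_mono) auto
  qed
  finally show ?case by (simp add: abs_mult)
next
  case (Suc k)
  show ?case using Suc[of "Suc i" j] Suc[of i "Suc j"] by simp
qed

text \<open>The function \<open>\<theta> 0\<close> is \<open>exp (- 1 / (t - a)) exp (- 1 / (b - t))\<close> on \<open>(a, b)\<close> and \<open>\<theta> k\<close> is its \<open>k\<close>-th
derivative.  The growth of its derivatives is the one admitted in \<open>laplace_chain\<close>.\<close>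

lemma gevrey_bump:
  fixes a b :: real
  assumes "a < b"
  obtains \<theta> :: "nat \<Rightarrow> real \<Rightarrow> real" where "\<And>k. continuous_on UNIV (\<theta> k)" "\<And>k. \<theta> k a = 0" "\<And>k. \<theta> k b = 0"
    "\<And>k t. a < t \<Longrightarrow> t < b \<Longrightarrow> (\<theta> k has_real_derivative \<theta> (Suc k) t) (at t)"
    "\<And>k t. \<bar>\<theta> k t\<bar> \<le> 4 ^ k * fact (2 * k)" "\<And>t. a < t \<Longrightarrow> t < b \<Longrightarrow> \<theta> 0 t > 0"
proof -
  define F where "F i t = exp_inv i (t - a)" for i t
  define H where "H i t = (- 1) ^ i * exp_inv i (b - t)" for i t
  define \<theta> where "\<theta> k = leibniz_terms F H k 0 0" for k
  have Fd: "(F i has_real_derivative F (Suc i) t) (at t)" if "a < t" for i t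
  proof -
    have "((\<lambda>t. exp_inv i (t - a)) has_real_derivative exp_inv (Suc i) (t - a) * 1) (at t)"
      by (rule DERIV_chain2[OF exp_inv_deriv]) (use that in \<open>auto intro!: derivative_eq_intros\<close>)
    then show ?thesis by (simp add: F_def[abs_def])
  qed
  have Hd: "(H i has_real_derivative H (Suc i) t) (at t)" if "t < b" for i t
  proof -
    have "((\<lambda>t. exp_inv i (b - t)) has_real_derivative exp_inv (Suc i) (b - t) * (- 1)) (at t)"
      by (rule DERIV_chain2[OF exp_inv_deriv]) (use that in \<open>auto intro!: derivative_eq_intros\<close>)
    from DERIV_cmult[OF this, of "(- 1) ^ i"] show ?thesis by (simp add: H_def[abs_def])
  qed
  have Fc: "continuous_on UNIV (F i)" and Hc: "continuous_on UNIV (H i)" for i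
    unfolding F_def[abs_def] H_def[abs_def]
    by (intro continuous_intros continuous_on_compose2[OF exp_inv_cont]; simp)+
  show ?thesis
  proof (rule that[of \<theta>])
    show "continuous_on UNIV (\<theta> k)" for k unfolding \<theta>_def by (intro leibniz_terms_cont Fc Hc)
    show "\<theta> k a = 0" "\<theta> k b = 0" for k
      unfolding \<theta>_def by (rule leibniz_terms_zero; simp add: F_def H_def exp_inv_def)+
    show "(\<theta> k has_real_derivative \<theta> (Suc k) t) (at t)" if "a < t" "t < b" for k t
      unfolding \<theta>_def by (rule leibniz_terms_deriv) (rule Fd[OF that(1)] Hd[OF that(2)])+
    show "\<bar>\<theta> k t\<bar> \<le> 4 ^ k * fact (2 * k)" for k t
    proof -
      have "\<bar>\<theta> k t\<bar> \<le> 2 ^ k * (2 ^ (0 + 0 + k) * fact (2 * (0 + 0 + k)))"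
        unfolding \<theta>_def by (rule leibniz_terms_bound) (auto simp: F_def H_def abs_mult exp_inv_bounds(1))
      also have "\<dots> = 4 ^ k * fact (2 * k)" by (simp flip: power_mult_distrib mult.assoc)
      finally show ?thesis .
    qed
    show "\<theta> 0 t > 0" if "a < t" "t < b" for t
      using that by (simp add: \<theta>_def F_def H_def exp_inv_def)
  qed
qed

section \<open>Iterated directional derivatives and extension by zero\<close>

lemma partial_on_subset: "partial_on W v f f' \<Longrightarrow> W' \<subseteq> W \<Longrightarrow> partial_on W' v f f'"
  by (auto simp: partial_on_def)

lemma partial_on_dirderiv: "partial_on W v f f' \<Longrightarrow> p \<in> W \<Longrightarrow> dirderiv v f p = f' p"
  by (auto simp: partial_on_def dirderiv_def vector_derivative_at)

lemma partial_on_dirderivI: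
  "(\<And>p. p \<in> W \<Longrightarrow> (\<lambda>s. f (p + s *\<^sub>R v)) differentiable (at 0)) \<Longrightarrow> partial_on W v f (dirderiv v f)"
  by (auto simp: partial_on_def dirderiv_def vector_derivative_works)

lemma eventually_on_line:
  fixes p v :: "'a::real_normed_vector"
  assumes "open W" "p \<in> W"
  shows "eventually (\<lambda>s. p + s *\<^sub>R v \<in> W) (nhds 0)"
proof -
  have "((\<lambda>s. p + s *\<^sub>R v) \<longlongrightarrow> p + 0 *\<^sub>R v) (nhds 0)"
    by (intro tendsto_add tendsto_const tendsto_scaleR filterlim_ident)
  then show ?thesis using assms by (simp add: tendsto_def)
qed

lemma partial_on_cong:
  assumes "open W" "\<And>p. p \<in> W \<Longrightarrow> f p = g p" "\<And>p. p \<in> W \<Longrightarrow> f' p = g' p"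
  shows "partial_on W v f f' \<longleftrightarrow> partial_on W v g g'"
proof -
  have "((\<lambda>s. f (p + s *\<^sub>R v)) has_vector_derivative f' p) (at 0) \<longleftrightarrow>
        ((\<lambda>s. g (p + s *\<^sub>R v)) has_vector_derivative g' p) (at 0)" if p: "p \<in> W" for p
    unfolding assms(3)[OF p] using eventually_on_line[OF assms(1) p, of v] assms(2) p
    by (intro has_vector_derivative_cong_ev) (auto elim!: eventually_mono)
  then show ?thesis by (simp add: partial_on_def)
qed

lemma partial_on_transform:
  "partial_on W v f f' \<Longrightarrow> open W \<Longrightarrow> (\<And>p. p \<in> W \<Longrightarrow> f p = g p) \<Longrightarrow> (\<And>p. p \<in> W \<Longrightarrow> f' p = g' p) \<Longrightarrow>
    partial_on W v g g'"
  using partial_on_cong[of W f g f' g' v] by blast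

lemma dirderiv_cong:
  assumes "open W" "\<And>p. p \<in> W \<Longrightarrow> f p = g p" "p \<in> W"
  shows "dirderiv v f p = dirderiv v g p"
proof -
  have ev: "eventually (\<lambda>s. f (p + s *\<^sub>R v) = g (p + s *\<^sub>R v)) (nhds 0)"
    using eventually_on_line[OF assms(1,3), of v] by eventually_elim (rule assms(2))
  then show ?thesis unfolding dirderiv_def
    by (intro vector_derivative_cong_eq) (auto simp: eventually_at_filter elim: eventually_mono)
qed

lemma partial_on_linear:
  assumes "bounded_linear L" "partial_on W v f f'"
  shows "partial_on W v (\<lambda>p. L (f p)) (\<lambda>p. L (f' p))"
  using assms bounded_linear.has_vector_derivative[OF assms(1)] by (auto simp: partial_on_def)

lemma partial_on_diff:
  "partial_on W v f f' \<Longrightarrow> partial_on W v g g' \<Longrightarrow> partial_on W v (\<lambda>p. f p - g p) (\<lambda>p. f' p - g' p)"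
  by (auto simp: partial_on_def intro!: has_vector_derivative_diff)

definition zero_ext :: "'a set \<Rightarrow> ('a \<Rightarrow> 'b::zero) \<Rightarrow> 'a \<Rightarrow> 'b" where
  "zero_ext W f p = (if p \<in> W then f p else 0)"

text \<open>The derivatives of \<open>f\<close> of order at most \<open>r\<close> along directions in \<open>V\<close> exist on \<open>W\<close>, and after extension by
zero they are continuous on \<open>X\<close>.  For \<open>X = W\<close> this is the class \<open>C\<^sup>r\<close>; if \<open>X\<close> crosses the boundary of
\<open>W\<close> it says in addition that the derivatives vanish there.\<close>

primrec smooth_zero_ext :: "nat \<Rightarrow> 'a::real_normed_vector set \<Rightarrow> 'a set \<Rightarrow> 'a set \<Rightarrow> ('a \<Rightarrow> 'b::real_normed_vector) \<Rightarrow> bool" where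
  "smooth_zero_ext 0 W X V f \<longleftrightarrow> continuous_on X (zero_ext W f)"
| "smooth_zero_ext (Suc r) W X V f \<longleftrightarrow> continuous_on X (zero_ext W f) \<and>
     (\<forall>v\<in>V. partial_on W v f (dirderiv v f) \<and> smooth_zero_ext r W X V (dirderiv v f))"

lemma smooth_zero_ext_cont: "smooth_zero_ext r W X V f \<Longrightarrow> continuous_on X (zero_ext W f)"
  by (cases r) auto

lemma smooth_zero_ext_partial: "smooth_zero_ext (Suc r) W X V f \<Longrightarrow> v \<in> V \<Longrightarrow> partial_on W v f (dirderiv v f)"
  by simp

lemma zero_ext_cong: "(\<And>p. p \<in> W \<Longrightarrow> f p = g p) \<Longrightarrow> zero_ext W f = zero_ext W g"
  by (auto simp: zero_ext_def)

lemma smooth_zero_ext_cong: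
  assumes "open W" "\<And>p. p \<in> W \<Longrightarrow> f p = g p" "smooth_zero_ext r W X V f"
  shows "smooth_zero_ext r W X V g"
  using assms(2,3)
proof (induction r arbitrary: f g)
  case 0
  then show ?case using zero_ext_cong[of W f g] by simp
next
  case (Suc r)
  have d: "dirderiv v f p = dirderiv v g p" if "p \<in> W" for v p
    by (rule dirderiv_cong[OF assms(1) Suc.prems(1) that])
  have "partial_on W v g (dirderiv v g)" if "v \<in> V" for v
    using Suc.prems(2) that by (intro partial_on_transform[OF _ assms(1) Suc.prems(1) d]) auto
  then show ?case using Suc.prems zero_ext_cong[of W f g] Suc.IH[OF d] by simp
qed

lemma smooth_zero_ext_Suc_D: "smooth_zero_ext (Suc r) W X V f \<Longrightarrow> smooth_zero_ext r W X V f"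
  by (induction r arbitrary: f) auto

lemma smooth_zero_ext_mono: "smooth_zero_ext r W X V f \<Longrightarrow> k \<le> r \<Longrightarrow> smooth_zero_ext k W X V f"
  by (induction r) (auto simp: le_Suc_eq dest: smooth_zero_ext_Suc_D simp del: smooth_zero_ext.simps)

lemma smooth_zero_ext_diff:
  assumes "open W" "smooth_zero_ext r W X V f" "smooth_zero_ext r W X V g"
  shows "smooth_zero_ext r W X V (\<lambda>p. f p - g p)"
  using assms(2,3)
proof (induction r arbitrary: f g)
  case 0
  have "zero_ext W (\<lambda>p. f p - g p) = (\<lambda>p. zero_ext W f p - zero_ext W g p)" by (auto simp: zero_ext_def)
  then show ?case using 0 by (auto intro: continuous_intros)
next
  case (Suc r)
  have z: "zero_ext W (\<lambda>p. f p - g p) = (\<lambda>p. zero_ext W f p - zero_ext W g p)" by (auto simp: zero_ext_def)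
  have p: "partial_on W v (\<lambda>p. f p - g p) (\<lambda>p. dirderiv v f p - dirderiv v g p)" if "v \<in> V" for v
    using Suc.prems that by (intro partial_on_diff) auto
  have p2: "dirderiv v f p - dirderiv v g p = dirderiv v (\<lambda>p. f p - g p) p" if "v \<in> V" "p \<in> W" for v p
    using partial_on_dirderiv[OF p that(2)] that by simp
  have "smooth_zero_ext r W X V (dirderiv v (\<lambda>p. f p - g p))" if "v \<in> V" for v
    by (rule smooth_zero_ext_cong[OF assms(1) p2[OF that]]) (use Suc that in auto)
  moreover have "partial_on W v (\<lambda>p. f p - g p) (dirderiv v (\<lambda>p. f p - g p))" if "v \<in> V" for v
    by (rule partial_on_transform[OF p[OF that] assms(1) refl p2[OF that]])
  ultimately show ?case using Suc.prems unfolding smooth_zero_ext.simps z by (auto intro!: continuous_intros)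
qed

lemma smooth_zero_ext_zero: "open W \<Longrightarrow> smooth_zero_ext r W X V (\<lambda>p. 0 :: 'b::real_normed_vector)"
proof (induction r)
  case 0
  show ?case by (simp add: zero_ext_def[abs_def])
next
  case (Suc r)
  have p: "partial_on W v (\<lambda>p. 0 :: 'b) (\<lambda>p. 0)" for v by (simp add: partial_on_def)
  have e: "0 = dirderiv v (\<lambda>p. 0 :: 'b) p" if "p \<in> W" for v p using partial_on_dirderiv[OF p that] by simp
  have "smooth_zero_ext r W X V (dirderiv v (\<lambda>p. 0 :: 'b))" for v by (rule smooth_zero_ext_cong[of W "\<lambda>p. 0", OF Suc.prems e Suc.IH[OF Suc.prems]])
  moreover have "partial_on W v (\<lambda>p. 0 :: 'b) (dirderiv v (\<lambda>p. 0))" for v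
    by (rule partial_on_transform[of W v "\<lambda>p. 0" "\<lambda>p. 0", OF p Suc.prems refl e])
  ultimately show ?case by (simp add: zero_ext_def[abs_def])
qed

lemma smooth_zero_ext_sum:
  assumes "open W" "finite I" "\<And>i. i \<in> I \<Longrightarrow> smooth_zero_ext r W X V (f i)"
  shows "smooth_zero_ext r W X V (\<lambda>p. \<Sum>i\<in>I. f i p)"
  using assms(2,3)
proof (induction I rule: finite_induct)
  case (insert i I)
  have "smooth_zero_ext r W X V (\<lambda>p. f i p - (0 - (\<Sum>i\<in>I. f i p)))"
    using insert by (intro smooth_zero_ext_diff smooth_zero_ext_zero assms(1)) auto
  then show ?case using insert by simp
qed (simp add: smooth_zero_ext_zero assms(1) del: smooth_zero_ext.simps)

lemma derivs_exist_append: 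
  "derivs_exist W (vs @ [v]) f \<longleftrightarrow> (\<forall>p\<in>W. (\<lambda>s. f (p + s *\<^sub>R v)) differentiable (at 0)) \<and> derivs_exist W vs (dirderiv v f)"
  by (induction vs) auto

lemma smooth_zero_ext_words:
  assumes "\<And>vs. set vs \<subseteq> V \<Longrightarrow> length vs \<le> r \<Longrightarrow> derivs_exist W vs f \<and> continuous_on X (zero_ext W (foldr dirderiv vs f))"
  shows "smooth_zero_ext r W X V f"
  using assms
proof (induction r arbitrary: f)
  case 0
  then show ?case using 0[of "[]"] by simp
next
  case (Suc r)
  have "smooth_zero_ext r W X V (dirderiv v f)" if "v \<in> V" for v
  proof (rule Suc.IH)
    fix vs assume "set vs \<subseteq> V" "length vs \<le> r"
    then show "derivs_exist W vs (dirderiv v f) \<and> continuous_on X (zero_ext W (foldr dirderiv vs (dirderiv v f)))"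
      using Suc.prems[of "vs @ [v]"] that by (auto simp: derivs_exist_append)
  qed
  moreover have "partial_on W v f (dirderiv v f)" if "v \<in> V" for v
    using Suc.prems[of "[v]"] that by (intro partial_on_dirderivI) simp
  ultimately show ?case using Suc.prems[of "[]"] by simp
qed

lemma smooth_zero_ext_foldr: "smooth_zero_ext (length vs + r) W X V f \<Longrightarrow> set vs \<subseteq> V \<Longrightarrow> smooth_zero_ext r W X V (foldr dirderiv vs f)"
proof (induction vs arbitrary: f rule: rev_induct)
  case (snoc v vs)
  then show ?case by simp
qed simp

lemma foldr_dirderiv_cong:
  assumes "open W" "\<And>p. p \<in> W \<Longrightarrow> f p = g p" "p \<in> W"
  shows "foldr dirderiv vs f p = foldr dirderiv vs g p"
  using assms(3)
proof (induction vs arbitrary: p)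
  case Nil
  then show ?case using assms(2) by simp
next
  case (Cons v vs)
  show ?case using dirderiv_cong[OF assms(1) Cons.IH Cons.prems] by simp
qed

lemma foldr_dirderiv_diff:
  assumes "open W" "smooth_zero_ext (length vs) W X V f" "smooth_zero_ext (length vs) W X V g" "set vs \<subseteq> V" "p \<in> W"
  shows "foldr dirderiv vs (\<lambda>p. f p - g p) p = foldr dirderiv vs f p - foldr dirderiv vs g p"
  using assms(2-5)
proof (induction vs arbitrary: f g p rule: rev_induct)
  case (snoc v vs)
  have v: "v \<in> V" and Cf: "smooth_zero_ext (Suc (length vs)) W X V f" and Cg: "smooth_zero_ext (Suc (length vs)) W X V g" using snoc.prems by auto
  have "dirderiv v (\<lambda>p. f p - g p) q = dirderiv v f q - dirderiv v g q" if "q \<in> W" for q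
    by (rule partial_on_dirderiv[OF partial_on_diff[OF smooth_zero_ext_partial[OF Cf v] smooth_zero_ext_partial[OF Cg v]] that])
  then have "foldr dirderiv vs (dirderiv v (\<lambda>p. f p - g p)) p = foldr dirderiv vs (\<lambda>q. dirderiv v f q - dirderiv v g q) p"
    by (intro foldr_dirderiv_cong[OF assms(1)] snoc.prems)
  then show ?case using snoc.IH[of "dirderiv v f" "dirderiv v g" p] snoc.prems v by simp
qed simp

text \<open>Apply the mean value inequality between \<open>s\<close> and the last point before \<open>s\<close> outside \<open>U\<close>.\<close>

lemma vanishing_bound_right:
  fixes g k :: "real \<Rightarrow> 'b::real_normed_vector"
  assumes g: "continuous_on {0..s} g" and U: "open U" "0 \<notin> U" and s: "s > 0"
    and d: "\<And>r. r \<in> U \<Longrightarrow> 0 \<le> r \<Longrightarrow> r \<le> s \<Longrightarrow> (g has_vector_derivative k r) (at r)"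
    and z: "\<And>r. r \<notin> U \<Longrightarrow> 0 \<le> r \<Longrightarrow> r \<le> s \<Longrightarrow> g r = 0"
    and k: "\<And>r. 0 \<le> r \<Longrightarrow> r \<le> s \<Longrightarrow> norm (k r) \<le> e" and e: "e \<ge> 0"
  shows "norm (g s) \<le> e * s"
proof (cases "s \<in> U")
  case False
  then show ?thesis using z[of s] s e by simp
next
  case True
  define Z where "Z = {0..s} \<inter> (- U)"
  have "compact Z" unfolding Z_def using U by (intro compact_Int_closed) auto
  moreover have "0 \<in> Z" using U s by (auto simp: Z_def)
  ultimately obtain s1 where s1: "s1 \<in> Z" "\<And>r. r \<in> Z \<Longrightarrow> r \<le> s1"
    using compact_attains_sup[of Z] by blast
  have lt: "0 \<le> s1" "s1 < s" using s1 True by (auto simp: Z_def less_le)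
  have "norm (g s - g s1) \<le> (\<lambda>r. e * r) s - (\<lambda>r. e * r) s1"
  proof (rule differentiable_bound_general[OF lt(2)])
    show "continuous_on {s1..s} g" by (rule continuous_on_subset[OF g]) (use lt in auto)
    show "continuous_on {s1..s} (\<lambda>r. e * r)" by (intro continuous_intros)
    fix r assume r: "s1 < r" "r < s"
    have "r \<in> U" using s1(2)[of r] r lt by (auto simp: Z_def)
    then show "(g has_vector_derivative k r) (at r)" using r lt by (intro d) auto
    show "((\<lambda>r. e * r) has_vector_derivative e) (at r)"
      unfolding has_real_derivative_iff_has_vector_derivative[symmetric] by (auto intro!: derivative_eq_intros)
    show "norm (k r) \<le> e" using r lt by (intro k) auto
  qed
  moreover have "g s1 = 0" using s1 z[of s1] by (auto simp: Z_def)
  moreover have "e * s1 \<ge> 0" using e lt by simp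
  ultimately show ?thesis by simp
qed

lemma vanishing_derivative_zero:
  fixes g k :: "real \<Rightarrow> 'b::real_normed_vector"
  assumes \<delta>: "\<delta> > 0" and g: "continuous_on {-\<delta><..<\<delta>} g" and k: "continuous_on {-\<delta><..<\<delta>} k"
    and U: "open U" "0 \<notin> U"
    and d: "\<And>r. r \<in> U \<Longrightarrow> \<bar>r\<bar> < \<delta> \<Longrightarrow> (g has_vector_derivative k r) (at r)"
    and z: "\<And>r. r \<notin> U \<Longrightarrow> \<bar>r\<bar> < \<delta> \<Longrightarrow> g r = 0 \<and> k r = 0"
  shows "(g has_vector_derivative 0) (at 0)"
proof -
  have "(g has_derivative (\<lambda>s. 0)) (at 0)" unfolding has_derivative_at
  proof (intro conjI bounded_linear_zero LIM_I)
    fix e :: real assume e: "e > 0"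
    have "continuous (at 0) k" using k \<delta> by (simp add: continuous_on_eq_continuous_at)
    moreover have k0: "k 0 = 0" "g 0 = 0" using z[of 0] U \<delta> by auto
    ultimately obtain \<eta> where \<eta>: "\<eta> > 0" "\<And>r. \<bar>r\<bar> < \<eta> \<Longrightarrow> norm (k r) < e / 2"
      unfolding continuous_at_eps_delta dist_norm using e by (metis diff_zero half_gt_zero real_norm_def)
    have b: "norm (g s) \<le> e / 2 * \<bar>s\<bar>" if s: "\<bar>s\<bar> < min \<delta> \<eta>" "s \<noteq> 0" for s
    proof (cases "s > 0")
      case True
      have "norm (g s) \<le> e / 2 * s"
      proof (rule vanishing_bound_right[OF _ U True])
        show "continuous_on {0..s} g" by (rule continuous_on_subset[OF g]) (use s in auto)
        show "norm (k r) \<le> e / 2" if "0 \<le> r" "r \<le> s" for r using \<eta>(2)[of r] that s by simp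
      qed (use d z s e in auto)
      then show ?thesis using True by simp
    next
      case False
      have U': "open (uminus ` U)" "0 \<notin> uminus ` U" using U by (auto intro: open_negations)
      have "norm (g (- (- s))) \<le> e / 2 * (- s)"
      proof (rule vanishing_bound_right[OF _ U', where g = "\<lambda>r. g (- r)" and k = "\<lambda>r. - k (- r)"])
        show "continuous_on {0..- s} (\<lambda>r. g (- r))"
          by (rule continuous_on_compose2[OF g]) (use s in \<open>auto intro!: continuous_intros\<close>)
        show "norm (- k (- r)) \<le> e / 2" if "0 \<le> r" "r \<le> - s" for r using \<eta>(2)[of "- r"] that s by simp
        show "((\<lambda>r. g (- r)) has_vector_derivative - k (- r)) (at r)" if "r \<in> uminus ` U" "0 \<le> r" "r \<le> - s" for r
        proof -
          have "(g has_vector_derivative k (- r)) (at (- r))" using that s by (intro d) auto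
          moreover have "(uminus has_vector_derivative - 1) (at r)"
            unfolding has_real_derivative_iff_has_vector_derivative[symmetric] by (auto intro!: derivative_eq_intros)
          ultimately have "(g \<circ> uminus has_vector_derivative (- 1) *\<^sub>R k (- r)) (at r)"
            by (intro vector_diff_chain_at)
          then show ?thesis by (simp add: o_def)
        qed
        show "g (- r) = 0" if "r \<notin> uminus ` U" "0 \<le> r" "r \<le> - s" for r
        proof -
          have "- r \<notin> U" using that(1) by force
          then show ?thesis using z[of "- r"] that s by simp
        qed
      qed (use False s e in auto)
      then show ?thesis using False by simp
    qed
    have "norm (norm (g (0 + h) - g 0 - 0) / norm h - 0) < e" if h: "h \<noteq> 0" "\<bar>h\<bar> < min \<delta> \<eta>" for h
    proof -
      have "norm (g h) / \<bar>h\<bar> \<le> e / 2" using b[OF h(2,1)] h by (simp add: divide_le_eq)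
      then have "norm (g h) / \<bar>h\<bar> < e" using e by linarith
      then show ?thesis using k0 by simp
    qed
    then show "\<exists>s>0. \<forall>h. h \<noteq> 0 \<and> norm (h - 0) < s \<longrightarrow> norm (norm (g (0 + h) - g 0 - 0) / norm h - 0) < e"
      using \<delta> \<eta>(1) by (intro exI[of _ "min \<delta> \<eta>"]) simp
  qed
  then show ?thesis by (simp add: has_vector_derivative_def)
qed

text \<open>At a point outside \<open>W\<close> the extended derivative is continuous with value \<open>0\<close>, hence small nearby, and
by the mean value inequality the extended function is of smaller order than the distance.\<close>

lemma zero_ext_partial:
  assumes W: "open W" and X: "open X" and C: "smooth_zero_ext (Suc r) W X V f" and v: "v \<in> V"
  shows "partial_on X v (zero_ext W f) (zero_ext W (dirderiv v f))"
  unfolding partial_on_def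
proof
  fix p assume p: "p \<in> X"
  have fc: "continuous_on X (zero_ext W f)" and kc: "continuous_on X (zero_ext W (dirderiv v f))"
    and fp: "partial_on W v f (dirderiv v f)"
    using C v smooth_zero_ext_cont[of r W X V "dirderiv v f"] by auto
  have fpz: "partial_on W v (zero_ext W f) (zero_ext W (dirderiv v f))"
    using fp by (subst partial_on_cong[OF W, of _ f _ "dirderiv v f"]) (auto simp: zero_ext_def)
  show "((\<lambda>s. zero_ext W f (p + s *\<^sub>R v)) has_vector_derivative zero_ext W (dirderiv v f) p) (at 0)"
  proof (cases "p \<in> W")
    case True
    then show ?thesis using fpz by (simp add: partial_on_def)
  next
    case False
    obtain \<delta> where \<delta>: "\<delta> > 0" "\<And>s. \<bar>s\<bar> < \<delta> \<Longrightarrow> p + s *\<^sub>R v \<in> X"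
      using eventually_on_line[OF X p, of v] by (auto simp: eventually_nhds_metric dist_norm)
    define U where "U = (\<lambda>s. p + s *\<^sub>R v) -` W"
    have "((\<lambda>s. zero_ext W f (p + s *\<^sub>R v)) has_vector_derivative 0) (at 0)"
    proof (rule vanishing_derivative_zero[OF \<delta>(1), where k = "\<lambda>s. zero_ext W (dirderiv v f) (p + s *\<^sub>R v)" and U = U])
      show "continuous_on {-\<delta><..<\<delta>} (\<lambda>s. zero_ext W f (p + s *\<^sub>R v))"
        by (rule continuous_on_compose2[OF fc]) (auto intro!: continuous_intros \<delta>(2))
      show "continuous_on {-\<delta><..<\<delta>} (\<lambda>s. zero_ext W (dirderiv v f) (p + s *\<^sub>R v))"
        by (rule continuous_on_compose2[OF kc]) (auto intro!: continuous_intros \<delta>(2))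
      show "open U" unfolding U_def by (intro continuous_open_vimage continuous_intros W)
      show "0 \<notin> U" using False by (simp add: U_def)
      show "((\<lambda>s. zero_ext W f (p + s *\<^sub>R v)) has_vector_derivative zero_ext W (dirderiv v f) (p + r *\<^sub>R v)) (at r)" if "r \<in> U" for r
        by (rule partial_on_line[OF fpz]) (use that in \<open>simp add: U_def\<close>)
      show "zero_ext W f (p + r *\<^sub>R v) = 0 \<and> zero_ext W (dirderiv v f) (p + r *\<^sub>R v) = 0" if "r \<notin> U" for r
        using that by (simp add: zero_ext_def U_def)
    qed
    then show ?thesis using False by (simp add: zero_ext_def)
  qed
qed

section \<open>Functions with continuous partial derivatives and powers of the Laplacian\<close>

text \<open>The increment is split into steps along the basis vectors, and each step is estimated by the mean
value inequality.\<close>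

lemma has_derivative_of_partials:
  fixes f :: "'a::euclidean_space \<Rightarrow> 'b::real_normed_vector"
  assumes W: "open W" and p: "\<And>b. b \<in> Basis \<Longrightarrow> partial_on W b f (f' b)"
    and c: "\<And>b. b \<in> Basis \<Longrightarrow> continuous_on W (f' b)" and x: "x \<in> W"
  shows "(f has_derivative (\<lambda>h. \<Sum>b\<in>Basis. (h \<bullet> b) *\<^sub>R f' b x)) (at x)"
  unfolding has_derivative_at_alt
proof (intro conjI allI impI)
  show "bounded_linear (\<lambda>h. \<Sum>b\<in>Basis. (h \<bullet> b) *\<^sub>R f' b x)"
    by (intro bounded_linear_intros)
  fix e :: real assume e: "e > 0"
  define \<epsilon> where "\<epsilon> = e / DIM('a)"
  have \<epsilon>: "\<epsilon> > 0" using e by (simp add: \<epsilon>_def)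
  have "\<forall>\<^sub>F z in nhds x. z \<in> W \<and> (\<forall>b\<in>Basis. norm (f' b z - f' b x) < \<epsilon>)"
  proof (intro eventually_conj eventually_nhds_in_open W x eventually_ball_finite)
    show "\<forall>b\<in>Basis. \<forall>\<^sub>F z in nhds x. norm (f' b z - f' b x) < \<epsilon>"
    proof
      fix b :: 'a assume b: "b \<in> Basis"
      have "isCont (f' b) x" using c[OF b] W x by (simp add: continuous_on_eq_continuous_at)
      then have "((\<lambda>z. f' b z) \<longlongrightarrow> f' b x) (nhds x)" by (simp add: isCont_def tendsto_at_iff_tendsto_nhds)
      then show "\<forall>\<^sub>F z in nhds x. norm (f' b z - f' b x) < \<epsilon>" unfolding dist_norm[symmetric] by (rule tendstoD[OF _ \<epsilon>])
    qed
  qed auto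
  then obtain \<delta> where \<delta>: "\<delta> > 0" "\<And>z. dist z x < \<delta> \<Longrightarrow> z \<in> W"
    "\<And>z b. dist z x < \<delta> \<Longrightarrow> b \<in> Basis \<Longrightarrow> norm (f' b z - f' b x) < \<epsilon>"
    unfolding eventually_nhds_metric by blast
  have tele: "norm (f (x + (\<Sum>b\<in>B. k b *\<^sub>R b)) - f x - (\<Sum>b\<in>B. k b *\<^sub>R f' b x)) \<le> \<epsilon> * (\<Sum>b\<in>B. \<bar>k b\<bar>)"
    if "finite B" "B \<subseteq> Basis" "(\<Sum>b\<in>B. \<bar>k b\<bar>) < \<delta>" for B k
    using that
  proof (induction B rule: finite_induct)
    case (insert b B)
    define y where "y = x + (\<Sum>b\<in>B. k b *\<^sub>R b)"
    have bB: "b \<in> Basis" and sB: "(\<Sum>b\<in>B. \<bar>k b\<bar>) + \<bar>k b\<bar> < \<delta>" using insert by auto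
    have ny: "norm (y - x) \<le> (\<Sum>b\<in>B. \<bar>k b\<bar>)"
      unfolding y_def using insert.prems(1) by (auto intro!: order_trans[OF norm_sum] sum_mono simp: subset_iff)
    have inb: "dist (y + s *\<^sub>R b) x < \<delta>" if "\<bar>s\<bar> \<le> \<bar>k b\<bar>" for s
    proof -
      have "norm (y + s *\<^sub>R b - x) \<le> norm (y - x) + norm (s *\<^sub>R b)"
        using norm_triangle_ineq[of "y - x" "s *\<^sub>R b"] by (simp add: algebra_simps)
      then show ?thesis using ny sB that bB by (simp add: dist_norm)
    qed
    define S where "S = {- \<bar>k b\<bar>..\<bar>k b\<bar>}"
    have "norm ((f (y + k b *\<^sub>R b) - k b *\<^sub>R f' b x) - (f (y + 0 *\<^sub>R b) - 0 *\<^sub>R f' b x)) \<le> \<epsilon> * norm (k b - 0)"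
    proof (rule differentiable_bound[where S = S and f = "\<lambda>s. f (y + s *\<^sub>R b) - s *\<^sub>R f' b x" and f' = "\<lambda>s h. h *\<^sub>R (f' b (y + s *\<^sub>R b) - f' b x)"])
      fix s assume s: "s \<in> S"
      then have sd: "dist (y + s *\<^sub>R b) x < \<delta>" by (intro inb) (auto simp: S_def abs_if split: if_splits)
      have "((\<lambda>s. f (y + s *\<^sub>R b)) has_vector_derivative f' b (y + s *\<^sub>R b)) (at s within S)"
        by (rule partial_on_line[OF p[OF bB]]) (rule \<delta>(2)[OF sd])
      moreover have "((\<lambda>s. s *\<^sub>R f' b x) has_vector_derivative f' b x) (at s within S)"
        unfolding has_vector_derivative_def by (auto intro!: derivative_eq_intros)
      ultimately have "((\<lambda>s. f (y + s *\<^sub>R b) - s *\<^sub>R f' b x) has_vector_derivative f' b (y + s *\<^sub>R b) - f' b x) (at s within S)"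
        by (rule has_vector_derivative_diff)
      then show "((\<lambda>s. f (y + s *\<^sub>R b) - s *\<^sub>R f' b x) has_derivative (\<lambda>h. h *\<^sub>R (f' b (y + s *\<^sub>R b) - f' b x))) (at s within S)"
        by (simp add: has_vector_derivative_def)
      show "onorm (\<lambda>h. h *\<^sub>R (f' b (y + s *\<^sub>R b) - f' b x)) \<le> \<epsilon>"
        using \<delta>(3)[OF sd bB] by (intro onorm_bound) (use \<epsilon> in \<open>auto simp: mult.commute[of \<epsilon>] intro!: mult_left_mono\<close>)
    qed (auto simp: S_def)
    then have 1: "norm (f (y + k b *\<^sub>R b) - f y - k b *\<^sub>R f' b x) \<le> \<epsilon> * \<bar>k b\<bar>"
      by (simp add: algebra_simps)
    have 2: "norm (f y - f x - (\<Sum>b\<in>B. k b *\<^sub>R f' b x)) \<le> \<epsilon> * (\<Sum>b\<in>B. \<bar>k b\<bar>)"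
      unfolding y_def using insert by auto
    have "f (x + (\<Sum>b\<in>insert b B. k b *\<^sub>R b)) - f x - (\<Sum>b\<in>insert b B. k b *\<^sub>R f' b x)
       = (f (y + k b *\<^sub>R b) - f y - k b *\<^sub>R f' b x) + (f y - f x - (\<Sum>b\<in>B. k b *\<^sub>R f' b x))"
      using insert.hyps by (simp add: y_def algebra_simps)
    also have "norm \<dots> \<le> \<epsilon> * \<bar>k b\<bar> + \<epsilon> * (\<Sum>b\<in>B. \<bar>k b\<bar>)" by (rule norm_triangle_mono[OF 1 2])
    finally show ?case using insert.hyps by (simp add: algebra_simps)
  qed simp
  define d where "d = \<delta> / DIM('a)"
  have "norm (f y - f x - (\<Sum>b\<in>Basis. ((y - x) \<bullet> b) *\<^sub>R f' b x)) \<le> e * norm (y - x)" if y: "norm (y - x) < d" for y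
  proof -
    have s: "(\<Sum>b\<in>Basis. \<bar>(y - x) \<bullet> b\<bar>) \<le> DIM('a) * norm (y - x)"
      by (rule order_trans[OF sum_bounded_above[of _ _ "norm (y - x)"]]) (auto simp: Basis_le_norm)
    also have "\<dots> < \<delta>" using y by (simp add: d_def field_simps)
    finally have "norm (f (x + (\<Sum>b\<in>Basis. ((y - x) \<bullet> b) *\<^sub>R b)) - f x - (\<Sum>b\<in>Basis. ((y - x) \<bullet> b) *\<^sub>R f' b x)) \<le> \<epsilon> * (\<Sum>b\<in>Basis. \<bar>(y - x) \<bullet> b\<bar>)"
      by (intro tele) auto
    also have "\<dots> \<le> \<epsilon> * (DIM('a) * norm (y - x))" using s \<epsilon> by (intro mult_left_mono) auto
    finally show ?thesis by (simp add: euclidean_representation \<epsilon>_def)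
  qed
  moreover have "d > 0" using \<delta> by (simp add: d_def)
  ultimately show "\<exists>d>0. \<forall>y. norm (y - x) < d \<longrightarrow> norm (f y - f x - (\<Sum>b\<in>Basis. ((y - x) \<bullet> b) *\<^sub>R f' b x)) \<le> e * norm (y - x)"
    by blast
qed

text \<open>Both mixed derivatives, at suitable points near \<open>p\<close>, equal the second difference of \<open>f\<close> over a small
parallelogram divided by the square of its size.\<close>

lemma schwarz_real:
  fixes f :: "'a::real_normed_vector \<Rightarrow> real"
  assumes W: "open W" and fa: "partial_on W a f fa" and fb: "partial_on W b f fb"
    and fab: "partial_on W b fa fab" and fba: "partial_on W a fb fba"
    and c: "continuous_on W fab" "continuous_on W fba" and p: "p \<in> W"
  shows "fab p = fba p"
proof (rule ccontr)
  assume ne: "fab p \<noteq> fba p"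
  define \<epsilon> where "\<epsilon> = \<bar>fab p - fba p\<bar> / 2"
  have \<epsilon>: "\<epsilon> > 0" using ne by (simp add: \<epsilon>_def)
  have "isCont fab p" "isCont fba p" using c W p by (auto simp: continuous_on_eq_continuous_at)
  then have "(fab \<longlongrightarrow> fab p) (nhds p)" "(fba \<longlongrightarrow> fba p) (nhds p)" by (auto simp: isCont_def tendsto_at_iff_tendsto_nhds)
  from this[THEN tendstoD, OF \<epsilon>] have "\<forall>\<^sub>F z in nhds p. z \<in> W \<and> dist (fab z) (fab p) < \<epsilon> \<and> dist (fba z) (fba p) < \<epsilon>"
    by (intro eventually_conj eventually_nhds_in_open W p)
  then obtain \<delta> where \<delta>: "\<delta> > 0" "\<And>z. dist z p < \<delta> \<Longrightarrow> z \<in> W \<and> dist (fab z) (fab p) < \<epsilon> \<and> dist (fba z) (fba p) < \<epsilon>"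
    unfolding eventually_nhds_metric by blast
  define h where "h = \<delta> / (norm a + norm b + 1) / 2"
  have n: "norm a + norm b + 1 > 0" by (smt (verit) norm_ge_zero)
  have h: "h > 0" using \<delta> n by (simp add: h_def)
  have in\<delta>: "dist (p + s *\<^sub>R a + t *\<^sub>R b) p < \<delta>" if "0 \<le> s" "s \<le> h" "0 \<le> t" "t \<le> h" for s t
  proof -
    have "norm (s *\<^sub>R a + t *\<^sub>R b) \<le> h * norm a + h * norm b"
      using that by (intro norm_triangle_mono) (auto intro!: mult_right_mono)
    also have "\<dots> \<le> h * (norm a + norm b + 1)" using h by (simp add: algebra_simps)
    also have "\<dots> < \<delta>"
    proof -
      have "h * (norm a + norm b + 1) = \<delta> / 2" using n unfolding h_def by (metis (no_types, opaque_lifting) divide_divide_eq_left' less_irrefl nonzero_eq_divide_eq times_divide_eq_left mult.commute)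
      then show ?thesis using \<delta>(1) by simp
    qed
    finally show ?thesis by (simp add: dist_norm algebra_simps)
  qed
  have key: "\<exists>s t. 0 \<le> s \<and> s \<le> h \<and> 0 \<le> t \<and> t \<le> h \<and>
      (f (p + h *\<^sub>R a' + h *\<^sub>R b') - f (p + h *\<^sub>R a')) - (f (p + h *\<^sub>R b') - f p) = h * h * g' (p + s *\<^sub>R a' + t *\<^sub>R b')"
    if ga: "partial_on W a' f g" and gab: "partial_on W b' g g'"
      and inW: "\<And>s t. 0 \<le> s \<Longrightarrow> s \<le> h \<Longrightarrow> 0 \<le> t \<Longrightarrow> t \<le> h \<Longrightarrow> p + s *\<^sub>R a' + t *\<^sub>R b' \<in> W" for a' b' g g'
  proof -
    define u where "u s = f (p + h *\<^sub>R b' + s *\<^sub>R a') - f (p + s *\<^sub>R a')" for s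
    have "\<exists>s>0. s < h \<and> u h - u 0 = (h - 0) * (g (p + h *\<^sub>R b' + s *\<^sub>R a') - g (p + s *\<^sub>R a'))"
    proof (rule MVT2[OF h])
      fix s assume s: "0 \<le> s" "s \<le> h"
      have "p + s *\<^sub>R a' \<in> W" "p + h *\<^sub>R b' + s *\<^sub>R a' \<in> W"
        using inW[of s 0] inW[of s h] s h by (auto simp: algebra_simps)
      then show "(u has_real_derivative g (p + h *\<^sub>R b' + s *\<^sub>R a') - g (p + s *\<^sub>R a')) (at s)"
        unfolding u_def[abs_def] has_real_derivative_iff_has_vector_derivative
        by (intro has_vector_derivative_diff partial_on_line[OF ga]) auto
    qed
    then obtain s where s: "0 < s" "s < h" and es: "u h - u 0 = h * (g (p + h *\<^sub>R b' + s *\<^sub>R a') - g (p + s *\<^sub>R a'))" by auto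
    have "\<exists>t>0. t < h \<and> g (p + s *\<^sub>R a' + h *\<^sub>R b') - g (p + s *\<^sub>R a' + 0 *\<^sub>R b') = (h - 0) * g' (p + s *\<^sub>R a' + t *\<^sub>R b')"
    proof (rule MVT2[OF h])
      fix t assume t: "0 \<le> t" "t \<le> h"
      then show "((\<lambda>t. g (p + s *\<^sub>R a' + t *\<^sub>R b')) has_real_derivative g' (p + s *\<^sub>R a' + t *\<^sub>R b')) (at t)"
        unfolding has_real_derivative_iff_has_vector_derivative
        using s by (intro partial_on_line[OF gab] inW) auto
    qed
    then obtain t where t: "0 < t" "t < h" and et: "g (p + s *\<^sub>R a' + h *\<^sub>R b') - g (p + s *\<^sub>R a') = h * g' (p + s *\<^sub>R a' + t *\<^sub>R b')" by auto
    have e: "p + h *\<^sub>R b' + s *\<^sub>R a' = p + s *\<^sub>R a' + h *\<^sub>R b'" "p + h *\<^sub>R b' + h *\<^sub>R a' = p + h *\<^sub>R a' + h *\<^sub>R b'" by (simp_all add: algebra_simps)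
    have "(f (p + h *\<^sub>R a' + h *\<^sub>R b') - f (p + h *\<^sub>R a')) - (f (p + h *\<^sub>R b') - f p) = h * h * g' (p + s *\<^sub>R a' + t *\<^sub>R b')"
      using es et unfolding u_def e by simp
    then show ?thesis using s t by (meson less_imp_le)
  qed
  obtain s t where st: "0 \<le> s" "s \<le> h" "0 \<le> t" "t \<le> h"
    and 1: "(f (p + h *\<^sub>R a + h *\<^sub>R b) - f (p + h *\<^sub>R a)) - (f (p + h *\<^sub>R b) - f p) = h * h * fab (p + s *\<^sub>R a + t *\<^sub>R b)"
    using key[OF fa fab] in\<delta> \<delta>(2) by blast
  have in\<delta>': "dist (p + s *\<^sub>R b + t *\<^sub>R a) p < \<delta>" if "0 \<le> s" "s \<le> h" "0 \<le> t" "t \<le> h" for s t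
    using in\<delta>[of t s] that by (simp add: algebra_simps)
  obtain s' t' where st': "0 \<le> s'" "s' \<le> h" "0 \<le> t'" "t' \<le> h"
    and 2: "(f (p + h *\<^sub>R b + h *\<^sub>R a) - f (p + h *\<^sub>R b)) - (f (p + h *\<^sub>R a) - f p) = h * h * fba (p + s' *\<^sub>R b + t' *\<^sub>R a)"
    using key[OF fb fba] in\<delta>' \<delta>(2) by blast
  have "p + h *\<^sub>R b + h *\<^sub>R a = p + h *\<^sub>R a + h *\<^sub>R b" by (simp add: algebra_simps)
  from 2[unfolded this] have "h * h * fab (p + s *\<^sub>R a + t *\<^sub>R b) = h * h * fba (p + s' *\<^sub>R b + t' *\<^sub>R a)"
    using 1 by linarith
  then have "fab (p + s *\<^sub>R a + t *\<^sub>R b) = fba (p + s' *\<^sub>R b + t' *\<^sub>R a)" using h by simp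
  moreover have "\<bar>fab (p + s *\<^sub>R a + t *\<^sub>R b) - fab p\<bar> < \<epsilon>" "\<bar>fba (p + s' *\<^sub>R b + t' *\<^sub>R a) - fba p\<bar> < \<epsilon>"
    using \<delta>(2)[OF in\<delta>[OF st]] \<delta>(2)[OF in\<delta>'[OF st']] by (auto simp: dist_real_def)
  ultimately have "\<bar>fab p - fba p\<bar> < 2 * \<epsilon>" by linarith
  then show False by (simp add: \<epsilon>_def)
qed

lemma schwarz:
  fixes f :: "'a::real_normed_vector \<Rightarrow> complex"
  assumes W: "open W" and fa: "partial_on W a f fa" and fb: "partial_on W b f fb"
    and fab: "partial_on W b fa fab" and fba: "partial_on W a fb fba"
    and c: "continuous_on W fab" "continuous_on W fba" and p: "p \<in> W"
  shows "fab p = fba p"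
proof (rule complex_eqI)
  show "Re (fab p) = Re (fba p)"
    by (rule schwarz_real[OF W partial_on_linear[OF bounded_linear_Re fa] partial_on_linear[OF bounded_linear_Re fb]
      partial_on_linear[OF bounded_linear_Re fab] partial_on_linear[OF bounded_linear_Re fba] _ _ p]) (intro continuous_intros c)+
  show "Im (fab p) = Im (fba p)"
    by (rule schwarz_real[OF W partial_on_linear[OF bounded_linear_Im fa] partial_on_linear[OF bounded_linear_Im fb]
      partial_on_linear[OF bounded_linear_Im fab] partial_on_linear[OF bounded_linear_Im fba] _ _ p]) (intro continuous_intros c)+
qed

lemma zero_ext_cont_on: "continuous_on W (zero_ext W f) \<longleftrightarrow> continuous_on W f"
  by (intro continuous_on_cong) (auto simp: zero_ext_def)

lemma dirderiv_swap:
  fixes f :: "'a::real_normed_vector \<Rightarrow> complex"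
  assumes "open W" "smooth_zero_ext 2 W W V f" "a \<in> V" "b \<in> V" "p \<in> W"
  shows "dirderiv a (dirderiv b f) p = dirderiv b (dirderiv a f) p"
proof -
  have C: "smooth_zero_ext (Suc (Suc 0)) W W V f" using assms(2) by (simp only: numeral_2_eq_2)
  show ?thesis
    by (rule schwarz[of W b f "dirderiv b f" a "dirderiv a f" "dirderiv a (dirderiv b f)" "dirderiv b (dirderiv a f)"])
      (use assms C in \<open>auto simp: zero_ext_cont_on\<close>)
qed

text \<open>The derivative along \<open>a\<close> is carried inwards by successive exchanges of neighbouring
derivatives.\<close>

lemma foldr_dirderiv_move:
  fixes f :: "'a::real_normed_vector \<Rightarrow> complex"
  assumes W: "open W" and "smooth_zero_ext (Suc (length vs + length ws)) W W V f" "set vs \<subseteq> V" "set ws \<subseteq> V" "a \<in> V" "p \<in> W"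
  shows "foldr dirderiv (a # vs @ ws) f p = foldr dirderiv (vs @ a # ws) f p"
  using assms(2-)
proof (induction vs arbitrary: p)
  case Nil
  then show ?case by simp
next
  case (Cons v vs)
  have "smooth_zero_ext (length (vs @ ws) + 2) W W V f" using Cons.prems(1) by (simp del: smooth_zero_ext.simps)
  then have "smooth_zero_ext 2 W W V (foldr dirderiv (vs @ ws) f)"
    by (rule smooth_zero_ext_foldr) (use Cons.prems in auto)
  from dirderiv_swap[OF W this, of a v p]
  have "foldr dirderiv (a # (v # vs) @ ws) f p = dirderiv v (foldr dirderiv (a # vs @ ws) f) p"
    using Cons.prems by simp
  also have "\<dots> = dirderiv v (foldr dirderiv (vs @ a # ws) f) p"
  proof (rule dirderiv_cong[OF W])
    show "foldr dirderiv (a # vs @ ws) f q = foldr dirderiv (vs @ a # ws) f q" if "q \<in> W" for q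
      by (rule Cons.IH) (use Cons.prems that smooth_zero_ext_Suc_D in \<open>auto simp del: smooth_zero_ext.simps\<close>)
  qed (rule Cons.prems)
  finally show ?case by simp
qed

lemma laplace_cong:
  "open W \<Longrightarrow> (\<And>p. p \<in> W \<Longrightarrow> f p = g p) \<Longrightarrow> p \<in> W \<Longrightarrow> laplace f p = laplace g p"
  unfolding laplace_def by (intro sum.cong refl dirderiv_cong[of W]) auto

lemma neg_laplace_pow_Suc: "neg_laplace_pow (Suc k) f = (\<lambda>p. - laplace (neg_laplace_pow k f) p)"
  by (simp add: neg_laplace_pow_def)

lemma neg_laplace_pow_0: "neg_laplace_pow 0 f = f"
  by (simp add: neg_laplace_pow_def)

lemma smooth_zero_ext_laplace:
  assumes "open W" "smooth_zero_ext (Suc (Suc r)) W X (range dir_x) f"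
  shows "smooth_zero_ext r W X (range dir_x) (laplace f)"
proof -
  have "smooth_zero_ext r W X (range dir_x) (\<lambda>p. \<Sum>i\<in>UNIV. dirderiv (dir_x i) (dirderiv (dir_x i) f) p)"
    using assms(2) by (intro smooth_zero_ext_sum assms(1)) auto
  then show ?thesis by (simp add: laplace_def[abs_def])
qed

lemma smooth_zero_ext_neg_laplace_pow:
  assumes "open W" "smooth_zero_ext (r + 2 * k) W X (range dir_x) f"
  shows "smooth_zero_ext r W X (range dir_x) (neg_laplace_pow k f)"
  using assms(2)
proof (induction k arbitrary: r)
  case 0
  then show ?case by (simp add: neg_laplace_pow_0)
next
  case (Suc k)
  have "smooth_zero_ext (Suc (Suc r)) W X (range dir_x) (neg_laplace_pow k f)" using Suc by (simp del: smooth_zero_ext.simps)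
  from smooth_zero_ext_diff[OF assms(1) smooth_zero_ext_zero[OF assms(1)] smooth_zero_ext_laplace[OF assms(1) this]]
  show ?case by (simp add: neg_laplace_pow_Suc del: smooth_zero_ext.simps)
qed

lemma neg_laplace_pow_diff:
  assumes W: "open W" and "smooth_zero_ext (2 * k) W W (range dir_x) f" "smooth_zero_ext (2 * k) W W (range dir_x) g" "p \<in> W"
  shows "neg_laplace_pow k (\<lambda>p. f p - g p) p = neg_laplace_pow k f p - neg_laplace_pow k g p"
  using assms(2-)
proof (induction k arbitrary: p)
  case 0
  then show ?case by (simp add: neg_laplace_pow_0)
next
  case (Suc k)
  define F where "F = neg_laplace_pow k f"
  define G where "G = neg_laplace_pow k g"
  have C: "smooth_zero_ext (Suc (Suc 0)) W W (range dir_x) F" "smooth_zero_ext (Suc (Suc 0)) W W (range dir_x) G"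
    unfolding F_def G_def using Suc.prems by (auto intro!: smooth_zero_ext_neg_laplace_pow W simp del: smooth_zero_ext.simps)
  have e: "neg_laplace_pow k (\<lambda>p. f p - g p) q = F q - G q" if "q \<in> W" for q
    unfolding F_def G_def by (rule Suc.IH) (use Suc.prems that in \<open>auto intro: smooth_zero_ext_mono simp del: smooth_zero_ext.simps\<close>)
  have d1: "dirderiv (dir_x i) (\<lambda>p. F p - G p) q = dirderiv (dir_x i) F q - dirderiv (dir_x i) G q" if "q \<in> W" for q i
    by (rule partial_on_dirderiv[OF partial_on_diff[OF smooth_zero_ext_partial[OF C(1)] smooth_zero_ext_partial[OF C(2)]] that]) auto
  have C1: "smooth_zero_ext (Suc 0) W W (range dir_x) (dirderiv (dir_x i) F)" "smooth_zero_ext (Suc 0) W W (range dir_x) (dirderiv (dir_x i) G)" for i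
    using C by auto
  have d2: "dirderiv (dir_x i) (dirderiv (dir_x i) (\<lambda>p. F p - G p)) p = dirderiv (dir_x i) (dirderiv (dir_x i) F) p - dirderiv (dir_x i) (dirderiv (dir_x i) G) p" for i
  proof -
    have "dirderiv (dir_x i) (dirderiv (dir_x i) (\<lambda>p. F p - G p)) p = dirderiv (dir_x i) (\<lambda>q. dirderiv (dir_x i) F q - dirderiv (dir_x i) G q) p"
      by (rule dirderiv_cong[OF W d1 Suc.prems(3)])
    also have "\<dots> = dirderiv (dir_x i) (dirderiv (dir_x i) F) p - dirderiv (dir_x i) (dirderiv (dir_x i) G) p"
      by (rule partial_on_dirderiv[OF partial_on_diff[OF smooth_zero_ext_partial[OF C1(1)] smooth_zero_ext_partial[OF C1(2)]] Suc.prems(3)]) auto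
    finally show ?thesis .
  qed
  have "laplace (neg_laplace_pow k (\<lambda>p. f p - g p)) p = laplace (\<lambda>p. F p - G p) p"
    by (rule laplace_cong[OF W e Suc.prems(3)])
  also have "\<dots> = laplace F p - laplace G p"
    unfolding laplace_def by (simp add: d2 sum_subtractf)
  finally show ?case by (simp add: neg_laplace_pow_Suc F_def G_def)
qed

section \<open>The normal at a smooth boundary point\<close>

lemma Basis_vec_eq: "(Basis :: (real^'n) set) = range (\<lambda>i. axis i 1)"
  by (auto simp: Basis_vec_def)

lemma sum_Basis_vec: "(\<Sum>b\<in>(Basis :: (real^'n) set). F b) = (\<Sum>i\<in>UNIV. F (axis i 1))"
  unfolding Basis_vec_eq by (subst sum.reindex) (auto simp: inj_on_def axis_eq_axis)

lemma smooth_fun_on_partial: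
  assumes "smooth_fun_on U \<phi>" "b \<in> Basis"
  shows "partial_on U b \<phi> (dirderiv b \<phi>)" "continuous_on U (dirderiv b \<phi>)" "continuous_on U \<phi>"
proof -
  have 1: "cont_deriv U [b] \<phi>" "cont_deriv U [] \<phi>" using assms by (auto simp: smooth_fun_on_def simp del: cont_deriv_def)
  then show "partial_on U b \<phi> (dirderiv b \<phi>)" by (intro partial_on_dirderivI) (simp add: cont_deriv_def)
  show "continuous_on U (dirderiv b \<phi>)" "continuous_on U \<phi>" using 1 by (auto simp: cont_deriv_def)
qed

lemma local_defining_derivative:
  assumes "local_defining \<Omega> x U \<phi>" "y \<in> U"
  shows "(\<phi> has_derivative (\<lambda>h. gradient \<phi> y \<bullet> h)) (at y)"
proof -
  have s: "smooth_fun_on U \<phi>" "open U" using assms by (auto simp: local_defining_def)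
  have "(\<phi> has_derivative (\<lambda>h. \<Sum>b\<in>Basis. (h \<bullet> b) *\<^sub>R dirderiv b \<phi> y)) (at y)"
    by (rule has_derivative_of_partials[OF s(2) _ _ assms(2)]) (use smooth_fun_on_partial[OF s(1)] in auto)
  moreover have "(\<Sum>b\<in>Basis. (h \<bullet> b) *\<^sub>R dirderiv b \<phi> y) = gradient \<phi> y \<bullet> h" for h
  proof -
    have "gradient \<phi> y \<bullet> h = (\<Sum>i\<in>UNIV. (h $ i) *\<^sub>R dirderiv (axis i 1) \<phi> y)"
      by (simp add: inner_vec_def gradient_def mult.commute)
    then show ?thesis by (simp add: sum_Basis_vec inner_axis)
  qed
  ultimately show ?thesis by simp
qed

lemma local_defining_zero:
  assumes "local_defining \<Omega> x U \<phi>" "x \<in> frontier \<Omega>"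
  shows "\<phi> x = 0" "gradient \<phi> x \<noteq> 0"
  using assms by (auto simp: local_defining_def)

lemma has_derivative_along_line:
  assumes "(f has_derivative f') (at (x + s *\<^sub>R d))"
  shows "((\<lambda>s. f (x + s *\<^sub>R d)) has_vector_derivative f' d) (at s)"
proof -
  have "((\<lambda>s. x + s *\<^sub>R d) has_derivative (\<lambda>h. h *\<^sub>R d)) (at s)"
    by (auto intro!: derivative_eq_intros)
  from has_derivative_compose[OF this assms] 
  have "((\<lambda>s. f (x + s *\<^sub>R d)) has_derivative (\<lambda>h. f' (h *\<^sub>R d))) (at s)" .
  moreover have "f' (h *\<^sub>R d) = h *\<^sub>R f' d" for h
    using has_derivative_linear[OF assms] by (simp add: linear_cmul)
  ultimately show ?thesis by (simp add: has_vector_derivative_def)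
qed

text \<open>A direction in which one defining function decreases leads into \<open>\<Omega>\<close>, so the other one
cannot increase along it.\<close>

lemma defining_gradients_one_sided:
  assumes "local_defining \<Omega> x U \<phi>" "local_defining \<Omega> x V \<psi>" and x: "x \<in> frontier \<Omega>"
    and d: "gradient \<phi> x \<bullet> d < 0"
  shows "gradient \<psi> x \<bullet> d \<le> 0"
proof (rule ccontr)
  assume "\<not> ?thesis"
  then have q: "gradient \<psi> x \<bullet> d > 0" by simp
  have xU: "x \<in> U" "open U" and xV: "x \<in> V" "open V" using assms by (auto simp: local_defining_def)
  have D1: "((\<lambda>s. \<phi> (x + s *\<^sub>R d)) has_real_derivative gradient \<phi> x \<bullet> d) (at 0)"
    unfolding has_real_derivative_iff_has_vector_derivative
    using has_derivative_along_line[of \<phi> _ x 0 d] local_defining_derivative[OF assms(1) xU(1)] by simp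
  have D2: "((\<lambda>s. \<psi> (x + s *\<^sub>R d)) has_real_derivative gradient \<psi> x \<bullet> d) (at 0)"
    unfolding has_real_derivative_iff_has_vector_derivative
    using has_derivative_along_line[of \<psi> _ x 0 d] local_defining_derivative[OF assms(2) xV(1)] by simp
  obtain e1 where e1: "e1 > 0" "\<And>h. h > 0 \<Longrightarrow> h < e1 \<Longrightarrow> \<phi> (x + h *\<^sub>R d) < 0"
    using DERIV_neg_dec_right[OF D1 d] local_defining_zero(1)[OF assms(1) x] by auto
  obtain e2 where e2: "e2 > 0" "\<And>h. h > 0 \<Longrightarrow> h < e2 \<Longrightarrow> \<psi> (x + h *\<^sub>R d) > 0"
    using DERIV_pos_inc_right[OF D2 q] local_defining_zero(1)[OF assms(2) x] by auto
  obtain e3 where e3: "e3 > 0" "\<And>h. \<bar>h\<bar> < e3 \<Longrightarrow> x + h *\<^sub>R d \<in> U \<inter> V"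
    using eventually_on_line[of "U \<inter> V" x d] xU xV by (auto simp: eventually_nhds_metric dist_norm)
  define h where "h = min e1 (min e2 e3) / 2"
  have h: "h > 0" "h < e1" "h < e2" "\<bar>h\<bar> < e3" using e1 e2 e3 by (auto simp: h_def)
  have "x + h *\<^sub>R d \<in> \<Omega>" using e1(2)[OF h(1,2)] e3(2)[OF h(4)] assms(1) by (auto simp: local_defining_def)
  then have "\<psi> (x + h *\<^sub>R d) < 0" using e3(2)[OF h(4)] assms(2) by (auto simp: local_defining_def)
  then show False using e2(2)[OF h(1,3)] by simp
qed

text \<open>By \<open>defining_gradients_one_sided\<close> and continuity the gradients \<open>p\<close> and \<open>q\<close> satisfy
\<open>p \<bullet> d \<le> 0 \<Longrightarrow> q \<bullet> d \<le> 0\<close> for all \<open>d\<close>, which forces \<open>q\<close> to be a positive multiple of \<open>p\<close>.\<close>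

lemma defining_gradients_parallel:
  assumes "local_defining \<Omega> x U \<phi>" "local_defining \<Omega> x V \<psi>" and x: "x \<in> frontier \<Omega>"
  shows "gradient \<psi> x /\<^sub>R norm (gradient \<psi> x) = gradient \<phi> x /\<^sub>R norm (gradient \<phi> x)"
proof -
  define p where "p = gradient \<phi> x"
  define q where "q = gradient \<psi> x"
  have p0: "p \<noteq> 0" and q0: "q \<noteq> 0" using local_defining_zero(2)[OF assms(1) x] local_defining_zero(2)[OF assms(2) x] by (auto simp: p_def q_def)
  have pp: "p \<bullet> p > 0" using p0 by simp
  have le: "q \<bullet> d \<le> 0" if "p \<bullet> d \<le> 0" for d
  proof (rule field_le_epsilon)
    fix e :: real assume e: "e > 0"
    define s where "s = e / (\<bar>q \<bullet> p\<bar> + 1)"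
    have s: "s > 0" using e by (simp add: s_def)
    have "p \<bullet> (d - s *\<^sub>R p) < 0" using that mult_pos_pos[OF s pp] by (simp only: inner_diff_right inner_scaleR_right)
    then have "q \<bullet> (d - s *\<^sub>R p) \<le> 0"
      using defining_gradients_one_sided[OF assms] by (simp add: p_def q_def)
    then have "q \<bullet> d \<le> s * (q \<bullet> p)" by (simp add: inner_diff_right)
    also have "\<dots> \<le> s * (\<bar>q \<bullet> p\<bar> + 1)" using s by (intro mult_left_mono) auto
    also have "\<dots> = e" by (simp add: s_def)
    finally show "q \<bullet> d \<le> 0 + e" by simp
  qed
  define l where "l = (q \<bullet> p) / (p \<bullet> p)"
  define d where "d = q - l *\<^sub>R p"
  have pd: "p \<bullet> d = 0" using pp by (simp add: d_def l_def inner_diff_right inner_commute)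
  have "q \<bullet> d \<le> 0" using le[of d] pd by simp
  moreover have "q \<bullet> d = d \<bullet> d" using pd by (simp add: d_def inner_diff_left inner_diff_right inner_commute algebra_simps)
  ultimately have "d = 0" by (metis inner_gt_zero_iff not_le)
  then have ql: "q = l *\<^sub>R p" by (simp add: d_def)
  have "l \<ge> 0" using le[of "- p"] pp by (simp add: l_def)
  then have "l > 0" using ql q0 by (cases "l = 0") auto
  then have "q /\<^sub>R norm q = p /\<^sub>R norm p" unfolding ql by simp
  then show ?thesis by (simp add: p_def q_def)
qed

lemma exterior_normal_eq:
  assumes "local_defining \<Omega> x U \<phi>" "x \<in> frontier \<Omega>"
  shows "exterior_normal \<Omega> x = gradient \<phi> x /\<^sub>R norm (gradient \<phi> x)"
  unfolding exterior_normal_def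
proof (rule the_equality)
  show "\<exists>U \<phi>'. local_defining \<Omega> x U \<phi>' \<and>
      gradient \<phi> x /\<^sub>R norm (gradient \<phi> x) = gradient \<phi>' x /\<^sub>R norm (gradient \<phi>' x)"
    using assms(1) by blast
  fix \<nu> assume "\<exists>U \<phi>. local_defining \<Omega> x U \<phi> \<and> \<nu> = gradient \<phi> x /\<^sub>R norm (gradient \<phi> x)"
  then obtain V \<psi> where "local_defining \<Omega> x V \<psi>" and \<nu>: "\<nu> = gradient \<psi> x /\<^sub>R norm (gradient \<psi> x)" by blast
  then show "\<nu> = gradient \<phi> x /\<^sub>R norm (gradient \<phi> x)"
    unfolding \<nu> by (intro defining_gradients_parallel[OF assms(1) _ assms(2)])
qed

lemma norm_diff_along_segment:
  fixes f :: "'a::real_normed_vector \<Rightarrow> 'b::real_normed_vector"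
  assumes ab: "\<alpha> \<le> \<beta>" and c: "continuous_on {\<alpha>..\<beta>} (\<lambda>s. f (z + s *\<^sub>R v))"
    and d: "\<And>s. \<alpha> < s \<Longrightarrow> s < \<beta> \<Longrightarrow> ((\<lambda>s. f (z + s *\<^sub>R v)) has_vector_derivative k s) (at s)"
    and k: "\<And>s. \<alpha> < s \<Longrightarrow> s < \<beta> \<Longrightarrow> norm (k s - w) \<le> M"
  shows "norm (f (z + \<beta> *\<^sub>R v) - f (z + \<alpha> *\<^sub>R v) - (\<beta> - \<alpha>) *\<^sub>R w) \<le> M * (\<beta> - \<alpha>)"
proof (cases "\<alpha> = \<beta>")
  case False
  then have lt: "\<alpha> < \<beta>" using ab by simp
  have "norm ((f (z + \<beta> *\<^sub>R v) - \<beta> *\<^sub>R w) - (f (z + \<alpha> *\<^sub>R v) - \<alpha> *\<^sub>R w)) \<le> M * \<beta> - M * \<alpha>"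
  proof (rule differentiable_bound_general[OF lt, where f = "\<lambda>s. f (z + s *\<^sub>R v) - s *\<^sub>R w" and \<phi> = "\<lambda>s. M * s" and f' = "\<lambda>s. k s - w" and \<phi>' = "\<lambda>s. M"])
    show "continuous_on {\<alpha>..\<beta>} (\<lambda>s. f (z + s *\<^sub>R v) - s *\<^sub>R w)" by (intro continuous_intros c)
    show "continuous_on {\<alpha>..\<beta>} (\<lambda>s. M * s)" by (intro continuous_intros)
    fix s assume s: "\<alpha> < s" "s < \<beta>"
    have "((\<lambda>s. s *\<^sub>R w) has_vector_derivative w) (at s)"
      unfolding has_vector_derivative_def by (auto intro!: derivative_eq_intros)
    then show "((\<lambda>s. f (z + s *\<^sub>R v) - s *\<^sub>R w) has_vector_derivative k s - w) (at s)"
      by (intro has_vector_derivative_diff d s)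
    show "((\<lambda>s. M * s) has_vector_derivative M) (at s)"
      unfolding has_real_derivative_iff_has_vector_derivative[symmetric] by (auto intro!: derivative_eq_intros)
    show "norm (k s - w) \<le> M" by (rule k[OF s])
  qed
  then show ?thesis by (simp add: algebra_simps)
qed simp

text \<open>If \<open>f\<close> vanishes on the boundary then its tangential derivatives vanish there.  Let \<open>\<tau>\<close> be tangent
at \<open>x0\<close> and \<open>p\<close> the gradient of \<open>\<phi>\<close> at \<open>x0\<close>.  For small \<open>r\<close> the segment of length \<open>r \<bar>\<tau>\<bar>\<close> parallel to
\<open>\<tau>\<close>, pushed inwards by \<open>\<kappa> r p\<close>, lies in \<open>\<Omega>\<close>, because \<open>\<phi>\<close> grows only by \<open>o(r)\<close> along \<open>\<tau>\<close>.  At both of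
its ends \<open>f\<close> is \<open>O(\<kappa> r)\<close>, as the boundary is reached along \<open>p\<close> within a distance of this order.  So
the derivative along \<open>\<tau>\<close> is \<open>O(\<kappa>)\<close>, and \<open>\<kappa>\<close> is arbitrary.\<close>

lemma boundary_gradient_normal:
  fixes \<Omega> :: "(real^'n) set" and f :: "real^'n \<Rightarrow> complex"
  assumes O: "open \<Omega>" and ld: "local_defining \<Omega> x0 U \<phi>" and x0: "x0 \<in> frontier \<Omega>"
    and fc: "continuous_on ((\<Omega> \<union> frontier \<Omega>) \<inter> U) f" and fz: "\<And>y. y \<in> frontier \<Omega> \<inter> U \<Longrightarrow> f y = 0"
    and fp: "\<And>i. partial_on (\<Omega> \<inter> U) (axis i 1) f (g i)"
    and gc: "\<And>i. continuous_on ((\<Omega> \<union> frontier \<Omega>) \<inter> U) (g i)"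
  shows "\<exists>\<kappa>. \<forall>i. g i x0 = complex_of_real (gradient \<phi> x0 $ i) * \<kappa>"
proof -
  define S where "S = (\<Omega> \<union> frontier \<Omega>) \<inter> U"
  define p where "p = gradient \<phi> x0"
  have U: "open U" "x0 \<in> U" and Oeq: "\<Omega> \<inter> U = {y \<in> U. \<phi> y < 0}" and Feq: "frontier \<Omega> \<inter> U = {y \<in> U. \<phi> y = 0}"
    using ld by (auto simp: local_defining_def)
  have Oin: "y \<in> \<Omega> \<inter> U" if "y \<in> U" "\<phi> y < 0" for y using that Oeq by auto
  have Fin: "y \<in> frontier \<Omega> \<inter> U" if "y \<in> U" "\<phi> y = 0" for y using that Feq by auto
  have OS: "\<Omega> \<inter> U \<subseteq> S" and FS: "frontier \<Omega> \<inter> U \<subseteq> S" and x0S: "x0 \<in> S" using x0 U by (auto simp: S_def)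
  have p0: "p \<noteq> 0" and \<phi>0: "\<phi> x0 = 0" using local_defining_zero[OF ld x0] by (auto simp: p_def)
  have oOU: "open (\<Omega> \<inter> U)" using O U by auto
  define gv where "gv v y = (\<Sum>i\<in>UNIV. (v $ i) *\<^sub>R g i y)" for v y
  have gvc: "continuous_on S (gv v)" for v unfolding gv_def S_def by (intro continuous_intros gc)
  have fd: "((\<lambda>s. f (z + s *\<^sub>R v)) has_vector_derivative gv v (z + s *\<^sub>R v)) (at s)" if "z + s *\<^sub>R v \<in> \<Omega> \<inter> U" for z v s
  proof -
    have "(f has_derivative (\<lambda>h. \<Sum>b\<in>Basis. (h \<bullet> b) *\<^sub>R g (SOME i. b = axis i 1) (z + s *\<^sub>R v))) (at (z + s *\<^sub>R v))"
    proof (rule has_derivative_of_partials[OF oOU _ _ that])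
      fix b :: "real^'n" assume "b \<in> Basis"
      then have b: "b = axis (SOME i. b = axis i 1) 1" unfolding Basis_vec_eq by (intro someI_ex[of "\<lambda>i. b = axis i 1"]) auto
      show "partial_on (\<Omega> \<inter> U) b f (g (SOME i. b = axis i 1))" using fp[of "SOME i. b = axis i 1"] b by simp
      show "continuous_on (\<Omega> \<inter> U) (g (SOME i. b = axis i 1))" by (rule continuous_on_subset[OF gc]) auto
    qed
    from has_derivative_along_line[OF this]
    have "((\<lambda>s. f (z + s *\<^sub>R v)) has_vector_derivative (\<Sum>b\<in>Basis. (v \<bullet> b) *\<^sub>R g (SOME i. b = axis i 1) (z + s *\<^sub>R v))) (at s)" .
    moreover have "(SOME j. axis i (1::real) = axis j 1) = i" for i :: 'n
      by (rule some_equality) (auto simp: axis_eq_axis)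
    ultimately show ?thesis by (simp add: sum_Basis_vec gv_def inner_axis)
  qed
  have tang: "gv \<tau> x0 = 0" if \<tau>: "\<tau> \<bullet> p = 0" for \<tau>
  proof (rule ccontr)
    define \<gamma> where "\<gamma> = gv \<tau> x0"
    assume "\<not> ?thesis"
    then have \<gamma>: "norm \<gamma> > 0" by (simp add: \<gamma>_def)
    define M where "M = norm (gv p x0) + 1"
    have M: "M > 0" by (simp add: M_def add_nonneg_pos)
    obtain \<delta>1 where \<delta>1: "\<delta>1 > 0" "\<And>y. y \<in> S \<Longrightarrow> dist y x0 < \<delta>1 \<Longrightarrow> norm (gv \<tau> y - \<gamma>) < norm \<gamma> / 4"
    proof -
      have "norm \<gamma> / 4 > 0" using \<gamma> by simp
      from gvc[of \<tau>, unfolded continuous_on_iff, rule_format, OF x0S this] that show thesis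
        unfolding \<gamma>_def dist_norm by blast
    qed
    obtain \<delta>2 where \<delta>2: "\<delta>2 > 0" "\<And>y. y \<in> S \<Longrightarrow> dist y x0 < \<delta>2 \<Longrightarrow> norm (gv p y - gv p x0) < 1"
      using gvc[of p, unfolded continuous_on_iff, rule_format, OF x0S zero_less_one] unfolding dist_norm by blast
    have gM: "norm (gv p y - 0) \<le> M" if "y \<in> S" "dist y x0 < \<delta>2" for y
      using \<delta>2(2)[OF that] norm_triangle_ineq2[of "gv p y" "gv p x0"] by (simp add: M_def)
    \<comment> \<open>with this \<open>\<kappa>\<close> the values of \<open>f\<close> at the two ends, of total size \<open>3 \<kappa> M r\<close>, cannot account for \<open>r \<bar>\<gamma>\<bar>\<close>\<close>
    define \<kappa> where "\<kappa> = norm \<gamma> / (12 * M)"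
    have \<kappa>: "\<kappa> > 0" "3 * \<kappa> * M = norm \<gamma> / 4" using \<gamma> M by (auto simp: \<kappa>_def)
    define L where "L = norm \<tau> + \<kappa> * norm p"
    have L: "L > 0" using \<kappa> p0 by (simp add: L_def add_nonneg_pos)
    \<comment> \<open>the permitted relative error of the linearisation of \<open>\<phi>\<close> at \<open>x0\<close>\<close>
    define \<eta> where "\<eta> = min (\<kappa> * (p \<bullet> p) / L) (norm p) / 2"
    have \<eta>: "\<eta> > 0" "\<eta> < norm p" "\<eta> * L < \<kappa> * (p \<bullet> p)"
    proof -
      have k: "\<kappa> * (p \<bullet> p) / L > 0" using \<kappa> p0 L by simp
      then show "\<eta> > 0" using p0 by (simp add: \<eta>_def)
      have half_min: "min A B / 2 < A" "min A B / 2 < B" if "A > 0" "B > 0" for A B :: real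
        using that by (auto simp: min_def)
      have n: "norm p > 0" using p0 by simp
      show "\<eta> < norm p" unfolding \<eta>_def by (rule half_min(2)[OF k n])
      have "\<eta> < \<kappa> * (p \<bullet> p) / L" unfolding \<eta>_def by (rule half_min(1)[OF k n])
      then show "\<eta> * L < \<kappa> * (p \<bullet> p)" using L by (simp add: pos_less_divide_eq)
    qed
    have "(\<phi> has_derivative (\<lambda>h. p \<bullet> h)) (at x0)"
      using local_defining_derivative[OF ld U(2)] by (simp add: p_def)
    then obtain \<delta>3 where \<delta>3: "\<delta>3 > 0" "\<And>y. norm (y - x0) < \<delta>3 \<Longrightarrow> norm (\<phi> y - \<phi> x0 - p \<bullet> (y - x0)) \<le> \<eta> * norm (y - x0)"
      unfolding has_derivative_at_alt using \<eta>(1) by blast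
    obtain \<delta>4 where \<delta>4: "\<delta>4 > 0" "ball x0 \<delta>4 \<subseteq> U" using U openE by blast
    define \<delta> where "\<delta> = min (min \<delta>1 \<delta>2) (min \<delta>3 \<delta>4)"
    have \<delta>: "\<delta> > 0" "\<delta> \<le> \<delta>1" "\<delta> \<le> \<delta>2" "\<delta> \<le> \<delta>3" "\<delta> \<le> \<delta>4" using \<delta>1 \<delta>2 \<delta>3 \<delta>4 by (auto simp: \<delta>_def)
    define r where "r = \<delta> / (2 * L)"
    have r: "r > 0" "r * L < \<delta>" using \<delta> L by (auto simp: r_def)
    define pt where "pt q s = x0 + q *\<^sub>R \<tau> + s *\<^sub>R p" for q s
    have nb: "norm (pt q s - x0) \<le> \<bar>q\<bar> * norm \<tau> + \<bar>s\<bar> * norm p" for q s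
      unfolding pt_def using norm_triangle_ineq[of "q *\<^sub>R \<tau>" "s *\<^sub>R p"] by simp
    have nL: "norm (pt q s - x0) \<le> r * L" if "\<bar>q\<bar> \<le> r" "\<bar>s\<bar> \<le> \<kappa> * r" for q s
    proof -
      have "\<bar>q\<bar> * norm \<tau> + \<bar>s\<bar> * norm p \<le> r * norm \<tau> + (\<kappa> * r) * norm p"
        using that by (intro add_mono mult_right_mono) auto
      then show ?thesis using nb[of q s] by (simp add: L_def algebra_simps)
    qed
    have near: "dist (pt q s) x0 < \<delta>" if "\<bar>q\<bar> \<le> r" "\<bar>s\<bar> \<le> \<kappa> * r" for q s
      using nL[OF that] r by (simp add: dist_norm)
    have inU: "pt q s \<in> U" if "\<bar>q\<bar> \<le> r" "\<bar>s\<bar> \<le> \<kappa> * r" for q s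
      using near[OF that] \<delta>(5) \<delta>4(2) by (auto simp: subset_iff dist_commute)
    have \<phi>e: "\<bar>\<phi> (pt q s) - s * (p \<bullet> p)\<bar> \<le> \<eta> * norm (pt q s - x0)" if "\<bar>q\<bar> \<le> r" "\<bar>s\<bar> \<le> \<kappa> * r" for q s
    proof -
      have "norm (pt q s - x0) < \<delta>3" using near[OF that] \<delta>(4) by (simp add: dist_norm)
      from \<delta>3(2)[OF this] show ?thesis using \<tau> \<phi>0 by (simp add: pt_def inner_add_right inner_commute)
    qed
    have \<kappa>r: "\<kappa> * r > 0" using \<kappa> r by simp
    have low: "\<phi> (pt q (- (\<kappa> * r))) < 0" if "\<bar>q\<bar> \<le> r" for q
    proof -
      have "\<phi> (pt q (- (\<kappa> * r))) \<le> - (\<kappa> * r) * (p \<bullet> p) + \<eta> * (r * L)"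
      proof -
        have b: "\<bar>- (\<kappa> * r)\<bar> \<le> \<kappa> * r" using \<kappa>r by simp
        have "\<eta> * norm (pt q (- (\<kappa> * r)) - x0) \<le> \<eta> * (r * L)"
          using nL[OF that b] \<eta>(1) by (intro mult_left_mono) auto
        then show ?thesis using abs_le_D1[OF \<phi>e[OF that b]] by linarith
      qed
      also have "\<dots> = r * (\<eta> * L - \<kappa> * (p \<bullet> p))" by (simp add: algebra_simps)
      also have "\<dots> < 0" using r \<eta>(3) by (simp add: mult_pos_neg)
      finally show ?thesis .
    qed
    have high: "\<phi> (pt r (\<kappa> * r)) > 0"
    proof -
      have rr: "\<bar>r\<bar> \<le> r" using r by simp
      have "\<phi> (pt r (\<kappa> * r)) \<ge> (\<kappa> * r) * (p \<bullet> p) - \<eta> * (r * L)"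
      proof -
        have b: "\<bar>\<kappa> * r\<bar> \<le> \<kappa> * r" using \<kappa>r by simp
        have "\<eta> * norm (pt r (\<kappa> * r) - x0) \<le> \<eta> * (r * L)"
          using nL[OF rr b] \<eta>(1) by (intro mult_left_mono) auto
        then show ?thesis using abs_le_D2[OF \<phi>e[OF rr b]] by linarith
      qed
      moreover have "(\<kappa> * r) * (p \<bullet> p) - \<eta> * (r * L) = r * (\<kappa> * (p \<bullet> p) - \<eta> * L)" by (simp add: algebra_simps)
      moreover have "\<dots> > 0" using r \<eta>(3) by simp
      ultimately show ?thesis by linarith
    qed
    have vert: "\<phi> (pt 0 s) < 0" if "- (\<kappa> * r) \<le> s" "s < 0" for s
    proof -
      have "\<phi> (pt 0 s) \<le> s * (p \<bullet> p) + \<eta> * norm (pt 0 s - x0)"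
      proof -
        have "\<bar>0\<bar> \<le> r" "\<bar>s\<bar> \<le> \<kappa> * r" using that r by auto
        from abs_le_D1[OF \<phi>e[OF this]] show ?thesis by linarith
      qed
      also have "norm (pt 0 s - x0) = - s * norm p" using that by (simp add: pt_def)
      also have "s * (p \<bullet> p) + \<eta> * (- s * norm p) = (- s) * norm p * (\<eta> - norm p)"
        by (simp add: dot_square_norm power2_eq_square algebra_simps)
      also have "\<dots> < 0" using that p0 \<eta>(2) by (intro mult_pos_neg mult_pos_pos) auto
      finally show ?thesis .
    qed
    have ptc: "continuous_on A (\<lambda>s. pt q s)" "continuous_on A (\<lambda>q. pt q s)" for A q s
      unfolding pt_def by (intro continuous_intros)+
    have pl: "pt q s = (x0 + q *\<^sub>R \<tau>) + s *\<^sub>R p" "pt q s = (x0 + s *\<^sub>R p) + q *\<^sub>R \<tau>" for q s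
      by (simp_all add: pt_def)
    \<comment> \<open>the lower end of the normal segment that starts at \<open>x0\<close>\<close>
    have v0: "norm (f (pt 0 (- (\<kappa> * r)))) \<le> \<kappa> * r * M"
    proof -
      have inS: "pt 0 s \<in> S" if "- (\<kappa> * r) \<le> s" "s \<le> 0" for s
      proof (cases "s = 0")
        case True
        then show ?thesis using x0S by (simp add: pt_def)
      next
        case False
        then show ?thesis using Oin[OF inU vert] OS that r by auto
      qed
      have "norm (f ((x0 + 0 *\<^sub>R \<tau>) + 0 *\<^sub>R p) - f ((x0 + 0 *\<^sub>R \<tau>) + (- (\<kappa> * r)) *\<^sub>R p) - (0 - (- (\<kappa> * r))) *\<^sub>R 0) \<le> M * (0 - (- (\<kappa> * r)))"
      proof (rule norm_diff_along_segment[where k = "\<lambda>s. gv p ((x0 + 0 *\<^sub>R \<tau>) + s *\<^sub>R p)"])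
        show "continuous_on {- (\<kappa> * r)..0} (\<lambda>s. f (x0 + 0 *\<^sub>R \<tau> + s *\<^sub>R p))"
          unfolding pl(1)[symmetric] using inS by (intro continuous_on_compose2[OF fc[folded S_def] ptc(1)]) auto
        fix s assume s: "- (\<kappa> * r) < s" "s < 0"
        have "pt 0 s \<in> \<Omega> \<inter> U" using Oin[OF inU vert] s r by auto
        then show "((\<lambda>s. f (x0 + 0 *\<^sub>R \<tau> + s *\<^sub>R p)) has_vector_derivative gv p ((x0 + 0 *\<^sub>R \<tau>) + s *\<^sub>R p)) (at s)"
          unfolding pl(1) by (rule fd)
        show "norm (gv p (x0 + 0 *\<^sub>R \<tau> + s *\<^sub>R p) - 0) \<le> M"
          unfolding pl(1)[symmetric] using inS[of s] near[of 0 s] s r \<delta>(3) by (intro gM) auto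
      qed (use \<kappa>r in auto)
      moreover have "f x0 = 0" using fz x0 U by auto
      ultimately show ?thesis by (simp add: pt_def mult_ac)
    qed
    have rr: "\<bar>r\<bar> \<le> r" using r by simp
    \<comment> \<open>the other end of the tangential segment: \<open>s1\<close> is the height at which the boundary is first met\<close>
    have v1: "norm (f (pt r (- (\<kappa> * r)))) \<le> 2 * (\<kappa> * r) * M"
    proof -
      define Z where "Z = {s \<in> {- (\<kappa> * r)..\<kappa> * r}. \<phi> (pt r s) \<in> {0..}}"
      have \<phi>c: "continuous_on {- (\<kappa> * r)..\<kappa> * r} (\<lambda>s. \<phi> (pt r s))"
      proof -
        have "continuous_on U \<phi>"
          using local_defining_derivative[OF ld] has_derivative_continuous continuous_at_imp_continuous_on by blast
        then show ?thesis
          by (rule continuous_on_compose2[OF _ ptc(1)]) (use inU[OF rr] in \<open>auto simp: abs_le_iff\<close>)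
      qed
      have "closed Z" unfolding Z_def
        using continuous_closed_preimage[OF \<phi>c _ closed_atLeast[of 0]] by (simp add: vimage_def Int_def)
      moreover have "bounded Z" by (rule bounded_subset[of "{- (\<kappa> * r)..\<kappa> * r}"]) (auto simp: Z_def)
      ultimately have "compact Z" by (simp add: compact_eq_bounded_closed)
      moreover have "\<kappa> * r \<in> Z" using high \<kappa>r by (simp add: Z_def)
      ultimately obtain s1 where s1: "s1 \<in> Z" "\<And>s. s \<in> Z \<Longrightarrow> s1 \<le> s"
        using compact_attains_inf[of Z] by blast
      have s1b: "- (\<kappa> * r) \<le> s1" "s1 \<le> \<kappa> * r" and s1p: "\<phi> (pt r s1) \<ge> 0" using s1(1) by (auto simp: Z_def)
      have neg: "\<phi> (pt r s) < 0" if "- (\<kappa> * r) \<le> s" "s < s1" for s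
        using s1(2)[of s] that s1b by (force simp: Z_def)
      have s1l: "- (\<kappa> * r) < s1" using low[OF rr] s1p s1b by (cases "s1 = - (\<kappa> * r)") auto
      have s1z: "\<phi> (pt r s1) = 0"
      proof (rule antisym[OF _ s1p])
        have "continuous_on {- (\<kappa> * r)..s1} (\<lambda>s. \<phi> (pt r s))" by (rule continuous_on_subset[OF \<phi>c]) (use s1b in auto)
        then have "((\<lambda>s. \<phi> (pt r s)) \<longlongrightarrow> \<phi> (pt r s1)) (at s1 within {- (\<kappa> * r)..s1})"
          using s1l by (auto simp: continuous_on_def)
        then have t: "((\<lambda>s. \<phi> (pt r s)) \<longlongrightarrow> \<phi> (pt r s1)) (at_left s1)"
          using s1l by (simp add: at_within_Icc_at_left)
        have "eventually (\<lambda>s. s \<in> {- (\<kappa> * r)<..<s1}) (at_left s1)" by (rule eventually_at_left_real[OF s1l])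
        then have "eventually (\<lambda>s. \<phi> (pt r s) \<le> 0) (at_left s1)"
          by eventually_elim (use neg in \<open>force simp: less_imp_le\<close>)
        then show "\<phi> (pt r s1) \<le> 0" by (rule tendsto_upperbound[OF t]) simp
      qed
      have ab: "\<bar>s\<bar> \<le> \<kappa> * r" if "- (\<kappa> * r) \<le> s" "s \<le> s1" for s using that s1b by auto
      have inO: "pt r s \<in> \<Omega> \<inter> U" if "- (\<kappa> * r) \<le> s" "s < s1" for s
        using Oin[OF inU[OF rr ab] neg] that by auto
      have inF: "pt r s1 \<in> frontier \<Omega> \<inter> U" using Fin[OF inU[OF rr ab] s1z] s1b by auto
      have inS: "pt r s \<in> S" if "- (\<kappa> * r) \<le> s" "s \<le> s1" for s
        using inO[of s] inF OS FS that by (cases "s = s1") auto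
      have "norm (f ((x0 + r *\<^sub>R \<tau>) + s1 *\<^sub>R p) - f ((x0 + r *\<^sub>R \<tau>) + (- (\<kappa> * r)) *\<^sub>R p) - (s1 - (- (\<kappa> * r))) *\<^sub>R 0) \<le> M * (s1 - (- (\<kappa> * r)))"
      proof (rule norm_diff_along_segment[where k = "\<lambda>s. gv p ((x0 + r *\<^sub>R \<tau>) + s *\<^sub>R p)"])
        show "continuous_on {- (\<kappa> * r)..s1} (\<lambda>s. f (x0 + r *\<^sub>R \<tau> + s *\<^sub>R p))"
          unfolding pl(1)[symmetric] using inS by (intro continuous_on_compose2[OF fc[folded S_def] ptc(1)]) auto
        fix s assume s: "- (\<kappa> * r) < s" "s < s1"
        have "pt r s \<in> \<Omega> \<inter> U" using inO s by auto
        then show "((\<lambda>s. f (x0 + r *\<^sub>R \<tau> + s *\<^sub>R p)) has_vector_derivative gv p ((x0 + r *\<^sub>R \<tau>) + s *\<^sub>R p)) (at s)"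
          unfolding pl(1) by (rule fd)
        show "norm (gv p (x0 + r *\<^sub>R \<tau> + s *\<^sub>R p) - 0) \<le> M"
          unfolding pl(1)[symmetric] using inS[of s] near[OF rr ab, of s] s \<delta>(3) by (intro gM) auto
      qed (use s1l in auto)
      moreover have "f (pt r s1) = 0" using fz[OF inF] .
      ultimately have "norm (f (pt r (- (\<kappa> * r)))) \<le> M * (s1 + \<kappa> * r)" by (simp add: pl(1))
      also have "\<dots> \<le> M * (2 * (\<kappa> * r))" using s1b M by (intro mult_left_mono) auto
      finally show ?thesis by (simp add: mult_ac)
    qed
    have hz: "norm (f (pt r (- (\<kappa> * r))) - f (pt 0 (- (\<kappa> * r))) - r *\<^sub>R \<gamma>) \<le> norm \<gamma> / 4 * r"
    proof -
      have ab: "\<bar>- (\<kappa> * r)\<bar> \<le> \<kappa> * r" using \<kappa>r by simp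
      have inO: "pt q (- (\<kappa> * r)) \<in> \<Omega> \<inter> U" if "0 \<le> q" "q \<le> r" for q
        using Oin[OF inU[OF _ ab] low] that by auto
      have "norm (f ((x0 + (- (\<kappa> * r)) *\<^sub>R p) + r *\<^sub>R \<tau>) - f ((x0 + (- (\<kappa> * r)) *\<^sub>R p) + 0 *\<^sub>R \<tau>) - (r - 0) *\<^sub>R \<gamma>) \<le> norm \<gamma> / 4 * (r - 0)"
      proof (rule norm_diff_along_segment[where k = "\<lambda>q. gv \<tau> ((x0 + (- (\<kappa> * r)) *\<^sub>R p) + q *\<^sub>R \<tau>)"])
        show "continuous_on {0..r} (\<lambda>q. f (x0 + (- (\<kappa> * r)) *\<^sub>R p + q *\<^sub>R \<tau>))"
          unfolding pl(2)[symmetric] using inO OS by (intro continuous_on_compose2[OF fc[folded S_def] ptc(2)]) auto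
        fix q assume q: "0 < q" "q < r"
        have i: "pt q (- (\<kappa> * r)) \<in> \<Omega> \<inter> U" using inO q by auto
        then show "((\<lambda>q. f (x0 + (- (\<kappa> * r)) *\<^sub>R p + q *\<^sub>R \<tau>)) has_vector_derivative gv \<tau> ((x0 + (- (\<kappa> * r)) *\<^sub>R p) + q *\<^sub>R \<tau>)) (at q)"
          unfolding pl(2) by (rule fd)
        show "norm (gv \<tau> (x0 + (- (\<kappa> * r)) *\<^sub>R p + q *\<^sub>R \<tau>) - \<gamma>) \<le> norm \<gamma> / 4"
          unfolding pl(2)[symmetric] using i OS near[OF _ ab, of q] q \<delta>(2) by (intro less_imp_le[OF \<delta>1(2)]) auto
      qed (use r in auto)
      then show ?thesis by (simp add: pl(2))
    qed
    have "r * norm \<gamma> = norm (r *\<^sub>R \<gamma>)" using r by simp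
    also have "\<dots> \<le> norm (f (pt r (- (\<kappa> * r))) - f (pt 0 (- (\<kappa> * r))) - r *\<^sub>R \<gamma>) + norm (f (pt r (- (\<kappa> * r)))) + norm (f (pt 0 (- (\<kappa> * r))))"
      using norm_triangle_ineq4[of "f (pt r (- (\<kappa> * r))) - f (pt 0 (- (\<kappa> * r)))" "f (pt r (- (\<kappa> * r))) - f (pt 0 (- (\<kappa> * r))) - r *\<^sub>R \<gamma>"]
        norm_triangle_ineq4[of "f (pt r (- (\<kappa> * r)))" "f (pt 0 (- (\<kappa> * r)))"] by simp
    also have "\<dots> \<le> norm \<gamma> / 4 * r + 2 * (\<kappa> * r) * M + \<kappa> * r * M" using hz v0 v1 by linarith
    also have "\<dots> = norm \<gamma> / 4 * r + (3 * \<kappa> * M) * r" by (simp add: algebra_simps)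
    also have "\<dots> = r * norm \<gamma> / 2" unfolding \<kappa>(2) by simp
    finally show False using r \<gamma> by simp
  qed
  define \<kappa> where "\<kappa> = gv p x0 /\<^sub>R (p \<bullet> p)"
  have "g i x0 = complex_of_real (p $ i) * \<kappa>" for i
  proof -
    define c where "c = p $ i / (p \<bullet> p)"
    have pp: "p \<bullet> p > 0" using p0 by simp
    have "(axis i 1 - c *\<^sub>R p) \<bullet> p = 0" using pp by (simp add: c_def inner_diff_left inner_axis')
    then have "gv (axis i 1 - c *\<^sub>R p) x0 = 0" by (rule tang)
    moreover have "gv (axis i 1 - c *\<^sub>R p) x0 = gv (axis i 1) x0 - c *\<^sub>R gv p x0"
      by (simp add: gv_def scaleR_left_diff_distrib sum_subtractf scaleR_sum_right)
    moreover have "gv (axis i 1) x0 = g i x0"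
    proof -
      have "gv (axis i 1) x0 = (\<Sum>k\<in>UNIV. if k = i then g k x0 else 0)"
        unfolding gv_def by (intro sum.cong refl) (simp add: axis_def)
      then show ?thesis by simp
    qed
    ultimately show ?thesis by (simp add: \<kappa>_def c_def scaleR_conv_of_real divide_inverse)
  qed
  then show ?thesis unfolding p_def by blast
qed

section \<open>Vanishing Cauchy data at smooth boundary points\<close>

lemma length_mi_word: "count_list (mi_word \<alpha>) i = \<alpha> i" "length (mi_word (\<alpha> :: 'n::finite \<Rightarrow> nat)) = mi_order \<alpha>"
proof -
  obtain w where w: "mset w = Abs_multiset \<alpha>" using ex_mset by blast
  have "count (Abs_multiset \<alpha>) = \<alpha>" by (rule count_Abs_multiset) simp
  then have "\<forall>i. count_list w i = \<alpha> i" unfolding w[symmetric] by (metis count_mset)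
  then have *: "\<forall>i. count_list (mi_word \<alpha>) i = \<alpha> i" unfolding mi_word_def by (rule someI)
  then show "count_list (mi_word \<alpha>) i = \<alpha> i" by simp
  show "length (mi_word \<alpha>) = mi_order \<alpha>"
    using sum_count_set[of "mi_word \<alpha>" UNIV] * by (simp add: mi_order_def)
qed

lemma prod_list_count:
  "prod_list (map f xs) = (\<Prod>i\<in>(UNIV :: 'n::finite set). f i ^ count_list xs i :: 'a::comm_semiring_1)"
proof (induction xs)
  case (Cons a xs)
  have "(\<Prod>i\<in>UNIV. f i ^ count_list (a # xs) i) = (\<Prod>i\<in>UNIV. (if i = a then f i else 1) * f i ^ count_list xs i)"
    by (intro prod.cong refl) auto
  also have "\<dots> = f a * (\<Prod>i\<in>UNIV. f i ^ count_list xs i)"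
    by (simp add: prod.distrib prod.delta)
  finally show ?case using Cons by simp
qed simp

lemma mi_power_word: "mi_power \<zeta> \<alpha> = prod_list (map (($) \<zeta>) (mi_word \<alpha>))"
  unfolding prod_list_count length_mi_word mi_power_def ..

lemma finite_mi_order_le: "finite {\<alpha> :: 'n::finite \<Rightarrow> nat. mi_order \<alpha> \<le> j}"
proof (rule finite_subset)
  show "{\<alpha> :: 'n \<Rightarrow> nat. mi_order \<alpha> \<le> j} \<subseteq> (\<Pi>\<^sub>E i\<in>UNIV. {..j})"
  proof
    fix \<alpha> :: "'n \<Rightarrow> nat" assume "\<alpha> \<in> {\<alpha>. mi_order \<alpha> \<le> j}"
    then have "\<alpha> i \<le> j" for i
      using member_le_sum[of i UNIV \<alpha>] by (simp add: mi_order_def)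
    then show "\<alpha> \<in> (\<Pi>\<^sub>E i\<in>UNIV. {..j})" by auto
  qed
qed (intro finite_PiE; simp)

lemma local_defining_restrict:
  assumes "local_defining \<Omega> x U \<phi>" "open V" "y \<in> U \<inter> V"
  shows "local_defining \<Omega> y (U \<inter> V) \<phi>"
proof -
  have "smooth_fun_on (U \<inter> V) \<phi>"
    unfolding smooth_fun_on_def cont_deriv_def
  proof (intro allI impI conjI)
    fix vs :: "(real^'a) list" assume "set vs \<subseteq> Basis"
    then have c: "derivs_exist U vs \<phi>" "continuous_on U (foldr dirderiv vs \<phi>)"
      using assms(1) by (auto simp: local_defining_def smooth_fun_on_def cont_deriv_def)
    have "derivs_exist U vs \<phi> \<Longrightarrow> derivs_exist (U \<inter> V) vs \<phi>" by (induction vs) auto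
    then show "derivs_exist (U \<inter> V) vs \<phi>" using c(1) by blast
    show "continuous_on (U \<inter> V) (foldr dirderiv vs \<phi>)" by (rule continuous_on_subset[OF c(2)]) auto
  qed
  then show ?thesis using assms by (auto simp: local_defining_def)
qed

text \<open>The words stand for derivatives of order \<open>j\<close> at a boundary point.  Exchanging the outermost letter
\<open>i\<close> for \<open>i0\<close> costs the factor \<open>c i\<close>; letters can be moved past each other, so all letters can be
exchanged.\<close>

lemma rank_one_words:
  fixes A :: "'n list \<Rightarrow> complex"
  assumes head: "\<And>i ws. length ws + 1 = j \<Longrightarrow> A (i # ws) = c i * A (i0 # ws)"
    and move: "\<And>p q. length p + length q + 1 = j \<Longrightarrow> A (i0 # p @ q) = A (p @ i0 # q)"
    and "length p + k = j"
  shows "A (p @ replicate k i0) = prod_list (map c p) * A (replicate j i0)"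
  using assms(3)
proof (induction p arbitrary: k)
  case Nil
  then show ?case by simp
next
  case (Cons i p)
  have "A ((i # p) @ replicate k i0) = c i * A (i0 # p @ replicate k i0)"
    using head[of "p @ replicate k i0" i] Cons.prems by simp
  also have "A (i0 # p @ replicate k i0) = A (p @ replicate (Suc k) i0)"
    using move[of p "replicate k i0"] Cons.prems by simp
  also have "\<dots> = prod_list (map c p) * A (replicate j i0)"
    by (rule Cons.IH) (use Cons.prems in simp)
  finally show ?case by (simp add: mult.assoc)
qed

lemma open_cyl: "open \<Omega> \<Longrightarrow> open (cyl \<Omega> T)"
  unfolding cyl_def by (intro open_Times) auto

lemma at_lateral_boundary_nontrivial:
  assumes "open \<Omega>" "x \<in> frontier \<Omega>" "0 < t" "t < T"
  shows "at (x, t) within cyl \<Omega> T \<noteq> bot"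
proof -
  have "x \<notin> \<Omega>" "x \<in> closure \<Omega>" using assms by (auto simp: frontier_def interior_open)
  moreover have "closure (cyl \<Omega> T) = closure \<Omega> \<times> {0..T}"
    using assms by (simp add: cyl_def closure_Times)
  ultimately have "(x, t) \<in> closure (cyl \<Omega> T)" "(x, t) \<notin> cyl \<Omega> T" using assms by (auto simp: cyl_def)
  then show ?thesis by (simp add: trivial_limit_within islimpt_in_closure)
qed

lemma dir_x_words: "set vs \<subseteq> range dir_x \<longleftrightarrow> (\<exists>ws. vs = map dir_x ws)"
  unfolding ex_map_conv by auto

lemma smooth_zero_ext_of_words:
  fixes f :: "(real^'n) \<times> real \<Rightarrow> complex"
  assumes "\<And>ws. length ws \<le> r \<Longrightarrow> cont_deriv W (map dir_x ws) f"
    and "\<And>ws. length ws \<le> r \<Longrightarrow> continuous_on X (zero_ext W (foldr dirderiv (map dir_x ws) f))"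
  shows "smooth_zero_ext r W X (range dir_x) f"
proof (rule smooth_zero_ext_words)
  fix vs :: "((real^'n) \<times> real) list" assume v: "set vs \<subseteq> range dir_x" "length vs \<le> r"
  then obtain ws where "vs = map dir_x ws" unfolding dir_x_words by blast
  then show "derivs_exist W vs f \<and> continuous_on X (zero_ext W (foldr dirderiv vs f))"
    using assms[of ws] v by (simp add: cont_deriv_def)
qed

lemma smooth_zero_ext_C_k_0: "u \<in> C_k_0 k \<Omega> T \<Longrightarrow> smooth_zero_ext k (cyl \<Omega> T) (cyl \<Omega> T) (range dir_x) u"
  by (rule smooth_zero_ext_of_words) (auto simp: C_k_0_def cont_deriv_def zero_ext_cont_on)

text \<open>Induction on the order \<open>j\<close> of the derivatives.  Derivatives of order \<open>j - 1\<close> vanish on \<open>\<Gamma>\<close>, so by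
\<open>boundary_gradient_normal\<close> the derivatives of order \<open>j\<close> are proportional to the normal in their
outermost index, and by symmetry in each index.  They are therefore \<open>\<nu>\<^sub>i\<^sub>1 \<dots> \<nu>\<^sub>i\<^sub>j\<close> times one number, and the
condition for \<open>B\<^sub>j\<close> says that this number times the principal symbol at \<open>\<nu>\<close> is zero.\<close>

proposition cauchy_data_vanish:
  fixes \<Omega> \<Gamma> :: "(real^'n) set" and u v :: "(real^'n) \<times> real \<Rightarrow> complex"
  assumes O: "open \<Omega>" and ds: "dirichlet_system \<Omega> (Suc k) B" and \<Gamma>: "openin (top_of_set (frontier \<Omega>)) \<Gamma>"
    and u: "u \<in> C_k_0_upto k \<Omega> (closure \<Gamma>) T" and v: "v \<in> C_k_0_upto k \<Omega> (closure \<Gamma>) T"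
    and bc: "\<And>j q. j \<le> k \<Longrightarrow> q \<in> cyl (closure \<Gamma>) T \<Longrightarrow> boundary_op \<Omega> T j (B j) u q = boundary_op \<Omega> T j (B j) v q"
  obtains H where "\<And>ws. length ws \<le> k \<Longrightarrow> continuous_on (cyl (\<Omega> \<union> closure \<Gamma>) T) (H ws)"
    "\<And>ws p. length ws \<le> k \<Longrightarrow> p \<in> cyl \<Omega> T \<Longrightarrow> H ws p = foldr dirderiv (map dir_x ws) (\<lambda>p. u p - v p) p"
    "\<And>ws x t. length ws \<le> k \<Longrightarrow> x \<in> \<Gamma> \<inter> smooth_boundary_part \<Omega> \<Longrightarrow> 0 < t \<Longrightarrow> t < T \<Longrightarrow> H ws (x, t) = 0"
proof -
  define W where "W = cyl \<Omega> T"
  define Y where "Y = cyl (\<Omega> \<union> closure \<Gamma>) T"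
  define w where "w p = u p - v p" for p
  have W: "open W" unfolding W_def by (rule open_cyl[OF O])
  have WY: "W \<subseteq> Y" by (auto simp: W_def Y_def cyl_def)
  have "\<forall>ws. \<exists>h. length ws \<le> k \<longrightarrow> continuous_on Y h \<and> (\<forall>p\<in>W. h p = foldr dirderiv (map dir_x ws) u p)"
    using u by (auto simp: C_k_0_upto_def Y_def W_def)
  then obtain hu where hu: "\<And>ws. length ws \<le> k \<Longrightarrow> continuous_on Y (hu ws)"
    "\<And>ws p. length ws \<le> k \<Longrightarrow> p \<in> W \<Longrightarrow> hu ws p = foldr dirderiv (map dir_x ws) u p" by metis
  have "\<forall>ws. \<exists>h. length ws \<le> k \<longrightarrow> continuous_on Y h \<and> (\<forall>p\<in>W. h p = foldr dirderiv (map dir_x ws) v p)"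
    using v by (auto simp: C_k_0_upto_def Y_def W_def)
  then obtain hv where hv: "\<And>ws. length ws \<le> k \<Longrightarrow> continuous_on Y (hv ws)"
    "\<And>ws p. length ws \<le> k \<Longrightarrow> p \<in> W \<Longrightarrow> hv ws p = foldr dirderiv (map dir_x ws) v p" by metis
  have Cu: "smooth_zero_ext k W W (range dir_x) u" and Cv: "smooth_zero_ext k W W (range dir_x) v"
    unfolding W_def using u v by (auto simp: C_k_0_upto_def intro!: smooth_zero_ext_C_k_0)
  have Cw: "smooth_zero_ext k W W (range dir_x) w" unfolding w_def[abs_def] by (rule smooth_zero_ext_diff[OF W Cu Cv])
  define H where "H ws p = hu ws p - hv ws p" for ws p
  have Hc: "continuous_on Y (H ws)" if "length ws \<le> k" for ws
    unfolding H_def by (intro continuous_intros hu hv that)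
  have Hw: "H ws p = foldr dirderiv (map dir_x ws) w p" if "length ws \<le> k" "p \<in> W" for ws p
  proof -
    have "foldr dirderiv (map dir_x ws) (\<lambda>p. u p - v p) p = foldr dirderiv (map dir_x ws) u p - foldr dirderiv (map dir_x ws) v p"
      using that by (intro foldr_dirderiv_diff[OF W smooth_zero_ext_mono[OF Cu] smooth_zero_ext_mono[OF Cv]]) auto
    then show ?thesis using that by (simp add: H_def hu hv w_def[abs_def])
  qed
  have "\<forall>ws. length ws = j \<longrightarrow> (\<forall>x t. x \<in> \<Gamma> \<inter> smooth_boundary_part \<Omega> \<and> 0 < t \<and> t < T \<longrightarrow> H ws (x, t) = 0)" if "j \<le> k" for j
    using that
  proof (induction j rule: less_induct)
    case (less j)
    have IH: "H ws (x, t) = 0" if "length ws < j" "x \<in> \<Gamma> \<inter> smooth_boundary_part \<Omega>" "0 < t" "t < T" for ws x t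
      using less.IH[OF that(1)] that less.prems by auto
    have jk: "j \<le> k" by fact
    have "H ws (x, t) = 0" if lw: "length ws = j" and x: "x \<in> \<Gamma> \<inter> smooth_boundary_part \<Omega>" and t: "0 < t" "t < T" for ws x t
    proof -
      have xf: "x \<in> frontier \<Omega>" using x by (simp add: smooth_boundary_part_def)
      obtain U0 \<phi> where ld0: "local_defining \<Omega> x U0 \<phi>" using x by (auto simp: smooth_boundary_part_def)
      obtain N where N: "open N" "\<Gamma> = frontier \<Omega> \<inter> N" using \<Gamma> by (auto simp: openin_open)
      define U where "U = U0 \<inter> N"
      have ld: "local_defining \<Omega> x U \<phi>" unfolding U_def
        by (rule local_defining_restrict[OF ld0 N(1)]) (use ld0 x N in \<open>auto simp: local_defining_def\<close>)
      have Ub: "y \<in> \<Gamma> \<inter> smooth_boundary_part \<Omega>" if "y \<in> frontier \<Omega> \<inter> U" for y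
      proof -
        have "local_defining \<Omega> y U \<phi>" unfolding U_def
          by (rule local_defining_restrict[OF ld0 N(1)]) (use that in \<open>auto simp: U_def\<close>)
        then show ?thesis using that N by (auto simp: U_def smooth_boundary_part_def)
      qed
      have UY: "(y, t) \<in> Y" if "y \<in> (\<Omega> \<union> frontier \<Omega>) \<inter> U" for y
        using that Ub[of y] closure_subset[of \<Gamma>] t by (auto simp: Y_def cyl_def)
      have q: "(x, t) \<in> Y" using x closure_subset[of \<Gamma>] t by (auto simp: Y_def cyl_def)
      define \<F> where "\<F> = at (x, t) within W"
      have nt: "\<F> \<noteq> bot" unfolding \<F>_def W_def by (rule at_lateral_boundary_nontrivial[OF O xf t])
      have evW: "eventually (\<lambda>p. p \<in> W) \<F>" by (simp add: \<F>_def eventually_at_filter)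
      have lim: "(f \<longlongrightarrow> h (x, t)) \<F>" if "continuous_on Y h" "\<And>p. p \<in> W \<Longrightarrow> h p = f p" for f h :: "(real^'n) \<times> real \<Rightarrow> complex"
      proof -
        have "(h \<longlongrightarrow> h (x, t)) (at (x, t) within Y)" using that(1) q by (auto simp: continuous_on_def)
        then have "(h \<longlongrightarrow> h (x, t)) \<F>" unfolding \<F>_def by (rule tendsto_within_subset[OF _ WY])
        then show ?thesis by (rule Lim_transform_eventually) (use evW that(2) in \<open>auto elim: eventually_mono\<close>)
      qed
      define A where "A ws = H ws (x, t)" for ws
      define \<nu> where "\<nu> = exterior_normal \<Omega> x"
      define p where "p = gradient \<phi> x"
      have \<nu>p: "\<nu> = p /\<^sub>R norm p" unfolding \<nu>_def p_def by (rule exterior_normal_eq[OF ld xf])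
      have p0: "p \<noteq> 0" unfolding p_def by (rule local_defining_zero(2)[OF ld xf])
      then obtain i0 where i0: "p $ i0 \<noteq> 0" by (metis vec_eq_iff zero_index)
      have \<nu>0: "\<nu> $ i0 \<noteq> 0" using i0 p0 by (simp add: \<nu>p)
      \<comment> \<open>\<open>i0\<close> is a coordinate in which the normal does not vanish; derivatives in \<open>i\<close> are \<open>c i\<close> times those in \<open>i0\<close>\<close>
      define c where "c i = complex_of_real (\<nu> $ i / \<nu> $ i0)" for i
      have cp: "c i = complex_of_real (p $ i / p $ i0)" for i using p0 by (simp add: c_def \<nu>p)
      have head: "A (i # ws) = c i * A (i0 # ws)" if "length ws + 1 = j" for i ws
      proof -
        have l: "length ws \<le> k" "length (i # ws) \<le> k" "length ws < j" for i using that jk by auto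
        have "\<exists>\<kappa>. \<forall>i. H (i # ws) (x, t) = complex_of_real (gradient \<phi> x $ i) * \<kappa>"
        proof (rule boundary_gradient_normal[OF O ld xf, where f = "\<lambda>y. H ws (y, t)" and g = "\<lambda>i y. H (i # ws) (y, t)"])
          show "continuous_on ((\<Omega> \<union> frontier \<Omega>) \<inter> U) (\<lambda>y. H ws (y, t))"
            by (rule continuous_on_compose2[OF Hc[OF l(1)]]) (auto intro!: continuous_intros UY)
          show "continuous_on ((\<Omega> \<union> frontier \<Omega>) \<inter> U) (\<lambda>y. H (i # ws) (y, t))" for i
            by (rule continuous_on_compose2[OF Hc[OF l(2)]]) (auto intro!: continuous_intros UY)
          show "H ws (y, t) = 0" if "y \<in> frontier \<Omega> \<inter> U" for y by (rule IH[OF l(3) Ub[OF that] t])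
          fix i
          have "smooth_zero_ext (length (map dir_x ws) + Suc 0) W W (range dir_x) w"
            by (rule smooth_zero_ext_mono[OF Cw]) (use that jk in auto)
          then have "smooth_zero_ext (Suc 0) W W (range dir_x) (foldr dirderiv (map dir_x ws) w)"
            by (rule smooth_zero_ext_foldr) auto
          then have "partial_on W (dir_x i) (foldr dirderiv (map dir_x ws) w) (dirderiv (dir_x i) (foldr dirderiv (map dir_x ws) w))"
            by (rule smooth_zero_ext_partial) auto
          then have "partial_on W (dir_x i) (H ws) (H (i # ws))"
            by (rule partial_on_transform[OF _ W]) (simp_all add: Hw[OF l(1)] Hw[OF l(2)])
          then show "partial_on (\<Omega> \<inter> U) (axis i 1) (\<lambda>y. H ws (y, t)) (\<lambda>y. H (i # ws) (y, t))"
            using t by (auto simp: partial_on_def W_def cyl_def dir_x_def)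
        qed
        then obtain \<kappa> where \<kappa>: "\<And>i. H (i # ws) (x, t) = complex_of_real (p $ i) * \<kappa>" unfolding p_def by blast
        show ?thesis using i0 by (simp add: A_def \<kappa> cp)
      qed
      have move: "A (i0 # p @ q) = A (p @ i0 # q)" if "length p + length q + 1 = j" for p q
      proof -
        have l: "length (i0 # p @ q) \<le> k" "length (p @ i0 # q) \<le> k" using that jk by auto
        have C: "smooth_zero_ext (Suc (length (map dir_x p :: ((real^'n) \<times> real) list) + length (map dir_x q :: ((real^'n) \<times> real) list))) W W (range dir_x) w"
          by (rule smooth_zero_ext_mono[OF Cw]) (use that jk in auto)
        have "H (i0 # p @ q) y = foldr dirderiv (map dir_x (p @ i0 # q)) w y" if "y \<in> W" for y
        proof -
          have "foldr dirderiv (dir_x i0 # map dir_x p @ map dir_x q) w y = foldr dirderiv (map dir_x p @ dir_x i0 # map dir_x q) w y"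
            by (rule foldr_dirderiv_move[OF W C]) (use that in auto)
          then show ?thesis using Hw[OF l(1) that] by simp
        qed
        from tendsto_unique[OF nt lim[OF Hc[OF l(1)] this] lim[OF Hc[OF l(2)] Hw[OF l(2)]]]
        show ?thesis by (simp add: A_def)
      qed
      define K where "K = A (replicate j i0)"
      have AK: "A ws = prod_list (map c ws) * K" if "length ws = j" for ws
        using rank_one_words[of j A c i0 ws 0, OF head move] that by (simp add: K_def)
      have pc: "prod_list (map c ws) = complex_of_real (prod_list (map (($) \<nu>) ws)) / complex_of_real (\<nu> $ i0) ^ length ws" for ws
        by (induction ws) (auto simp: c_def)
      have Li: "Lim \<F> (partial_x \<alpha> u) = hu (mi_word \<alpha>) (x, t)" "Lim \<F> (partial_x \<alpha> v) = hv (mi_word \<alpha>) (x, t)" if "mi_order \<alpha> \<le> j" for \<alpha>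
      proof -
        have l: "length (mi_word \<alpha>) \<le> k" using that jk by (simp add: length_mi_word)
        show "Lim \<F> (partial_x \<alpha> u) = hu (mi_word \<alpha>) (x, t)" unfolding partial_x_def
          by (rule tendsto_Lim[OF nt lim[OF hu(1)[OF l] hu(2)[OF l]]])
        show "Lim \<F> (partial_x \<alpha> v) = hv (mi_word \<alpha>) (x, t)" unfolding partial_x_def
          by (rule tendsto_Lim[OF nt lim[OF hv(1)[OF l] hv(2)[OF l]]])
      qed
      have "(x, t) \<in> cyl (closure \<Gamma>) T" using x closure_subset[of \<Gamma>] t by (auto simp: cyl_def)
      from bc[OF jk this] have "(\<Sum>\<alpha> | mi_order \<alpha> \<le> j. B j \<alpha> x * hu (mi_word \<alpha>) (x, t)) = (\<Sum>\<alpha> | mi_order \<alpha> \<le> j. B j \<alpha> x * hv (mi_word \<alpha>) (x, t))"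
        unfolding boundary_op_def \<F>_def[unfolded W_def, symmetric] by (simp add: Li)
      then have "0 = (\<Sum>\<alpha> | mi_order \<alpha> \<le> j. B j \<alpha> x * A (mi_word \<alpha>))"
        by (simp add: A_def H_def right_diff_distrib sum_subtractf)
      also have "\<dots> = (\<Sum>\<alpha> | mi_order \<alpha> = j. B j \<alpha> x * A (mi_word \<alpha>))"
      proof (rule sum.mono_neutral_right[OF finite_mi_order_le])
        show "\<forall>\<alpha>\<in>{\<alpha>. mi_order \<alpha> \<le> j} - {\<alpha>. mi_order \<alpha> = j}. B j \<alpha> x * A (mi_word \<alpha>) = 0"
          using IH x t by (auto simp: A_def length_mi_word)
      qed auto
      also have "\<dots> = (\<Sum>\<alpha> | mi_order \<alpha> = j. B j \<alpha> x * complex_of_real (mi_power \<nu> \<alpha>) * (K / complex_of_real (\<nu> $ i0) ^ j))"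
        by (intro sum.cong refl) (simp add: AK pc length_mi_word mi_power_word)
      also have "\<dots> = principal_symbol j (B j) x \<nu> * (K / complex_of_real (\<nu> $ i0) ^ j)"
        unfolding principal_symbol_def by (rule sum_distrib_right[symmetric])
      finally have "principal_symbol j (B j) x \<nu> * (K / complex_of_real (\<nu> $ i0) ^ j) = 0" by simp
      moreover have "principal_symbol j (B j) x \<nu> \<noteq> 0" unfolding \<nu>_def
        using ds x jk by (auto simp: dirichlet_system_def)
      ultimately have "K = 0" using \<nu>0 by simp
      then show ?thesis using AK[OF lw] by (simp add: A_def)
    qed
    then show ?case by blast
  qed
  then show ?thesis using that[of H] Hc Hw unfolding W_def Y_def w_def by blast
qed

section \<open>Time averages of a solution form a chain of iterated Laplacians\<close>

lemma range_dir_x: "range dir_x = (\<lambda>b. (b, 0)) ` (Basis :: (real^'n) set)"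
  unfolding Basis_vec_eq by (auto simp: dir_x_def image_image)

lemma smooth_zero_ext_subset:
  assumes "smooth_zero_ext r W X V f" "X' \<subseteq> X"
  shows "smooth_zero_ext r W X' V f"
  using assms(1)
proof (induction r arbitrary: f)
  case 0
  then show ?case using assms(2) continuous_on_subset by auto
next
  case (Suc r)
  then show ?case by (auto intro: continuous_on_subset[OF _ assms(2)])
qed

lemma fact_add_le: "(fact (2 * (i + j)) :: real) \<le> 4 ^ (i + j) * (fact (2 * i) * fact (2 * j))"
proof -
  have "fact (2 * (i + j)) = real ((2 * (i + j)) choose (2 * i)) * (fact (2 * i) * fact (2 * j))"
    using binomial_fact[of "2 * i" "2 * (i + j)", where 'a = real] by simp
  also have "\<dots> \<le> real (2 ^ (2 * (i + j))) * (fact (2 * i) * fact (2 * j))"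
    by (intro mult_right_mono of_nat_mono binomial_le_pow2) auto
  also have "real (2 ^ (2 * (i + j))) = 4 ^ (i + j)" by (simp only: power_mult) simp
  finally show ?thesis .
qed

locale parabolic_solution =
  fixes \<Omega> :: "(real^'n) set" and T :: real and m :: nat and w :: "(real^'n) \<times> real \<Rightarrow> complex"
  assumes open_\<Omega>: "open \<Omega>" and m: "m \<ge> 1"
    and Cw: "smooth_zero_ext (2 * m) (cyl \<Omega> T) (cyl \<Omega> T) (range dir_x) w"
    and wt: "partial_on (cyl \<Omega> T) dir_t w (dirderiv dir_t w)"
    and eq: "\<And>p. p \<in> cyl \<Omega> T \<Longrightarrow> dirderiv dir_t w p + neg_laplace_pow m w p = 0"

text \<open>The functions \<open>\<theta> k\<close> are the successive derivatives of a bump on \<open>[a, b]\<close>; the functional \<open>L\<close> stands for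
the real or the imaginary part.\<close>

locale time_average = parabolic_solution \<Omega> T m w
  for \<Omega> :: "(real^'n) set" and T :: real and m :: nat and w :: "(real^'n) \<times> real \<Rightarrow> complex" +
  fixes a b :: real and \<theta> :: "nat \<Rightarrow> real \<Rightarrow> real" and L :: "complex \<Rightarrow> real"
  assumes ab: "0 < a" "a < b" "b < T" and L: "bounded_linear L"
    and \<theta>c: "\<And>k. continuous_on UNIV (\<theta> k)" and \<theta>0: "\<And>k. \<theta> k a = 0" "\<And>k. \<theta> k b = 0"
    and \<theta>d: "\<And>k t. a < t \<Longrightarrow> t < b \<Longrightarrow> (\<theta> k has_real_derivative \<theta> (Suc k) t) (at t)"
    and \<theta>b: "\<And>k t. \<bar>\<theta> k t\<bar> \<le> 4 ^ k * fact (2 * k)"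
begin

abbreviation "W \<equiv> cyl \<Omega> T"

definition avg_of :: "nat \<Rightarrow> ((real^'n) \<times> real \<Rightarrow> complex) \<Rightarrow> real^'n \<Rightarrow> real" where
  "avg_of k f x = integral (cbox a b) (\<lambda>t. L (zero_ext W f (x, t)) * \<theta> k t)"

text \<open>Going up by one in \<open>j\<close> applies \<open>- \<Delta>\<close>; a full block of \<open>m\<close> steps is traded for one more derivative
of the bump, since \<open>(- \<Delta>)\<^sup>m w\<close> is not known to be bounded near the boundary.\<close>

definition avg :: "nat \<Rightarrow> real^'n \<Rightarrow> real" where
  "avg j = avg_of (j div m) (neg_laplace_pow (j mod m) w)"

lemma open_W: "open W" by (rule open_cyl[OF open_\<Omega>])

lemma averaging_time: "t \<in> cbox a b \<Longrightarrow> t \<in> {0<..<T}" using ab by auto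

lemma integrand_cont:
  assumes "continuous_on (D \<times> {0<..<T}) (zero_ext W f)"
  shows "continuous_on (D \<times> cbox a b) (\<lambda>(x, t). L (zero_ext W f (x, t)) * \<theta> k t)"
  unfolding split_beta prod.collapse
  by (intro continuous_intros bounded_linear.continuous_on[OF L] continuous_on_subset[OF assms] continuous_on_compose2[OF \<theta>c])
    (use averaging_time in auto)

lemma integrand_integrable:
  assumes "continuous_on (D \<times> {0<..<T}) (zero_ext W f)" "x \<in> D"
  shows "(\<lambda>t. L (zero_ext W f (x, t)) * \<theta> k t) integrable_on cbox a b"
  using assms(2) by (intro integrable_continuous continuous_on_compose2[OF integrand_cont[OF assms(1), of k], of _ "\<lambda>t. (x, t)", unfolded prod.case] continuous_intros) auto

lemma avg_of_cont:
  assumes "continuous_on (D \<times> {0<..<T}) (zero_ext W f)"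
  shows "continuous_on D (avg_of k f)"
  unfolding avg_of_def[abs_def] by (rule integral_continuous_on_param[OF integrand_cont[OF assms]])

lemma avg_of_partial:
  assumes D: "open D" and f: "continuous_on (D \<times> {0<..<T}) (zero_ext W f)"
    and f': "continuous_on (D \<times> {0<..<T}) (zero_ext W f')"
    and p: "partial_on (D \<times> {0<..<T}) (v, 0) (zero_ext W f) (zero_ext W f')"
  shows "partial_on D v (avg_of k f) (avg_of k f')"
  unfolding partial_on_def
proof
  fix x assume x: "x \<in> D"
  obtain e where e: "e > 0" "\<And>s. \<bar>s\<bar> < e \<Longrightarrow> x + s *\<^sub>R v \<in> D"
    using eventually_on_line[OF D x, of v] by (auto simp: eventually_nhds_metric dist_norm)
  have "((\<lambda>s. integral (cbox a b) (\<lambda>t. L (zero_ext W f (x + s *\<^sub>R v, t)) * \<theta> k t)) has_vector_derivative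
     integral (cbox a b) (\<lambda>t. L (zero_ext W f' (x + 0 *\<^sub>R v, t)) * \<theta> k t)) (at 0 within {-e<..<e})"
  proof (rule leibniz_rule_vector_derivative)
    fix s t assume s: "s \<in> {-e<..<e}" and t: "t \<in> cbox a b"
    have "((\<lambda>s. zero_ext W f ((x, t) + s *\<^sub>R (v, 0))) has_vector_derivative zero_ext W f' ((x, t) + s *\<^sub>R (v, 0))) (at s within {-e<..<e})"
      by (rule partial_on_line[OF p]) (use s t e(2)[of s] averaging_time[OF t] in \<open>auto simp: abs_less_iff\<close>)
    then have "((\<lambda>s. zero_ext W f (x + s *\<^sub>R v, t)) has_vector_derivative zero_ext W f' (x + s *\<^sub>R v, t)) (at s within {-e<..<e})" by simp
    from bounded_linear.has_vector_derivative[OF L this]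
    have "((\<lambda>s. L (zero_ext W f (x + s *\<^sub>R v, t))) has_real_derivative L (zero_ext W f' (x + s *\<^sub>R v, t))) (at s within {-e<..<e})"
      by (simp add: has_real_derivative_iff_has_vector_derivative)
    from DERIV_cmult_right[OF this, of "\<theta> k t"]
    show "((\<lambda>s. L (zero_ext W f (x + s *\<^sub>R v, t)) * \<theta> k t) has_vector_derivative L (zero_ext W f' (x + s *\<^sub>R v, t)) * \<theta> k t) (at s within {-e<..<e})"
      by (simp add: has_real_derivative_iff_has_vector_derivative)
  next
    fix s assume "s \<in> {-e<..<e}"
    then have "x + s *\<^sub>R v \<in> D" using e(2)[of s] by (auto simp: abs_less_iff)
    then show "(\<lambda>t. L (zero_ext W f (x + s *\<^sub>R v, t)) * \<theta> k t) integrable_on cbox a b" by (rule integrand_integrable[OF f])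
  next
    have "continuous_on ({- e<..<e} \<times> cbox a b) (\<lambda>z. (\<lambda>(x, t). L (zero_ext W f' (x, t)) * \<theta> k t) (x + fst z *\<^sub>R v, snd z))"
      by (rule continuous_on_compose2[OF integrand_cont[OF f']]) (use e(2) in \<open>auto intro!: continuous_intros simp: abs_less_iff\<close>)
    then show "continuous_on ({- e<..<e} \<times> cbox a b) (\<lambda>(s, t). L (zero_ext W f' (x + s *\<^sub>R v, t)) * \<theta> k t)"
      by (simp add: split_beta)
  qed (use e in auto)
  then show "((\<lambda>s. avg_of k f (x + s *\<^sub>R v)) has_vector_derivative avg_of k f' x) (at 0)"
    using e(1) by (simp add: avg_of_def at_within_open[of _ "{-e<..<e}"])
qed

lemma avg_of_outside: "x \<notin> \<Omega> \<Longrightarrow> avg_of k f x = 0"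
  using bounded_linear.linear[OF L] by (simp add: avg_of_def zero_ext_def cyl_def linear_0)

lemma avg_of_sum:
  assumes "finite I" "\<And>i. i \<in> I \<Longrightarrow> continuous_on W (f i)" and x: "x \<in> \<Omega>"
  shows "avg_of k (\<lambda>p. \<Sum>i\<in>I. f i p) x = (\<Sum>i\<in>I. avg_of k (f i) x)"
proof -
  have "avg_of k (\<lambda>p. \<Sum>i\<in>I. f i p) x = integral (cbox a b) (\<lambda>t. \<Sum>i\<in>I. L (zero_ext W (f i) (x, t)) * \<theta> k t)"
    unfolding avg_of_def
  proof (rule integral_cong)
    fix t assume "t \<in> cbox a b"
    then have "(x, t) \<in> W" using x averaging_time by (auto simp: cyl_def)
    then show "L (zero_ext W (\<lambda>p. \<Sum>i\<in>I. f i p) (x, t)) * \<theta> k t = (\<Sum>i\<in>I. L (zero_ext W (f i) (x, t)) * \<theta> k t)"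
      using linear_sum[OF bounded_linear.linear[OF L], of "\<lambda>i. f i (x, t)" I] by (simp add: zero_ext_def sum_distrib_right)
  qed
  also have "\<dots> = (\<Sum>i\<in>I. integral (cbox a b) (\<lambda>t. L (zero_ext W (f i) (x, t)) * \<theta> k t))"
  proof (rule integral_sum[OF assms(1)])
    fix i assume "i \<in> I"
    then have "continuous_on (\<Omega> \<times> {0<..<T}) (zero_ext W (f i))"
      using assms(2)[of i] zero_ext_cont_on[of W "f i"] by (simp add: cyl_def)
    then show "(\<lambda>t. L (zero_ext W (f i) (x, t)) * \<theta> k t) integrable_on cbox a b"
      by (rule integrand_integrable) (rule x)
  qed
  finally show ?thesis by (simp add: avg_of_def)
qed

lemma avg_of_minus: "avg_of k (\<lambda>p. - f p) x = - avg_of k f x"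
proof -
  have "L (zero_ext W (\<lambda>p. - f p) q) = - L (zero_ext W f q)" for q
    using linear_neg[OF bounded_linear.linear[OF L]] linear_0[OF bounded_linear.linear[OF L]] by (simp add: zero_ext_def)
  then show ?thesis by (simp add: avg_of_def)
qed

text \<open>By the equation, \<open>(- \<Delta>)\<^sup>m w = - \<partial>\<^sub>t w\<close>; integration by parts moves the time derivative to the
bump.\<close>

lemma avg_of_time_derivative:
  assumes x: "x \<in> \<Omega>"
  shows "avg_of k (neg_laplace_pow m w) x = avg_of (Suc k) w x"
proof -
  have inW: "(x, t) \<in> W" if "t \<in> {a..b}" for t using x averaging_time[of t] that by (auto simp: cyl_def)
  have wc: "continuous_on W w" using smooth_zero_ext_cont[OF Cw] by (simp add: zero_ext_cont_on)
  have Nc: "continuous_on W (neg_laplace_pow m w)"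
    using smooth_zero_ext_cont[OF smooth_zero_ext_neg_laplace_pow[OF open_W, of 0 m W w]] Cw by (simp add: zero_ext_cont_on del: smooth_zero_ext.simps)
  have sc: "continuous_on {a..b} (\<lambda>t. L (f (x, t)))" if "continuous_on W f" for f
    by (intro bounded_linear.continuous_on[OF L] continuous_on_compose2[OF that] continuous_intros) (use inW in auto)
  have prod_int: "((\<lambda>t. L (w (x, t)) * \<theta> (Suc k) t) has_integral integral (cbox a b) (\<lambda>t. L (w (x, t)) * \<theta> (Suc k) t)) {a..b}"
    unfolding cbox_interval[symmetric] by (intro integrable_integral integrable_continuous)
      (auto intro!: continuous_intros sc[OF wc] continuous_on_subset[OF \<theta>c] simp: cbox_interval)
  have "((\<lambda>t. L (dirderiv dir_t w (x, t)) * \<theta> k t) has_integral - integral (cbox a b) (\<lambda>t. L (w (x, t)) * \<theta> (Suc k) t)) {a..b}"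
  proof (rule integration_by_parts_interior[OF bounded_bilinear_mult, where f = "\<lambda>t. L (w (x, t))" and g = "\<theta> k" and g' = "\<theta> (Suc k)"])
    show "a \<le> b" using ab by simp
    show "continuous_on {a..b} (\<lambda>t. L (w (x, t)))" by (rule sc[OF wc])
    show "continuous_on {a..b} (\<theta> k)" by (rule continuous_on_subset[OF \<theta>c]) auto
    fix t assume t: "t \<in> {a<..<b}"
    show "(\<theta> k has_vector_derivative \<theta> (Suc k) t) (at t)"
      using \<theta>d[of t k] t by (simp add: has_real_derivative_iff_has_vector_derivative)
    have "((\<lambda>s. w ((x, 0) + s *\<^sub>R dir_t)) has_vector_derivative dirderiv dir_t w ((x, 0) + t *\<^sub>R dir_t)) (at t)"
      by (rule partial_on_line[OF wt]) (use inW[of t] t in \<open>simp add: dir_t_def\<close>)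
    then have "((\<lambda>s. w (x, s)) has_vector_derivative dirderiv dir_t w (x, t)) (at t)" by (simp add: dir_t_def)
    then show "((\<lambda>s. L (w (x, s))) has_vector_derivative L (dirderiv dir_t w (x, t))) (at t)"
      by (rule bounded_linear.has_vector_derivative[OF L])
  qed (use prod_int \<theta>0 in simp)
  then have "integral (cbox a b) (\<lambda>t. L (dirderiv dir_t w (x, t)) * \<theta> k t) = - integral (cbox a b) (\<lambda>t. L (w (x, t)) * \<theta> (Suc k) t)"
    by (simp add: integral_unique)
  moreover have "integral (cbox a b) (\<lambda>t. L (zero_ext W (neg_laplace_pow m w) (x, t)) * \<theta> k t) = integral (cbox a b) (\<lambda>t. - (L (dirderiv dir_t w (x, t)) * \<theta> k t))"
  proof (rule integral_cong)
    fix t assume "t \<in> cbox a b"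
    then have i: "(x, t) \<in> W" using inW by simp
    have "neg_laplace_pow m w (x, t) = - dirderiv dir_t w (x, t)"
      using eq[OF i] by (simp add: eq_neg_iff_add_eq_0 add.commute)
    then show "L (zero_ext W (neg_laplace_pow m w) (x, t)) * \<theta> k t = - (L (dirderiv dir_t w (x, t)) * \<theta> k t)"
      using linear_neg[OF bounded_linear.linear[OF L]] i by (simp add: zero_ext_def)
  qed
  moreover have "integral (cbox a b) (\<lambda>t. L (zero_ext W w (x, t)) * \<theta> (Suc k) t) = integral (cbox a b) (\<lambda>t. L (w (x, t)) * \<theta> (Suc k) t)"
    by (rule integral_cong) (use inW in \<open>simp add: zero_ext_def\<close>)
  ultimately show ?thesis by (simp add: avg_of_def)
qed

lemma avg_Suc:
  assumes y: "y \<in> \<Omega>"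
  shows "avg (Suc j) y = - (\<Sum>c\<in>Basis. avg_of (j div m) (dirderiv (c, 0) (dirderiv (c, 0) (neg_laplace_pow (j mod m) w))) y)"
proof -
  define q where "q = neg_laplace_pow (j mod m) w"
  have jm: "j mod m < m" using m by simp
  have Cq: "smooth_zero_ext (Suc (Suc 0)) W W (range dir_x) q" unfolding q_def
    by (rule smooth_zero_ext_neg_laplace_pow[OF open_W smooth_zero_ext_mono[OF Cw]]) (use jm in auto)
  have c2: "continuous_on W (dirderiv (dir_x i) (dirderiv (dir_x i) q))" for i
    using Cq by (auto simp: zero_ext_cont_on)
  have "avg_of (j div m) (neg_laplace_pow (Suc (j mod m)) w) y = - avg_of (j div m) (laplace q) y"
    by (simp add: neg_laplace_pow_Suc avg_of_minus q_def)
  also have "avg_of (j div m) (laplace q) y = (\<Sum>i\<in>UNIV. avg_of (j div m) (dirderiv (dir_x i) (dirderiv (dir_x i) q)) y)"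
    unfolding laplace_def[abs_def] by (rule avg_of_sum) (use c2 y in auto)
  also have "\<dots> = (\<Sum>c\<in>Basis. avg_of (j div m) (dirderiv (c, 0) (dirderiv (c, 0) q)) y)"
    by (simp add: sum_Basis_vec dir_x_def)
  finally have "avg_of (j div m) (neg_laplace_pow (Suc (j mod m)) w) y = - (\<Sum>c\<in>Basis. avg_of (j div m) (dirderiv (c, 0) (dirderiv (c, 0) q)) y)" .
  moreover have "avg (Suc j) y = avg_of (j div m) (neg_laplace_pow (Suc (j mod m)) w) y"
  proof (cases "Suc (j mod m) = m")
    case True
    then have "Suc j mod m = 0" "Suc j div m = Suc (j div m)" by (simp_all add: mod_Suc div_Suc)
    then show ?thesis using avg_of_time_derivative[OF y, of "j div m"] True by (simp add: avg_def neg_laplace_pow_0)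
  next
    case False
    then have "Suc j mod m = Suc (j mod m)" "Suc j div m = j div m" by (simp_all add: mod_Suc div_Suc)
    then show ?thesis by (simp add: avg_def)
  qed
  ultimately show ?thesis by (simp add: q_def)
qed

text \<open>Only \<open>(- \<Delta>)\<^sup>i w\<close> with \<open>i < m\<close> and its gradient enter, that is derivatives of order at most \<open>2m - 1\<close>;
extended by zero, these are continuous across the boundary.  The bound by \<open>(2j)!\<close> is inherited from the bump, as the number
\<open>j div m\<close> of its derivatives is at most \<open>j\<close>.  The factor \<open>16\<close> arises when \<open>(2 (i + j))!\<close> is split into
\<open>(2i)! (2j)!\<close>.\<close>

lemma avg_chain:
  assumes osd: "one_sided_domain D (\<Omega> \<inter> D) d d' b0 \<sigma> C"
    and ext: "smooth_zero_ext (2 * m - 1) W (D \<times> {0<..<T}) (range dir_x) w"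
    and K: "compact K" "K \<subseteq> D" and D': "open D'" "D' \<subseteq> K"
    and osd': "one_sided_domain D' (\<Omega> \<inter> D') d d' b0 \<sigma> C"
  shows "laplace_chain D' avg 16"
proof
  define X where "X = D' \<times> {0<..<T}"
  have XD: "X \<subseteq> D \<times> {0<..<T}" using K D' by (auto simp: X_def)
  have openX: "open X" using D' by (auto simp: X_def intro: open_Times)
  have CqD: "smooth_zero_ext (Suc 0) W (D \<times> {0<..<T}) (range dir_x) (neg_laplace_pow i w)" if "i < m" for i
    by (rule smooth_zero_ext_neg_laplace_pow[OF open_W smooth_zero_ext_mono[OF ext]]) (use that in auto)
  have Cq: "smooth_zero_ext (Suc 0) W X (range dir_x) (neg_laplace_pow i w)" if "i < m" for i
    by (rule smooth_zero_ext_subset[OF CqD[OF that] XD])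
  have Cq2: "smooth_zero_ext (Suc (Suc 0)) W W (range dir_x) (neg_laplace_pow i w)" if "i < m" for i
    by (rule smooth_zero_ext_neg_laplace_pow[OF open_W smooth_zero_ext_mono[OF Cw]]) (use that in auto)
  have jm: "j mod m < m" for j using m by simp
  show "open D'" by (rule D')
  show "(0::real) < 16" by simp
  show cont: "continuous_on D' (avg j)" for j
    unfolding avg_def by (rule avg_of_cont) (use smooth_zero_ext_cont[OF Cq[OF jm]] in \<open>simp add: X_def\<close>)
  show "weak_poisson D' (avg j) (avg (Suc j))" for j
  proof -
    define q where "q = neg_laplace_pow (j mod m) w"
    have v: "(c, 0) \<in> range dir_x" if "c \<in> Basis" for c :: "real^'n" using that by (auto simp: range_dir_x)
    have q1: "smooth_zero_ext (Suc 0) W X (range dir_x) q" "smooth_zero_ext (Suc (Suc 0)) W W (range dir_x) q" unfolding q_def using Cq[OF jm] Cq2[OF jm] .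
    have q1': "continuous_on X (zero_ext W q)" "c \<in> Basis \<Longrightarrow> continuous_on X (zero_ext W (dirderiv (c, 0) q))" for c
      using q1(1) v[of c] by auto
    have q2: "partial_on W (c, 0) (dirderiv (c, 0) q) (dirderiv (c, 0) (dirderiv (c, 0) q))"
      "continuous_on W (zero_ext W (dirderiv (c, 0) q))" "continuous_on W (zero_ext W (dirderiv (c, 0) (dirderiv (c, 0) q)))" if "c \<in> Basis" for c
      using q1(2) v[OF that] by auto
    have X2: "(\<Omega> \<inter> D') \<times> {0<..<T} \<subseteq> W" by (auto simp: cyl_def)
    show ?thesis
    proof (rule one_sided_domain.weak_poissonI[OF osd', where F' = "\<lambda>c. avg_of (j div m) (dirderiv (c, 0) q)"
          and F'' = "\<lambda>c. avg_of (j div m) (dirderiv (c, 0) (dirderiv (c, 0) q))"])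
      show "continuous_on D' (avg j)" by (rule cont)
      show "continuous_on D' (avg (Suc j))" by (rule cont)
      show "partial_on D' c (avg j) (avg_of (j div m) (dirderiv (c, 0) q))" if "c \<in> Basis" for c
        unfolding avg_def q_def[symmetric]
        by (rule avg_of_partial[OF D'(1)])
          (use q1' zero_ext_partial[OF open_W openX q1(1) v[OF that]] that in \<open>simp_all add: X_def\<close>)
      show "continuous_on D' (avg_of (j div m) (dirderiv (c, 0) q))" if "c \<in> Basis" for c
        by (rule avg_of_cont) (use q1'(2)[OF that] in \<open>simp add: X_def\<close>)
      show "avg_of (j div m) (dirderiv (c, 0) q) y = 0" if "y \<in> D'" "y \<notin> \<Omega> \<inter> D'" for c y
        using that by (simp add: avg_of_outside)
      show "avg (Suc j) y = 0" if "y \<in> D'" "y \<notin> \<Omega> \<inter> D'" for y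
        using that by (simp add: avg_def avg_of_outside)
      show "partial_on (\<Omega> \<inter> D') c (avg_of (j div m) (dirderiv (c, 0) q)) (avg_of (j div m) (dirderiv (c, 0) (dirderiv (c, 0) q)))" if "c \<in> Basis" for c
      proof (rule avg_of_partial)
        show "open (\<Omega> \<inter> D')" using open_\<Omega> D' by auto
        have "partial_on W (c, 0) (zero_ext W (dirderiv (c, 0) q)) (zero_ext W (dirderiv (c, 0) (dirderiv (c, 0) q)))"
          by (rule partial_on_transform[OF q2(1)[OF that] open_W]) (auto simp: zero_ext_def)
        then show "partial_on ((\<Omega> \<inter> D') \<times> {0<..<T}) (c, 0) (zero_ext W (dirderiv (c, 0) q)) (zero_ext W (dirderiv (c, 0) (dirderiv (c, 0) q)))"
          by (rule partial_on_subset[OF _ X2])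
      qed (rule continuous_on_subset[OF _ X2], rule q2[OF that])+
      show "continuous_on (\<Omega> \<inter> D') (avg_of (j div m) (dirderiv (c, 0) (dirderiv (c, 0) q)))" if "c \<in> Basis" for c
        by (rule avg_of_cont) (rule continuous_on_subset[OF q2(3)[OF that] X2])
      show "avg (Suc j) y = - (\<Sum>c\<in>Basis. avg_of (j div m) (dirderiv (c, 0) (dirderiv (c, 0) q)) y)" if "y \<in> \<Omega> \<inter> D'" for y
        using avg_Suc[of y j] that by (simp add: q_def)
    qed
  qed
  show "\<exists>B. \<forall>j. \<forall>y\<in>D'. \<bar>avg (i + j) y\<bar> \<le> B * 16 ^ j * fact (2 * j)" for i
  proof -
    have cK: "compact (K \<times> cbox a b)" by (intro compact_Times K compact_cbox)
    have KX: "K \<times> cbox a b \<subseteq> D \<times> {0<..<T}" using K averaging_time by auto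
    have "\<exists>M. \<forall>p\<in>K \<times> cbox a b. \<bar>L (zero_ext W (neg_laplace_pow i w) p)\<bar> \<le> M" if "i < m" for i
    proof -
      have "continuous_on (K \<times> cbox a b) (\<lambda>p. L (zero_ext W (neg_laplace_pow i w) p))"
        by (intro bounded_linear.continuous_on[OF L] continuous_on_subset[OF smooth_zero_ext_cont[OF CqD[OF that]] KX])
      from compact_imp_bounded[OF compact_continuous_image[OF this cK]] show ?thesis by (auto simp: bounded_iff)
    qed
    then obtain M where M: "\<And>i p. i < m \<Longrightarrow> p \<in> K \<times> cbox a b \<Longrightarrow> \<bar>L (zero_ext W (neg_laplace_pow i w) p)\<bar> \<le> M i" by metis
    define M' where "M' = (\<Sum>i<m. \<bar>M i\<bar>)"
    have MM: "M i \<le> M'" if "i < m" for i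
      using member_le_sum[of i "{..<m}" "\<lambda>i. \<bar>M i\<bar>"] that by (force simp: M'_def)
    have M'0: "M' \<ge> 0" by (simp add: M'_def sum_nonneg)
    have bd: "\<bar>avg j y\<bar> \<le> M' * (b - a) * (4 ^ j * fact (2 * j))" if y: "y \<in> D'" for j y
    proof -
      have "norm (integral (cbox a b) (\<lambda>t. L (zero_ext W (neg_laplace_pow (j mod m) w) (y, t)) * \<theta> (j div m) t)) \<le> M' * (4 ^ j * fact (2 * j)) * measure lborel (cbox a b)"
      proof (rule has_integral_bound[OF _ integrable_integral])
        show "0 \<le> M' * (4 ^ j * fact (2 * j))" using M'0 by simp
        show "(\<lambda>t. L (zero_ext W (neg_laplace_pow (j mod m) w) (y, t)) * \<theta> (j div m) t) integrable_on cbox a b"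
          by (rule integrand_integrable[OF smooth_zero_ext_cont[OF CqD[OF jm]]]) (use y D' K in auto)
        fix t assume t: "t \<in> cbox a b"
        have yt: "(y, t) \<in> K \<times> cbox a b" using y D' t by auto
        have 1: "\<bar>L (zero_ext W (neg_laplace_pow (j mod m) w) (y, t))\<bar> \<le> M'"
          by (rule order_trans[OF M[OF jm yt] MM[OF jm]])
        have kj: "j div m \<le> j" by simp
        have "\<bar>\<theta> (j div m) t\<bar> \<le> 4 ^ (j div m) * fact (2 * (j div m))" by (rule \<theta>b)
        also have "\<dots> \<le> 4 ^ j * fact (2 * j)"
          using kj by (intro mult_mono power_increasing fact_mono) auto
        finally show "norm (L (zero_ext W (neg_laplace_pow (j mod m) w) (y, t)) * \<theta> (j div m) t) \<le> M' * (4 ^ j * fact (2 * j))"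
          using 1 M'0 by (simp add: abs_mult mult_mono)
      qed
      then show ?thesis using ab by (simp add: avg_def avg_of_def mult_ac)
    qed
    have "\<bar>avg (i + j) y\<bar> \<le> (M' * (b - a) * (16 ^ i * fact (2 * i))) * 16 ^ j * fact (2 * j)" if y: "y \<in> D'" for j y
    proof -
      have "\<bar>avg (i + j) y\<bar> \<le> M' * (b - a) * (4 ^ (i + j) * fact (2 * (i + j)))" by (rule bd[OF y])
      also have "\<dots> \<le> M' * (b - a) * (4 ^ (i + j) * (4 ^ (i + j) * (fact (2 * i) * fact (2 * j))))"
        using M'0 ab by (intro mult_left_mono fact_add_le) auto
      also have "\<dots> = M' * (b - a) * ((4 * 4) ^ (i + j) * (fact (2 * i) * fact (2 * j)))"
        by (simp only: power_mult_distrib mult.assoc)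
      also have "\<dots> = (M' * (b - a) * (16 ^ i * fact (2 * i))) * 16 ^ j * fact (2 * j)" by (simp add: power_add)
      finally show ?thesis .
    qed
    then show ?thesis by blast
  qed
qed

end

section \<open>Uniqueness\<close>

lemma one_sided_domain_subset:
  assumes "one_sided_domain D \<Omega>' d d' b0 \<sigma> C" "open D'" "D' \<subseteq> D"
  shows "one_sided_domain D' (\<Omega>' \<inter> D') d d' b0 \<sigma> C"
proof -
  interpret one_sided_domain D \<Omega>' d d' b0 \<sigma> C by fact
  show ?thesis
    by unfold_locales (use assms(2,3) O_def b0 \<sigma> C0 dom in
      \<open>auto intro: continuous_on_subset[OF dc] continuous_on_subset[OF d'c] partial_on_subset[OF dd]\<close>)
qed

text \<open>Near \<open>z\<close> the set \<open>\<Omega>\<close> is one-sided and \<open>w\<close>, extended by zero, keeps its space derivatives up to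
order \<open>2m - 1\<close>.  The point \<open>z\<close> may lie in \<open>\<Omega>\<close> or on its boundary.\<close>

definition continuable_at :: "(real^'n) set \<Rightarrow> real \<Rightarrow> nat \<Rightarrow> ((real^'n) \<times> real \<Rightarrow> complex) \<Rightarrow> real^'n \<Rightarrow> bool" where
  "continuable_at \<Omega> T m w z \<longleftrightarrow> (\<exists>R d d' b0 \<sigma> C. R > 0 \<and> one_sided_domain (ball z R) (\<Omega> \<inter> ball z R) d d' b0 \<sigma> C \<and>
     smooth_zero_ext (2 * m - 1) (cyl \<Omega> T) (ball z R \<times> {0<..<T}) (range dir_x) w)"

lemma (in parabolic_solution) continuable_interior:
  assumes "z \<in> \<Omega>"
  shows "continuable_at \<Omega> T m w z"
proof -
  obtain R where R: "R > 0" "ball z R \<subseteq> \<Omega>" using open_\<Omega> assms openE by blast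
  obtain b0 :: "real^'n" where b0: "b0 \<in> Basis" using nonempty_Basis by blast
  have "one_sided_domain (ball z R) (\<Omega> \<inter> ball z R) (\<lambda>y. - 1) (\<lambda>b y. 0) b0 1 0"
    by unfold_locales (use R b0 in \<open>auto simp: partial_on_def\<close>)
  moreover have "smooth_zero_ext (2 * m - 1) (cyl \<Omega> T) (ball z R \<times> {0<..<T}) (range dir_x) w"
    by (rule smooth_zero_ext_subset[OF smooth_zero_ext_mono[OF Cw]]) (use R in \<open>auto simp: cyl_def\<close>)
  ultimately show ?thesis using R(1) unfolding continuable_at_def by blast
qed

context time_average
begin

text \<open>The radius \<open>r\<close> depends on \<open>z\<close> alone: vanishing near any point \<open>c\<close> of \<open>ball z r\<close> spreads to
\<open>ball c r\<close>, which contains \<open>z\<close>.\<close>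

lemma avg_zero_spread:
  assumes "continuable_at \<Omega> T m w z"
  obtains r where "r > 0"
    "\<And>c \<epsilon> j y. c \<in> ball z r \<Longrightarrow> \<epsilon> > 0 \<Longrightarrow> (\<And>j y. y \<in> ball c \<epsilon> \<Longrightarrow> avg j y = 0) \<Longrightarrow> y \<in> ball c r \<Longrightarrow> avg j y = 0"
proof -
  obtain R d d' b0 \<sigma> C where R: "R > 0" and osd: "one_sided_domain (ball z R) (\<Omega> \<inter> ball z R) d d' b0 \<sigma> C"
    and ext: "smooth_zero_ext (2 * m - 1) W (ball z R \<times> {0<..<T}) (range dir_x) w"
    using assms unfolding continuable_at_def by blast
  define D' where "D' = ball z (R / 2)"
  have sub: "D' \<subseteq> ball z R" "cball z (R / 2) \<subseteq> ball z R" "D' \<subseteq> cball z (R / 2)" using R by (auto simp: D'_def)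
  have "(\<Omega> \<inter> ball z R) \<inter> D' = \<Omega> \<inter> D'" using sub by auto
  then have osd': "one_sided_domain D' (\<Omega> \<inter> D') d d' b0 \<sigma> C"
    using one_sided_domain_subset[OF osd _ sub(1)] by (simp add: D'_def)
  interpret laplace_chain D' avg 16
    by (rule avg_chain[OF osd ext compact_cball sub(2) _ sub(3) osd']) (simp add: D'_def)
  define E where "E = 16 * exp (real DIM(real^'n))"
  have E: "E > 0" by (simp add: E_def)
  define r where "r = min (R / 8) (1 / sqrt (2 * E))"
  have r: "r > 0" "r \<le> R / 8" using R E by (auto simp: r_def)
  have "r\<^sup>2 \<le> (1 / sqrt (2 * E))\<^sup>2" using r(1) by (intro power_mono) (auto simp: r_def)
  also have "\<dots> = 1 / (2 * E)" using E by (simp add: power_divide)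
  finally have "E * r\<^sup>2 \<le> 1 / 2" using E by (simp add: field_simps)
  then have small: "16 * exp (real DIM(real^'n)) * r\<^sup>2 < 1" by (simp add: E_def)
  show ?thesis
  proof (rule that[OF r(1)])
    fix c \<epsilon> j y assume c: "c \<in> ball z r" and e: "\<epsilon> > 0" and zero: "\<And>j y. y \<in> ball c \<epsilon> \<Longrightarrow> avg j y = 0" and y: "y \<in> ball c r"
    have "cball c (2 * r) \<subseteq> D'"
    proof
      fix y assume "y \<in> cball c (2 * r)"
      then have "dist z y \<le> dist z c + 2 * r" using dist_triangle[of z y c] by simp
      then show "y \<in> D'" using c r R by (simp add: D'_def)
    qed
    from zero_ball_full[OF this small e r(1) zero y] show "avg j y = 0" .
  qed
qed

text \<open>Outside \<open>\<Omega>\<close> the averages vanish by definition, hence they vanish near the boundary point \<open>z\<close> and so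
somewhere in \<open>\<Omega>\<close>.  By \<open>avg_zero_spread\<close> the set of points of \<open>\<Omega>\<close> near which they vanish is relatively
closed, and \<open>\<Omega>\<close> is connected.\<close>

lemma avg_zero:
  assumes conn: "connected \<Omega>" and z: "continuable_at \<Omega> T m w z" "z \<in> frontier \<Omega>"
    and ext: "\<And>r. r > 0 \<Longrightarrow> \<exists>c\<in>ball z r. c \<notin> closure \<Omega>" and x: "x \<in> \<Omega>"
  shows "avg j x = 0"
proof -
  define Z where "Z = {c. \<exists>\<epsilon>>0. \<forall>j. \<forall>y\<in>ball c \<epsilon>. avg j y = 0}"
  have openZ: "open Z"
    unfolding open_contains_ball
  proof
    fix c assume "c \<in> Z"
    then obtain \<epsilon> where e: "\<epsilon> > 0" "\<And>j y. y \<in> ball c \<epsilon> \<Longrightarrow> avg j y = 0" by (auto simp: Z_def)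
    have "ball c \<epsilon> \<subseteq> Z"
    proof
      fix y assume y: "y \<in> ball c \<epsilon>"
      obtain \<delta> where "\<delta> > 0" "ball y \<delta> \<subseteq> ball c \<epsilon>" using openE[OF open_ball y] by blast
      then show "y \<in> Z" using e(2) unfolding Z_def by blast
    qed
    then show "\<exists>e>0. ball c e \<subseteq> Z" using e(1) by blast
  qed
  have spread: "\<exists>r>0. \<forall>c\<in>ball z r. c \<in> Z \<longrightarrow> ball c r \<subseteq> Z" if cz: "continuable_at \<Omega> T m w z" for z
  proof -
    obtain r where r: "r > 0" "\<And>c \<epsilon> j y. c \<in> ball z r \<Longrightarrow> \<epsilon> > 0 \<Longrightarrow> (\<And>j y. y \<in> ball c \<epsilon> \<Longrightarrow> avg j y = 0) \<Longrightarrow> y \<in> ball c r \<Longrightarrow> avg j y = 0"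
      by (rule avg_zero_spread[OF cz]) blast
    have "ball c r \<subseteq> Z" if c: "c \<in> ball z r" "c \<in> Z" for c
    proof
      fix y assume y: "y \<in> ball c r"
      obtain \<delta> where d: "\<delta> > 0" "ball y \<delta> \<subseteq> ball c r" using openE[OF open_ball y] by blast
      obtain \<epsilon> where e: "\<epsilon> > 0" "\<And>j y. y \<in> ball c \<epsilon> \<Longrightarrow> avg j y = 0" using c(2) by (auto simp: Z_def)
      have "avg j y' = 0" if "y' \<in> ball y \<delta>" for j y'
        by (rule r(2)[OF c(1) e]) (use that d(2) in auto)
      then show "y \<in> Z" using d(1) unfolding Z_def by blast
    qed
    then show ?thesis using r(1) by blast
  qed
  have outside: "c \<in> Z" if cn: "c \<notin> closure \<Omega>" for c
  proof -
    have o: "open (- closure \<Omega>)" "c \<in> - closure \<Omega>" using cn by auto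
    obtain \<epsilon> where e: "\<epsilon> > 0" "ball c \<epsilon> \<subseteq> - closure \<Omega>" by (rule openE[OF o])
    have "avg j y = 0" if "y \<in> ball c \<epsilon>" for j y
    proof -
      have "y \<notin> \<Omega>" using that e(2) closure_subset[of \<Omega>] by auto
      then show ?thesis by (simp add: avg_def avg_of_outside)
    qed
    then show ?thesis using e(1) unfolding Z_def by blast
  qed
  have ne: "\<Omega> \<inter> Z \<noteq> {}"
  proof -
    obtain r where r: "r > 0" "\<And>c. c \<in> ball z r \<Longrightarrow> c \<in> Z \<Longrightarrow> ball c r \<subseteq> Z" using spread[OF z(1)] by blast
    obtain c where c: "c \<in> ball z r" "c \<notin> closure \<Omega>" using ext[OF r(1)] by blast
    have "z \<in> Z" using r(2)[OF c(1) outside[OF c(2)]] c(1) by (auto simp: dist_commute)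
    then show ?thesis using z(2) openZ open_Int_closure_eq_empty[of Z \<Omega>] by (auto simp: frontier_def)
  qed
  define N where "N = (\<Union>z\<in>\<Omega> - Z. ball z (SOME r. r > 0 \<and> (\<forall>c\<in>ball z r. c \<in> Z \<longrightarrow> ball c r \<subseteq> Z)))"
  have N: "open N" "\<Omega> - Z \<subseteq> N" "N \<inter> Z = {}"
  proof -
    define \<rho> where "\<rho> z = (SOME r. r > 0 \<and> (\<forall>c\<in>ball z r. c \<in> Z \<longrightarrow> ball c r \<subseteq> Z))" for z
    have \<rho>: "\<rho> z > 0 \<and> (\<forall>c\<in>ball z (\<rho> z). c \<in> Z \<longrightarrow> ball c (\<rho> z) \<subseteq> Z)" if "z \<in> \<Omega>" for z
      unfolding \<rho>_def by (rule someI_ex) (use spread[OF continuable_interior[OF that]] in blast)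
    have NN: "N = (\<Union>z\<in>\<Omega> - Z. ball z (\<rho> z))" by (simp add: N_def \<rho>_def)
    show "open N" unfolding NN by auto
    show "\<Omega> - Z \<subseteq> N" unfolding NN using \<rho> by force
    show "N \<inter> Z = {}"
    proof (rule ccontr)
      assume "N \<inter> Z \<noteq> {}"
      then obtain c z where cz: "c \<in> Z" "z \<in> \<Omega>" "z \<notin> Z" "c \<in> ball z (\<rho> z)" unfolding NN by blast
      then have "ball c (\<rho> z) \<subseteq> Z" using \<rho> by blast
      moreover have "z \<in> ball c (\<rho> z)" using cz(4) by (simp add: dist_commute)
      ultimately show False using cz(3) by blast
    qed
  qed
  have "\<Omega> \<subseteq> Z"
  proof (rule ccontr)
    assume "\<not> \<Omega> \<subseteq> Z"
    then have "N \<inter> \<Omega> \<noteq> {}" using N(2) by blast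
    moreover have "\<Omega> \<subseteq> N \<union> Z" using N(2) by blast
    ultimately show False using connectedD[OF conn N(1) openZ] N(3) ne by blast
  qed
  then obtain \<epsilon> where "\<epsilon> > 0" "\<And>j y. y \<in> ball x \<epsilon> \<Longrightarrow> avg j y = 0" using x unfolding Z_def by blast
  then show ?thesis by simp
qed

end

text \<open>If \<open>L w\<close> did not vanish at \<open>(x, t0)\<close>, it would have a constant sign on a short time interval
around \<open>t0\<close>, and so would its average against a positive bump on this interval.\<close>

lemma (in parabolic_solution) solution_zero:
  assumes conn: "connected \<Omega>" and z: "continuable_at \<Omega> T m w z" "z \<in> frontier \<Omega>"
    and ext: "\<And>r. r > 0 \<Longrightarrow> \<exists>c\<in>ball z r. c \<notin> closure \<Omega>" and p: "p \<in> cyl \<Omega> T"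
    and L: "bounded_linear L"
  shows "L (w p) = (0::real)"
proof (rule ccontr)
  assume ne: "L (w p) \<noteq> 0"
  obtain x t0 where pxt: "p = (x, t0)" by (cases p)
  have x: "x \<in> \<Omega>" and t0: "0 < t0" "t0 < T" using p by (auto simp: pxt cyl_def)
  have wc: "continuous_on (cyl \<Omega> T) w" using smooth_zero_ext_cont[OF Cw] by (simp add: zero_ext_cont_on)
  define s where "s = sgn (L (w p))"
  define h where "h t = s * L (w (x, t))" for t
  have hc: "continuous_on {0<..<T} h" unfolding h_def
    by (intro continuous_intros bounded_linear.continuous_on[OF L] continuous_on_compose2[OF wc]) (auto simp: cyl_def x)
  have h0: "h t0 > 0" using ne by (simp add: h_def s_def pxt[symmetric] sgn_if)
  have "isCont h t0" using hc t0 by (simp add: continuous_on_eq_continuous_at)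
  then have "(h \<longlongrightarrow> h t0) (nhds t0)" by (simp add: isCont_def tendsto_at_iff_tendsto_nhds)
  then have "eventually (\<lambda>t. h t > 0 \<and> t \<in> {0<..<T}) (nhds t0)"
    using t0 by (intro eventually_conj order_tendstoD(1)[OF _ h0] eventually_nhds_in_open) auto
  then obtain e where e: "e > 0" "\<And>t. dist t t0 < e \<Longrightarrow> h t > 0 \<and> t \<in> {0<..<T}" unfolding eventually_nhds_metric by blast
  define a where "a = t0 - e / 2"
  define b where "b = t0 + e / 2"
  have at0b: "a < t0" "t0 < b" "a < b" using e(1) by (auto simp: a_def b_def)
  have hab: "h t > 0" "0 < t" "t < T" if "t \<in> {a..b}" for t
    using e(2)[of t] e(1) that by (auto simp: a_def b_def dist_real_def abs_less_iff)
  obtain \<theta> :: "nat \<Rightarrow> real \<Rightarrow> real" where \<theta>: "\<And>k. continuous_on UNIV (\<theta> k)" "\<And>k. \<theta> k a = 0" "\<And>k. \<theta> k b = 0"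
    "\<And>k t. a < t \<Longrightarrow> t < b \<Longrightarrow> (\<theta> k has_real_derivative \<theta> (Suc k) t) (at t)"
    "\<And>k t. \<bar>\<theta> k t\<bar> \<le> 4 ^ k * fact (2 * k)" "\<And>t. a < t \<Longrightarrow> t < b \<Longrightarrow> \<theta> 0 t > 0"
    using gevrey_bump[OF at0b(3)] by blast
  interpret time_average \<Omega> T m w a b \<theta> L
    by (intro time_average.intro time_average_axioms.intro parabolic_solution_axioms L \<theta>)
      (use hab(2)[of a] hab(3)[of b] at0b in auto)
  have "avg 0 x = 0" by (rule avg_zero[OF conn z ext x])
  then have I0: "integral (cbox a b) (\<lambda>t. L (zero_ext W w (x, t)) * \<theta> 0 t) = 0"
    using m by (simp add: avg_def avg_of_def neg_laplace_pow_0)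
  have c: "continuous_on (cbox a b) (\<lambda>t. h t * \<theta> 0 t)"
    by (intro continuous_intros continuous_on_subset[OF hc] continuous_on_subset[OF \<theta>(1)]) (use hab in auto)
  have "integral (cbox a b) (\<lambda>t. h t * \<theta> 0 t) = integral (cbox a b) (\<lambda>t. s * (L (zero_ext W w (x, t)) * \<theta> 0 t))"
    by (intro integral_cong) (use hab x in \<open>auto simp: h_def zero_ext_def cyl_def\<close>)
  also have "\<dots> = s * integral (cbox a b) (\<lambda>t. L (zero_ext W w (x, t)) * \<theta> 0 t)" by (rule integral_mult_right)
  finally have "integral (cbox a b) (\<lambda>t. h t * \<theta> 0 t) = 0" unfolding I0 by simp
  then have hi: "((\<lambda>t. h t * \<theta> 0 t) has_integral 0) (cbox a b)"
    using integrable_integral[OF integrable_continuous[OF c]] by simp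
  have "h t0 * \<theta> 0 t0 = 0"
  proof (rule has_integral_0_cbox_imp_0[OF c _ hi])
    show "0 \<le> h t * \<theta> 0 t" if "t \<in> box a b" for t
      using hab(1)[of t] \<theta>(6)[of t] that by auto
    show "box a b \<noteq> {}" "t0 \<in> cbox a b" using at0b by auto
  qed
  then show False using h0 \<theta>(6)[OF at0b(1,2)] by simp
qed

text \<open>Close to a smooth boundary point some partial derivative \<open>\<sigma> \<partial>\<^bsub>b0\<^esub> \<phi>\<close> of the defining function is bounded away
from zero and so dominates the others.  The continuous extensions \<open>H\<close> of the derivatives vanish on
\<open>\<Gamma>\<close>, so they fit together with zero outside \<open>\<Omega>\<close>.\<close>

lemma continuable_boundary_point:
  fixes \<Omega> \<Gamma> :: "(real^'n) set"
  assumes O: "open \<Omega>" and \<Gamma>: "openin (top_of_set (frontier \<Omega>)) \<Gamma>" and x: "x \<in> \<Gamma> \<inter> smooth_boundary_part \<Omega>"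
    and k: "k = 2 * m - 1"
    and words: "\<And>ws. length ws \<le> k \<Longrightarrow> cont_deriv (cyl \<Omega> T) (map dir_x ws) w"
    and Hc: "\<And>ws. length ws \<le> k \<Longrightarrow> continuous_on (cyl (\<Omega> \<union> closure \<Gamma>) T) (H ws)"
    and Hw: "\<And>ws p. length ws \<le> k \<Longrightarrow> p \<in> cyl \<Omega> T \<Longrightarrow> H ws p = foldr dirderiv (map dir_x ws) w p"
    and Hz: "\<And>ws x t. length ws \<le> k \<Longrightarrow> x \<in> \<Gamma> \<inter> smooth_boundary_part \<Omega> \<Longrightarrow> 0 < t \<Longrightarrow> t < T \<Longrightarrow> H ws (x, t) = 0"
  shows "continuable_at \<Omega> T m w x" and "\<And>r. r > 0 \<Longrightarrow> \<exists>c\<in>ball x r. c \<notin> closure \<Omega>"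
proof -
  have xf: "x \<in> frontier \<Omega>" using x by (simp add: smooth_boundary_part_def)
  obtain U0 \<phi> where ld0: "local_defining \<Omega> x U0 \<phi>" using x by (auto simp: smooth_boundary_part_def)
  obtain N where N: "open N" "\<Gamma> = frontier \<Omega> \<inter> N" using \<Gamma> by (auto simp: openin_open)
  define U where "U = U0 \<inter> N"
  have ld: "local_defining \<Omega> x U \<phi>" unfolding U_def
    by (rule local_defining_restrict[OF ld0 N(1)]) (use ld0 x N in \<open>auto simp: local_defining_def\<close>)
  have Ub: "y \<in> \<Gamma> \<inter> smooth_boundary_part \<Omega>" if "y \<in> frontier \<Omega> \<inter> U" for y
  proof -
    have "local_defining \<Omega> y U \<phi>" unfolding U_def
      by (rule local_defining_restrict[OF ld0 N(1)]) (use that in \<open>auto simp: U_def\<close>)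
    then show ?thesis using that N by (auto simp: U_def smooth_boundary_part_def)
  qed
  have U: "open U" "x \<in> U" "smooth_fun_on U \<phi>" "\<Omega> \<inter> U = {y \<in> U. \<phi> y < 0}" "frontier \<Omega> \<inter> U = {y \<in> U. \<phi> y = 0}"
    using ld by (auto simp: local_defining_def)
  define p where "p = gradient \<phi> x"
  have p0: "p \<noteq> 0" and \<phi>x: "\<phi> x = 0" using local_defining_zero[OF ld xf] by (auto simp: p_def)
  show "\<exists>c\<in>ball x r. c \<notin> closure \<Omega>" if r: "r > 0" for r
  proof -
    have D: "((\<lambda>s. \<phi> (x + s *\<^sub>R p)) has_real_derivative p \<bullet> p) (at 0)"
      unfolding has_real_derivative_iff_has_vector_derivative
      using has_derivative_along_line[of \<phi> _ x 0 p] local_defining_derivative[OF ld U(2)] by (simp add: p_def)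
    obtain e1 where e1: "e1 > 0" "\<And>h. h > 0 \<Longrightarrow> h < e1 \<Longrightarrow> \<phi> (x + h *\<^sub>R p) > 0"
      using DERIV_pos_inc_right[OF D] p0 \<phi>x by auto
    obtain e2 where e2: "e2 > 0" "\<And>h. \<bar>h\<bar> < e2 \<Longrightarrow> x + h *\<^sub>R p \<in> U \<inter> ball x r"
      using eventually_on_line[of "U \<inter> ball x r" x p] U r by (auto simp: eventually_nhds_metric dist_norm)
    define h where "h = min e1 e2 / 2"
    have h: "h > 0" "h < e1" "\<bar>h\<bar> < e2" using e1 e2 by (auto simp: h_def)
    have "x + h *\<^sub>R p \<notin> \<Omega> \<union> frontier \<Omega>"
      using e1(2)[OF h(1,2)] e2(2)[OF h(3)] U(4,5) by force
    then have "x + h *\<^sub>R p \<notin> closure \<Omega>" by (simp add: closure_Un_frontier)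
    then show ?thesis using e2(2)[OF h(3)] by blast
  qed
  have dx: "p $ i = dirderiv (axis i 1) \<phi> x" for i by (simp add: p_def gradient_def)
  obtain i0 where i0: "p $ i0 \<noteq> 0" using p0 by (metis vec_eq_iff zero_index)
  define b0 :: "real^'n" where "b0 = axis i0 1"
  have b0: "b0 \<in> Basis" by (auto simp: b0_def Basis_vec_eq)
  define A0 where "A0 = \<bar>dirderiv b0 \<phi> x\<bar>"
  have A0: "A0 > 0" using i0 by (simp add: A0_def b0_def dx)
  define \<sigma> where "\<sigma> = sgn (dirderiv b0 \<phi> x)"
  have \<sigma>: "\<bar>\<sigma>\<bar> = 1" "\<sigma> * dirderiv b0 \<phi> x = A0" using A0 by (auto simp: \<sigma>_def A0_def sgn_if)
  define S where "S = (\<Sum>b\<in>Basis. \<bar>dirderiv b \<phi> x\<bar>) + 1"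
  have S0: "S > 0" by (simp add: S_def sum_nonneg add_nonneg_pos)
  have lim: "((\<lambda>y. dirderiv b \<phi> y) \<longlongrightarrow> dirderiv b \<phi> x) (nhds x)" if "b \<in> Basis" for b
    using smooth_fun_on_partial(2)[OF U(3) that] U(1,2)
    by (simp add: continuous_on_eq_continuous_at isCont_def tendsto_at_iff_tendsto_nhds)
  have ev1: "\<forall>\<^sub>F y in nhds x. \<sigma> * dirderiv b0 \<phi> y > A0 / 2"
    using A0 \<sigma> by (intro order_tendstoD(1)[OF tendsto_mult_left[OF lim[OF b0], of \<sigma>]]) simp
  have ev2: "\<forall>\<^sub>F y in nhds x. \<bar>dirderiv b \<phi> y\<bar> < S" if "b \<in> Basis" for b
  proof (rule order_tendstoD(2)[OF tendsto_rabs[OF lim[OF that]]])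
    show "\<bar>dirderiv b \<phi> x\<bar> < S"
      using member_le_sum[of b Basis "\<lambda>b. \<bar>dirderiv b \<phi> x\<bar>"] that by (simp add: S_def)
  qed
  have "\<forall>\<^sub>F y in nhds x. y \<in> U \<and> \<sigma> * dirderiv b0 \<phi> y > A0 / 2 \<and> (\<forall>b\<in>Basis. \<bar>dirderiv b \<phi> y\<bar> < S)"
    by (intro eventually_conj eventually_nhds_in_open U ev1 eventually_ball_finite ballI ev2) auto
  then obtain R where R: "R > 0" "\<And>y. dist y x < R \<Longrightarrow> y \<in> U \<and> \<sigma> * dirderiv b0 \<phi> y > A0 / 2 \<and> (\<forall>b\<in>Basis. \<bar>dirderiv b \<phi> y\<bar> < S)"
    unfolding eventually_nhds_metric by blast
  define D where "D = ball x R"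
  have D: "y \<in> U" "\<sigma> * dirderiv b0 \<phi> y > A0 / 2" "b \<in> Basis \<Longrightarrow> \<bar>dirderiv b \<phi> y\<bar> < S" if "y \<in> D" for y b
    using R(2)[of y] that by (auto simp: D_def dist_commute)
  have DU: "D \<subseteq> U" using D(1) by blast
  have osd: "one_sided_domain D (\<Omega> \<inter> D) \<phi> (\<lambda>b. dirderiv b \<phi>) b0 \<sigma> (2 * S / A0)"
  proof
    show "\<Omega> \<inter> D = {y \<in> D. \<phi> y < 0}" using U(4) DU by auto
    show "continuous_on D \<phi>" by (rule continuous_on_subset[OF smooth_fun_on_partial(3)[OF U(3) b0] DU])
    show "continuous_on D (dirderiv b \<phi>)" "partial_on D b \<phi> (dirderiv b \<phi>)" if "b \<in> Basis" for b
      using smooth_fun_on_partial(1,2)[OF U(3) that] DU by (auto intro: continuous_on_subset partial_on_subset)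
    show "\<bar>dirderiv b \<phi> y\<bar> \<le> 2 * S / A0 * (\<sigma> * dirderiv b0 \<phi> y)" if "b \<in> Basis" "y \<in> D" for b y
    proof -
      have "\<bar>dirderiv b \<phi> y\<bar> \<le> 2 * S / A0 * (A0 / 2)" using D(3)[OF that(2,1)] A0 by simp
      also have "\<dots> \<le> 2 * S / A0 * (\<sigma> * dirderiv b0 \<phi> y)"
        using D(2)[OF that(2)] S0 A0 by (intro mult_left_mono) auto
      finally show ?thesis .
    qed
    show "2 * S / A0 \<ge> 0" using S0 A0 by simp
  qed (simp_all add: D_def b0 \<sigma>)
  have "smooth_zero_ext k (cyl \<Omega> T) (D \<times> {0<..<T}) (range dir_x) w"
  proof (rule smooth_zero_ext_of_words)
    fix ws :: "'n list" assume l: "length ws \<le> k"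
    show "cont_deriv (cyl \<Omega> T) (map dir_x ws) w" by (rule words[OF l])
    define X1 where "X1 = (D \<inter> closure \<Omega>) \<times> {0<..<T}"
    define X2 where "X2 = (D \<inter> - \<Omega>) \<times> {0<..<T}"
    have XX: "X1 \<union> X2 = D \<times> {0<..<T}" using closure_subset[of \<Omega>] by (auto simp: X1_def X2_def)
    have clO: "closure \<Omega> = \<Omega> \<union> frontier \<Omega>" by (rule closure_Un_frontier)
    have onF: "y \<in> frontier \<Omega> \<inter> U" if "y \<in> D" "y \<in> closure \<Omega>" "y \<notin> \<Omega>" for y using that DU clO by auto
    have "continuous_on (X1 \<union> X2) (\<lambda>p. if fst p \<in> closure \<Omega> then H ws p else 0)"
    proof (rule continuous_on_cases_local)
      have "X1 = (X1 \<union> X2) \<inter> (closure \<Omega> \<times> UNIV)" "X2 = (X1 \<union> X2) \<inter> ((- \<Omega>) \<times> UNIV)"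
        unfolding XX by (auto simp: X1_def X2_def)
      then show "closedin (top_of_set (X1 \<union> X2)) X1" "closedin (top_of_set (X1 \<union> X2)) X2"
        using closedin_closed_Int[of "closure \<Omega> \<times> UNIV" "X1 \<union> X2"] closedin_closed_Int[of "(- \<Omega>) \<times> UNIV" "X1 \<union> X2"] O
        by (auto intro!: closed_Times)
      show "continuous_on X1 (H ws)"
      proof (rule continuous_on_subset[OF Hc[OF l]])
        show "X1 \<subseteq> cyl (\<Omega> \<union> closure \<Gamma>) T"
          using onF Ub closure_subset[of \<Gamma>] unfolding X1_def cyl_def by blast
      qed
      show "H ws p = 0" if "p \<in> X1 \<and> \<not> fst p \<in> closure \<Omega> \<or> p \<in> X2 \<and> fst p \<in> closure \<Omega>" for p
      proof -
        have q: "p \<in> X2" "fst p \<in> closure \<Omega>" using that by (auto simp: X1_def)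
        then have "fst p \<in> \<Gamma> \<inter> smooth_boundary_part \<Omega>" "0 < snd p" "snd p < T" using onF Ub by (auto simp: X2_def)
        from Hz[OF l this] show ?thesis by simp
      qed
    qed simp
    moreover have "(if fst p \<in> closure \<Omega> then H ws p else 0) = zero_ext (cyl \<Omega> T) (foldr dirderiv (map dir_x ws) w) p"
      if p: "p \<in> D \<times> {0<..<T}" for p
    proof (cases "p \<in> cyl \<Omega> T")
      case True
      then show ?thesis using Hw[OF l True] closure_subset[of \<Omega>] by (auto simp: zero_ext_def cyl_def)
    next
      case False
      then have "fst p \<notin> \<Omega>" using p by (auto simp: cyl_def)
      then have "H ws p = 0" if "fst p \<in> closure \<Omega>"
        using Hz[OF l Ub[OF onF[OF _ that]], of "snd p"] p by auto
      then show ?thesis using False by (simp add: zero_ext_def)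
    qed
    ultimately show "continuous_on (D \<times> {0<..<T}) (zero_ext (cyl \<Omega> T) (foldr dirderiv (map dir_x ws) w))"
      unfolding XX by (subst continuous_on_cong[OF refl, symmetric]) auto
  qed
  then show "continuable_at \<Omega> T m w x"
    unfolding continuable_at_def k using osd R(1) unfolding D_def by blast
qed

theorem theorem2p2:
  fixes \<Omega> \<Gamma> :: "(real^'n) set" and m :: nat and T :: real
    and B :: "nat \<Rightarrow> 'n diff_op"
    and f :: "(real^'n) \<times> real \<Rightarrow> complex"
    and g :: "nat \<Rightarrow> (real^'n) \<times> real \<Rightarrow> complex"
    and u v :: "(real^'n) \<times> real \<Rightarrow> complex"
  assumes "m \<ge> 1" and "T > 0"
    and "bounded_domain \<Omega>" and "piecewise_smooth_boundary \<Omega>"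
    and "\<Gamma> \<noteq> {}" and "connected \<Gamma>" and "openin (top_of_set (frontier \<Omega>)) \<Gamma>"
    and "dirichlet_system \<Omega> (2 * m) B"
    and "(top_of_set (frontier \<Omega>)) interior_of \<Gamma> \<noteq> {}"
    and "continuous_on (closure (cyl \<Omega> T)) f"
    and "\<And>j. 1 \<le> j \<Longrightarrow> j \<le> 2 * m \<Longrightarrow> g j \<in> C_k_0_bdry (2 * m - j + 1) \<Omega> \<Gamma> T"
    and "cauchy_solution m \<Omega> \<Gamma> T B f g u"
    and "cauchy_solution m \<Omega> \<Gamma> T B f g v"
  shows "\<forall>p\<in>cyl \<Omega> T. u p = v p"
proof -
  define k where "k = 2 * m - 1"
  have km: "Suc k = 2 * m" using assms(1) by (simp add: k_def)
  have O: "open \<Omega>" and conn: "connected \<Omega>" using assms(3) by (auto simp: bounded_domain_def)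
  define W where "W = cyl \<Omega> T"
  have W: "open W" unfolding W_def by (rule open_cyl[OF O])
  have sol: "s \<in> C_2m_1 m \<Omega> T" "s \<in> C_k_0_upto k \<Omega> (closure \<Gamma>) T"
    "\<And>p. p \<in> W \<Longrightarrow> dirderiv dir_t s p + neg_laplace_pow m s p = f p"
    "\<And>j q. j \<le> k \<Longrightarrow> q \<in> cyl (closure \<Gamma>) T \<Longrightarrow> boundary_op \<Omega> T j (B j) s q = g (j + 1) q"
    if "cauchy_solution m \<Omega> \<Gamma> T B f g s" for s
    using that by (auto simp: cauchy_solution_def k_def W_def)
  note solu = sol[OF assms(12)] and solv = sol[OF assms(13)]
  have words: "cont_deriv W (map dir_x ws) s" if "s \<in> C_2m_1 m \<Omega> T" "length ws \<le> 2 * m" for s ws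
  proof -
    have "cont_deriv (cyl \<Omega> T) (replicate 0 dir_t @ map dir_x ws) s"
      using that unfolding C_2m_1_def mem_Collect_eq by (metis add.right_neutral mult_0_right)
    then show ?thesis by (simp add: W_def)
  qed
  have time: "partial_on W dir_t s (dirderiv dir_t s)" if "s \<in> C_2m_1 m \<Omega> T" for s
  proof (rule partial_on_dirderivI)
    have "cont_deriv (cyl \<Omega> T) (replicate 1 dir_t @ map dir_x []) s"
      using that unfolding C_2m_1_def mem_Collect_eq by (metis add_0 list.size(3) mult_1_right order_refl)
    then show "(\<lambda>r. s (p + r *\<^sub>R dir_t)) differentiable (at 0)" if "p \<in> W" for p
      using that by (simp add: cont_deriv_def W_def)
  qed
  have C: "smooth_zero_ext (2 * m) W W (range dir_x) s" if "s \<in> C_2m_1 m \<Omega> T" for s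
    by (rule smooth_zero_ext_of_words) (use words[OF that] in \<open>auto simp: zero_ext_cont_on cont_deriv_def\<close>)
  define w where "w = (\<lambda>p. u p - v p)"
  have Cw: "smooth_zero_ext (2 * m) W W (range dir_x) w" unfolding w_def by (rule smooth_zero_ext_diff[OF W C[OF solu(1)] C[OF solv(1)]])
  have wt: "partial_on W dir_t w (\<lambda>p. dirderiv dir_t u p - dirderiv dir_t v p)"
    unfolding w_def by (intro partial_on_diff time solu solv)
  have wd: "dirderiv dir_t w p = dirderiv dir_t u p - dirderiv dir_t v p" if "p \<in> W" for p
    by (rule partial_on_dirderiv[OF wt that])
  interpret parabolic_solution \<Omega> T m w
  proof (unfold_locales, fold W_def)
    show "partial_on W dir_t w (dirderiv dir_t w)"
      by (rule partial_on_transform[OF wt W]) (simp_all add: wd)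
    fix p assume p: "p \<in> W"
    have "neg_laplace_pow m w p = neg_laplace_pow m u p - neg_laplace_pow m v p"
      unfolding w_def by (rule neg_laplace_pow_diff[OF W C[OF solu(1)] C[OF solv(1)] p])
    moreover have "dirderiv dir_t u p + neg_laplace_pow m u p = dirderiv dir_t v p + neg_laplace_pow m v p"
      using solu(3)[OF p] solv(3)[OF p] by simp
    ultimately show "dirderiv dir_t w p + neg_laplace_pow m w p = 0"
      unfolding wd[OF p] by (metis (no_types, lifting) add_diff_add cancel_comm_monoid_add_class.diff_cancel)
  qed (fact O assms(1) Cw)+
  obtain H where H: "\<And>ws. length ws \<le> k \<Longrightarrow> continuous_on (cyl (\<Omega> \<union> closure \<Gamma>) T) (H ws)"
    "\<And>ws p. length ws \<le> k \<Longrightarrow> p \<in> cyl \<Omega> T \<Longrightarrow> H ws p = foldr dirderiv (map dir_x ws) (\<lambda>p. u p - v p) p"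
    "\<And>ws x t. length ws \<le> k \<Longrightarrow> x \<in> \<Gamma> \<inter> smooth_boundary_part \<Omega> \<Longrightarrow> 0 < t \<Longrightarrow> t < T \<Longrightarrow> H ws (x, t) = 0"
  proof (rule cauchy_data_vanish[OF O _ assms(7) solu(2) solv(2)])
    show "dirichlet_system \<Omega> (Suc k) B" using assms(8) by (simp only: km)
    show "boundary_op \<Omega> T j (B j) u q = boundary_op \<Omega> T j (B j) v q" if "j \<le> k" "q \<in> cyl (closure \<Gamma>) T" for j q
      using solu(4)[OF that] solv(4)[OF that] by simp
  qed (rule that)
  \<comment> \<open>the smooth pieces are dense in the boundary, so the relatively open set \<open>\<Gamma>\<close> meets one of them\<close>
  obtain z where z: "z \<in> \<Gamma> \<inter> smooth_boundary_part \<Omega>"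
  proof -
    obtain \<S> where \<S>: "\<And>S. S \<in> \<S> \<Longrightarrow> openin (top_of_set (frontier \<Omega>)) S \<and> S \<subseteq> smooth_boundary_part \<Omega>"
      "frontier \<Omega> = (\<Union>S\<in>\<S>. closure S)" using assms(4) unfolding piecewise_smooth_boundary_def by metis
    obtain N where N: "open N" "\<Gamma> = frontier \<Omega> \<inter> N" using assms(7) by (auto simp: openin_open)
    obtain y where y: "y \<in> \<Gamma>" using assms(5) by blast
    then obtain S where S: "S \<in> \<S>" "y \<in> closure S" using \<S>(2) N by blast
    then have "N \<inter> S \<noteq> {}" using y N open_Int_closure_eq_empty[of N S] by auto
    moreover have "S \<subseteq> frontier \<Omega>" using \<S>(1)[OF S(1)] openin_imp_subset by blast
    ultimately show thesis using that \<S>(1)[OF S(1)] N by blast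
  qed
  have zf: "z \<in> frontier \<Omega>" using z by (simp add: smooth_boundary_part_def)
  have wwords: "cont_deriv (cyl \<Omega> T) (map dir_x ws) w" if l: "length ws \<le> k" for ws
  proof -
    have "derivs_exist W vs w \<and> continuous_on W (foldr dirderiv vs w)" if "smooth_zero_ext (length vs) W W (range dir_x) w" "set vs \<subseteq> range dir_x" for vs
      using that
    proof (induction vs)
      case (Cons a vs)
      have "smooth_zero_ext (length vs + Suc 0) W W (range dir_x) w" using Cons.prems(1) by (simp del: smooth_zero_ext.simps)
      then have c: "smooth_zero_ext (Suc 0) W W (range dir_x) (foldr dirderiv vs w)" by (rule smooth_zero_ext_foldr) (use Cons.prems in auto)
      have a: "a \<in> range dir_x" using Cons.prems by simp
      have "(\<lambda>s. foldr dirderiv vs w (p + s *\<^sub>R a)) differentiable (at 0)" if "p \<in> W" for p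
        using smooth_zero_ext_partial[OF c a] that unfolding partial_on_def by (blast intro: differentiableI_vector)
      moreover have "continuous_on W (dirderiv a (foldr dirderiv vs w))" using c a by (auto simp: zero_ext_cont_on)
      moreover have "smooth_zero_ext (length vs) W W (range dir_x) w"
        by (rule smooth_zero_ext_Suc_D) (use Cons.prems(1) in \<open>simp del: smooth_zero_ext.simps\<close>)
      ultimately show ?case using Cons.IH Cons.prems(2) by (simp del: smooth_zero_ext.simps)
    qed (simp add: zero_ext_cont_on)
    from this[of "map dir_x ws"] smooth_zero_ext_mono[OF Cw, of "length ws"] l km show ?thesis
      by (auto simp: cont_deriv_def W_def)
  qed
  note cb = continuable_boundary_point[OF O assms(7) z k_def wwords H[folded w_def]]
  show ?thesis
  proof
    fix p assume p: "p \<in> cyl \<Omega> T"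
    have "Re (w p) = 0" by (rule solution_zero[OF conn cb(1) zf cb(2) p bounded_linear_Re])
    moreover have "Im (w p) = 0" by (rule solution_zero[OF conn cb(1) zf cb(2) p bounded_linear_Im])
    ultimately show "u p = v p" by (simp add: w_def complex_eq_iff)
  qed
qed

end
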